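(* Let $n\in\mathbb N$ and let $K\subset\mathbb R$ be a symmetric set such that $K^+=K\cap[0,\infty)$ is the union of $n$ disjoint intervals, $K^+=I_1\cup\dots\cup I_n$. Then $K$ is a wavelet set of $L^2(\mathbb R)$ if and only if there exist: (i) an $n$-tuple $\epsilon=(\epsilon_1,\dots,\epsilon_n)\in\{-1,1\}^n$; (ii) a permutation $\tau\in\Sigma_{n-1}$ on the set $\{1,\dots,n-1\}$; (iii) a vector $a=(a_0,a_1,\dots,a_n)$ of real numbers that satisfy $0=a_0<a_1<\dots<a_n=\frac12$; (iv) a vector $m=(m_1,\dots,m_n)$ of nonnegative integers; (v) a vector $\lambda=(\lambda_1,\dots,\lambda_n)$ of integers; such that (a) $I_j=\epsilon_j[a_{j-1},a_j]+m_j$, $j=1,\dots,n$; (b) the intervals $H_k=[\alpha_k,\beta_k]$, $1\le k\le n$, defined by $H_{\tau(j)}=2^{-\lambda_j}I_j$, $j=1,\dots,n-1$, and $H_n=I_n$, are such that $2\alpha_1=\beta_n$ and $\beta_k=\alpha_{k+1}$ if $1\le k\le n-1$; (c) $\epsilon$ and $m$ satisfy the condition: if $\epsilon_j=\epsilon_{j+1}$, then $m_j\ne m_{j+1}$. Moreover, the wavelet sets relative to $\epsilon\in\{1,-1\}^n$ are made up of $2n$ disjoint intervals, and different sets of data give different wavelet sets.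
   Context: Fourier transform: $\widehat\psi(\xi)=\int_{\mathbb R}\psi(x)e^{-2\pi i x\xi}\,dx$. An orthonormal wavelet is a function $\psi\in L^2(\mathbb R)$ such that $\{2^{j/2}\psi(2^jx-k): j,k\in\mathbb Z\}$ is an orthonormal basis of $L^2(\mathbb R)$. A (Lebesgue measurable) set $K\subset\mathbb R$ is a wavelet set of $L^2(\mathbb R)$ if there is an orthonormal wavelet $\psi$ with $|\widehat\psi|=\chi_K$ a.e. The set $K$ is symmetric if $K\cap(-\infty,0]=-(K\cap[0,\infty))$. $\Sigma_{n-1}$ denotes the set of permutations of $\{1,\dots,n-1\}$ (for $n=1$, the permutation on the empty set is a dummy symbol). For an interval $[b,c]$, $\epsilon\in\{-1,1\}$ and $m\in\mathbb Z$, $\epsilon[b,c]+m=\{\epsilon x+m: x\in[b,c]\}$. A set of data is a tuple $(n,\epsilon,\tau,a,m,\lambda)$ as in the claim.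
   Formalization: Intervals are closed and nondegenerate, and the labelling I_1,…,I_n is taken up to a permutation, as (a) forces; "different sets of data give different wavelet sets" is proved for all data except λ_n, which enters no condition (H_n = I_n) and so is not determined. *)

theory Defs
  imports "HOL-Analysis.Analysis"
begin

definition L2_fun :: "(real \<Rightarrow> complex) \<Rightarrow> bool" where
  "L2_fun f \<longleftrightarrow>
     f \<in> borel_measurable lebesgue \<and> integrable lebesgue (\<lambda>x. (cmod (f x))\<^sup>2)"

definition L2_inner :: "(real \<Rightarrow> complex) \<Rightarrow> (real \<Rightarrow> complex) \<Rightarrow> complex" where
  "L2_inner f g = (LINT x|lebesgue. f x * cnj (g x))"

definition L2_sqdist :: "(real \<Rightarrow> complex) \<Rightarrow> (real \<Rightarrow> complex) \<Rightarrow> ennreal" where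
  "L2_sqdist f g = (\<integral>\<^sup>+x. ennreal ((cmod (f x - g x))\<^sup>2) \<partial>lebesgue)"

definition L2_orthonormal_basis :: "('i \<Rightarrow> real \<Rightarrow> complex) \<Rightarrow> bool" where
  "L2_orthonormal_basis e \<longleftrightarrow>
     (\<forall>i. L2_fun (e i)) \<and>
     (\<forall>i i'. L2_inner (e i) (e i') = (if i = i' then 1 else 0)) \<and>
     (\<forall>f. L2_fun f \<longrightarrow>
        (\<forall>r>0. \<exists>F c. finite F \<and>
           L2_sqdist f (\<lambda>x. \<Sum>i\<in>F. c i * e i x) < ennreal r))"

definition fourier_integral :: "(real \<Rightarrow> complex) \<Rightarrow> real \<Rightarrow> complex" where
  "fourier_integral f \<xi> =
     (LINT x|lebesgue. f x * exp (- 2 * complex_of_real pi * \<i> * of_real (x * \<xi>)))"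

text \<open>
  For a square integrable function the Fourier integral need not converge absolutely.
  The transform is the limit in mean, as \<open>R\<close> tends to infinity, of the Fourier integrals of
  the truncations to \<open>[-R, R]\<close>, which are integrable. It is determined only up to null
  sets, hence the relational form.
\<close>

definition has_L2_fourier_transform ::
    "(real \<Rightarrow> complex) \<Rightarrow> (real \<Rightarrow> complex) \<Rightarrow> bool" where
  "has_L2_fourier_transform f g \<longleftrightarrow>
     L2_fun f \<and> L2_fun g \<and>
     ((\<lambda>R. L2_sqdist (fourier_integral (\<lambda>x. indicator {-R..R} x * f x)) g) \<longlongrightarrow> 0) at_top"

definition wavelet_system :: "(real \<Rightarrow> complex) \<Rightarrow> int \<times> int \<Rightarrow> real \<Rightarrow> complex" where
  "wavelet_system \<psi> = (\<lambda>(j, k) x.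
     of_real (2 powr (of_int j / 2)) * \<psi> (2 powi j * x - of_int k))"

definition orthonormal_wavelet :: "(real \<Rightarrow> complex) \<Rightarrow> bool" where
  "orthonormal_wavelet \<psi> \<longleftrightarrow> L2_fun \<psi> \<and> L2_orthonormal_basis (wavelet_system \<psi>)"

definition wavelet_set :: "real set \<Rightarrow> bool" where
  "wavelet_set K \<longleftrightarrow>
     K \<in> sets lebesgue \<and>
     (\<exists>\<psi> g. orthonormal_wavelet \<psi> \<and> has_L2_fourier_transform \<psi> g \<and>
        (AE \<xi> in lebesgue. cmod (g \<xi>) = indicator K \<xi>))"

definition symmetric_set :: "real set \<Rightarrow> bool" where
  "symmetric_set K \<longleftrightarrow> K \<inter> {..0} = uminus ` (K \<inter> {0..})"

text \<open>
  Intervals are closed and not reduced to a point. Closedness matters: disjoint half-open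
  intervals could be adjacent, and then the number of intervals is not determined by
  their union.
\<close>

definition disjoint_intervals :: "nat \<Rightarrow> (nat \<Rightarrow> real set) \<Rightarrow> bool" where
  "disjoint_intervals n I \<longleftrightarrow>
     (\<forall>j\<in>{1..n}. is_interval (I j) \<and> closed (I j) \<and> interior (I j) \<noteq> {}) \<and>
     disjoint_family_on I {1..n}"

text \<open>
  Vectors are functions on \<^typ>\<open>nat\<close>, of which only the entries with index in
  \<open>{1..n}\<close> (\<open>{0..n}\<close> for \<open>a\<close>) are relevant.
\<close>

definition data_interval ::
    "(nat \<Rightarrow> int) \<Rightarrow> (nat \<Rightarrow> real) \<Rightarrow> (nat \<Rightarrow> nat) \<Rightarrow> nat \<Rightarrow> real set" where
  "data_interval \<epsilon> a m j = (\<lambda>x. of_int (\<epsilon> j) * x + of_nat (m j)) ` {a (j - 1)..a j}"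

text \<open>
  The entry \<open>lam n\<close> is not constrained, since the \<open>n\<close>-th interval is
  not rescaled: sets of data that differ only in it describe the same subset of the line.
\<close>

definition wavelet_data ::
    "nat \<Rightarrow> (nat \<Rightarrow> int) \<Rightarrow> (nat \<Rightarrow> nat) \<Rightarrow> (nat \<Rightarrow> real) \<Rightarrow> (nat \<Rightarrow> nat) \<Rightarrow> (nat \<Rightarrow> int) \<Rightarrow> bool"
  where
  "wavelet_data n \<epsilon> \<tau> a m lam \<longleftrightarrow>
     n \<ge> 1 \<and>
     (\<forall>j\<in>{1..n}. \<epsilon> j \<in> {-1, 1}) \<and>
     \<tau> permutes {1..n - 1} \<and>
     a 0 = 0 \<and> (\<forall>j\<in>{1..n}. a (j - 1) < a j) \<and> a n = 1 / 2 \<and>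
     (\<exists>\<alpha> \<beta>.
        (\<forall>j\<in>{1..n - 1}. {\<alpha> (\<tau> j)..\<beta> (\<tau> j)} =
           (\<lambda>x. 2 powi (- lam j) * x) ` data_interval \<epsilon> a m j) \<and>
        {\<alpha> n..\<beta> n} = data_interval \<epsilon> a m n \<and>
        2 * \<alpha> 1 = \<beta> n \<and>
        (\<forall>k\<in>{1..n - 1}. \<beta> k = \<alpha> (k + 1))) \<and>
     (\<forall>j\<in>{1..n - 1}. \<epsilon> j = \<epsilon> (j + 1) \<longrightarrow> m j \<noteq> m (j + 1))"

definition data_set ::
    "nat \<Rightarrow> (nat \<Rightarrow> int) \<Rightarrow> (nat \<Rightarrow> real) \<Rightarrow> (nat \<Rightarrow> nat) \<Rightarrow> real set" where
  "data_set n \<epsilon> a m =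
     (\<Union>j\<in>{1..n}. data_interval \<epsilon> a m j \<union> uminus ` data_interval \<epsilon> a m j)"

end

theory Submission
  imports Defs
begin

text \<open>
  By Plancherel's identity, a bounded set \<open>K\<close> is a wavelet set if and only if, for some \<open>g\<close>
  with \<open>|g| = \<chi>\<^sub>K\<close>, the functions \<open>2\<^bsup>-j/2\<^esup> g(2\<^bsup>-j\<^esup> \<xi>) exp(-2\<pi>ik 2\<^bsup>-j\<^esup> \<xi>)\<close> form an
  orthonormal basis. Comparing Fourier coefficients of periodizations, this holds if and only if \<open>K\<close>
  tiles the line almost everywhere both by integer translations and by dilations by powers of 2.

  For symmetric \<open>K\<close> whose positive part consists of intervals \<open>I\<^sub>j\<close>, the translation tiling says
  that the distance to the nearest integer folds the \<open>I\<^sub>j\<close> onto a partition of \<open>[0, 1/2]\<close>, which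
  yields \<open>\<epsilon>\<close>, \<open>a\<close> and \<open>m\<close>. If \<open>\<beta>\<close> is the right end of the interval folded onto the last cell,
  the dilation tiling says that powers of 2 carry the \<open>I\<^sub>j\<close> onto a partition of \<open>[\<beta>/2, \<beta>]\<close>,
  which yields \<open>\<tau>\<close> and \<open>\<lambda>\<close>.

  Plancherel's identity for compactly supported \<open>f\<close> is obtained by integrating over \<open>\<xi>\<close> Parseval's
  identity for the values of the Fourier transform of \<open>f\<close> at the points \<open>\<xi> + k/L\<close>.
\<close>

subsection \<open>Square integrable functions\<close>

text \<open>Only the modulus of \<open>g\<close> is prescribed, while the tilings are statements
  about \<open>K\<close> alone. Orthogonality within one scale involves \<open>g * cnj g\<close>,
  where the phase cancels. Across scales it does not cancel; there the translation tiling, obtained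
  first, leaves at most one nonzero term in the periodization, so that a vanishing sum means a
  vanishing product. Boundedness of \<open>K\<close> keeps the functions on the frequency side
  compactly supported: transforms are absolutely convergent integrals and periodizations are finite
  sums. Adjointness of the two transforms together with Plancherel's identity carries distances from
  one side to the other. The tilings hold almost everywhere, but the data are exact. Closed
  intervals bridge this gap: a closed set that contains almost every point of an open interval
  contains its closure, and an overlap of positive length cannot hide in a null set. Condition (c)
  excludes just the case in which adjacent cells unfold to intervals with a common end
  point.\<close>

lemma ident_borel_measurable_lebesgue [measurable]:
  "(\<lambda>x. x) \<in> borel_measurable (lebesgue :: real measure)"
  by (rule measurable_completion) simp

definition L2_sq :: "(real \<Rightarrow> complex) \<Rightarrow> real" where
  "L2_sq f = (LINT x|lebesgue. (cmod (f x))\<^sup>2)"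

lemma L2_fun_measurable [measurable_dest]: "L2_fun f \<Longrightarrow> f \<in> borel_measurable lebesgue"
  by (simp add: L2_fun_def)

lemma L2_fun_integrable_sq: "L2_fun f \<Longrightarrow> integrable lebesgue (\<lambda>x. (cmod (f x))\<^sup>2)"
  by (simp add: L2_fun_def)

lemma L2_sq_nonneg: "0 \<le> L2_sq f"
  by (simp add: L2_sq_def)

lemma L2_fun_dominated:
  assumes "L2_fun f" "g \<in> borel_measurable lebesgue" "\<And>x. cmod (g x) \<le> B * cmod (f x)"
  shows "L2_fun g"
  unfolding L2_fun_def
proof
  show "integrable lebesgue (\<lambda>x. (cmod (g x))\<^sup>2)"
  proof (rule Bochner_Integration.integrable_bound)
    show "integrable lebesgue (\<lambda>x. B\<^sup>2 * (cmod (f x))\<^sup>2)"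
      using L2_fun_integrable_sq[OF assms(1)] by simp
    show "AE x in lebesgue. norm ((cmod (g x))\<^sup>2) \<le> norm (B\<^sup>2 * (cmod (f x))\<^sup>2)"
      using assms(3) power_mono[OF assms(3), of _ 2]
      by (auto simp: power_mult_distrib intro!: AE_I2)
  qed (use assms(2) in measurable)
qed (use assms in simp)

lemma norm_add_sq_le: "(cmod (a + b))\<^sup>2 \<le> 2 * (cmod a)\<^sup>2 + 2 * (cmod b)\<^sup>2"
proof -
  have "(cmod (a + b))\<^sup>2 \<le> (cmod a + cmod b)\<^sup>2"
    by (intro power_mono norm_triangle_ineq) auto
  also have "\<dots> \<le> 2 * (cmod a)\<^sup>2 + 2 * (cmod b)\<^sup>2"
    using sum_squares_bound[of "cmod a" "cmod b"] by (simp add: power2_sum)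
  finally show ?thesis .
qed

lemma L2_fun_add: assumes "L2_fun f" "L2_fun g" shows "L2_fun (\<lambda>x. f x + g x)"
  unfolding L2_fun_def
proof
  note [measurable] = assms
  show "(\<lambda>x. f x + g x) \<in> borel_measurable lebesgue" by measurable
  show "integrable lebesgue (\<lambda>x. (cmod (f x + g x))\<^sup>2)"
  proof (rule Bochner_Integration.integrable_bound)
    show "integrable lebesgue (\<lambda>x. 2 * (cmod (f x))\<^sup>2 + 2 * (cmod (g x))\<^sup>2)"
      using assms[THEN L2_fun_integrable_sq] by simp
    show "AE x in lebesgue. norm ((cmod (f x + g x))\<^sup>2) \<le> norm (2 * (cmod (f x))\<^sup>2 + 2 * (cmod (g x))\<^sup>2)"
      using norm_add_sq_le by (auto intro!: AE_I2)
  qed measurable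
qed

lemma L2_fun_cmult: "L2_fun f \<Longrightarrow> L2_fun (\<lambda>x. c * f x)"
  by (rule L2_fun_dominated[of f _ "cmod c"]) (auto simp: norm_mult)

lemma L2_fun_diff: "L2_fun f \<Longrightarrow> L2_fun g \<Longrightarrow> L2_fun (\<lambda>x. f x - g x)"
  using L2_fun_add[of f "\<lambda>x. -1 * g x"] L2_fun_cmult[of g "-1"] by simp

lemma L2_fun_0: "L2_fun (\<lambda>x. 0)"
  by (simp add: L2_fun_def)

lemma L2_fun_sum: "(\<And>i. i \<in> A \<Longrightarrow> L2_fun (f i)) \<Longrightarrow> L2_fun (\<lambda>x. \<Sum>i\<in>A. f i x)"
  by (induction A rule: infinite_finite_induct) (auto intro: L2_fun_add L2_fun_0)

lemma L2_fun_indicator_mult: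
  "L2_fun f \<Longrightarrow> S \<in> sets lebesgue \<Longrightarrow> L2_fun (\<lambda>x. indicator S x * f x)"
  by (rule L2_fun_dominated[of f _ 1]) (auto simp: indicator_def)

lemma L2_prod_integrable:
  assumes "L2_fun f" "L2_fun g"
  shows "integrable lebesgue (\<lambda>x. f x * cnj (g x))"
proof (rule Bochner_Integration.integrable_bound)
  note [measurable] = assms
  show "integrable lebesgue (\<lambda>x. (cmod (f x))\<^sup>2 + (cmod (g x))\<^sup>2)"
    using assms[THEN L2_fun_integrable_sq] by simp
  show "AE x in lebesgue. norm (f x * cnj (g x)) \<le> norm ((cmod (f x))\<^sup>2 + (cmod (g x))\<^sup>2)"
  proof (rule AE_I2)
    fix x
    have "2 * (cmod (f x) * cmod (g x)) \<le> (cmod (f x))\<^sup>2 + (cmod (g x))\<^sup>2"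
      using sum_squares_bound[of "cmod (f x)" "cmod (g x)"] by simp
    moreover have "0 \<le> cmod (f x) * cmod (g x)" by simp
    ultimately have "cmod (f x) * cmod (g x) \<le> (cmod (f x))\<^sup>2 + (cmod (g x))\<^sup>2" by linarith
    also have "\<dots> \<le> norm ((cmod (f x))\<^sup>2 + (cmod (g x))\<^sup>2)" by simp
    finally show "norm (f x * cnj (g x)) \<le> norm ((cmod (f x))\<^sup>2 + (cmod (g x))\<^sup>2)"
      by (simp only: norm_mult complex_mod_cnj)
  qed
  show "(\<lambda>x. f x * cnj (g x)) \<in> borel_measurable lebesgue"
    by (intro borel_measurable_times borel_measurable_continuous_on[of cnj] continuous_intros) measurable
qed

lemma L2_inner_self: "L2_inner f f = of_real (L2_sq f)"
  unfolding L2_inner_def L2_sq_def integral_complex_of_real[symmetric]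
  by (simp add: complex_norm_square[symmetric])

lemma L2_inner_commute: "L2_inner g f = cnj (L2_inner f g)"
  unfolding L2_inner_def
  using Bochner_Integration.integral_cnj[of lebesgue "\<lambda>x. f x * cnj (g x)"] by (simp add: mult.commute)

lemma L2_inner_cmult_left: "L2_inner (\<lambda>x. c * f x) h = c * L2_inner f h"
  unfolding L2_inner_def by (simp add: mult.assoc)

lemma L2_inner_sum_left:
  assumes "\<And>i. i \<in> A \<Longrightarrow> L2_fun (f i)" "L2_fun h"
  shows "L2_inner (\<lambda>x. \<Sum>i\<in>A. f i x) h = (\<Sum>i\<in>A. L2_inner (f i) h)"
  unfolding L2_inner_def
  by (simp add: sum_distrib_right assms L2_prod_integrable)

lemma L2_sq_diff:
  assumes "L2_fun f" "L2_fun g"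
  shows "L2_sq (\<lambda>x. f x - g x) = L2_sq f - 2 * Re (L2_inner f g) + L2_sq g"
proof -
  have "(cmod (f x - g x))\<^sup>2 = (cmod (f x))\<^sup>2 - 2 * Re (f x * cnj (g x)) + (cmod (g x))\<^sup>2" for x
    unfolding cmod_power2 by (simp add: power2_eq_square algebra_simps)
  moreover have "(LINT x|lebesgue. Re (f x * cnj (g x))) = Re (L2_inner f g)"
    unfolding L2_inner_def using L2_prod_integrable[OF assms] by (rule integral_Re)
  moreover have "integrable lebesgue (\<lambda>x. Re (f x * cnj (g x)))"
    using L2_prod_integrable[OF assms] by (rule integrable_Re)
  ultimately show ?thesis
    unfolding L2_sq_def using assms[THEN L2_fun_integrable_sq]
    by (simp only: Bochner_Integration.integral_add Bochner_Integration.integral_diff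
        Bochner_Integration.integrable_diff integrable_mult_right integral_mult_right_zero)
qed

text \<open>The factor 2 is the price of working with squared norms; error budgets such as
  \<open>e / 4\<close> and \<open>e / 12\<close> come from it.\<close>

lemma L2_sq_triangle:
  assumes "L2_fun f" "L2_fun g" "L2_fun h"
  shows "L2_sq (\<lambda>x. f x - h x) \<le> 2 * L2_sq (\<lambda>x. f x - g x) + 2 * L2_sq (\<lambda>x. g x - h x)"
proof -
  have "L2_sq (\<lambda>x. f x - h x) \<le>
      (LINT x|lebesgue. 2 * (cmod (f x - g x))\<^sup>2 + 2 * (cmod (g x - h x))\<^sup>2)"
    unfolding L2_sq_def
  proof (rule integral_mono)
    show "(cmod (f x - h x))\<^sup>2 \<le> 2 * (cmod (f x - g x))\<^sup>2 + 2 * (cmod (g x - h x))\<^sup>2" for x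
      using norm_add_sq_le[of "f x - g x" "g x - h x"] by simp
  qed (use L2_fun_integrable_sq[OF L2_fun_diff] assms in auto)
  also have "\<dots> = 2 * L2_sq (\<lambda>x. f x - g x) + 2 * L2_sq (\<lambda>x. g x - h x)"
    unfolding L2_sq_def using L2_fun_integrable_sq[OF L2_fun_diff] assms by simp
  finally show ?thesis .
qed

lemma L2_sq_sym: "L2_sq (\<lambda>x. f x - g x) = L2_sq (\<lambda>x. g x - f x)"
  unfolding L2_sq_def by (simp add: norm_minus_commute)

lemma L2_sqdist_eq:
  "L2_fun f \<Longrightarrow> L2_fun g \<Longrightarrow> L2_sqdist f g = ennreal (L2_sq (\<lambda>x. f x - g x))"
  unfolding L2_sqdist_def L2_sq_def
  by (intro nn_integral_eq_integral L2_fun_integrable_sq[OF L2_fun_diff]) auto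

lemma L2_sq_eq_0_iff:
  assumes "L2_fun f"
  shows "L2_sq f = 0 \<longleftrightarrow> (AE x in lebesgue. f x = 0)"
  unfolding L2_sq_def
  by (subst integral_nonneg_eq_0_iff_AE) (use L2_fun_integrable_sq[OF assms] in auto)

lemma L2_sq_cong_AE:
  assumes "f \<in> borel_measurable lebesgue" "g \<in> borel_measurable lebesgue"
    "AE x in lebesgue. f x = g x"
  shows "L2_sq f = L2_sq g"
  unfolding L2_sq_def using assms by (intro integral_cong_AE) auto

lemma L2_inner_cong_AE:
  assumes "L2_fun f" "L2_fun f'" "L2_fun g" "L2_fun g'"
    "AE x in lebesgue. f x = f' x" "AE x in lebesgue. g x = g' x"
  shows "L2_inner f g = L2_inner f' g'"
  unfolding L2_inner_def
proof (rule integral_cong_AE)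
  show "AE x in lebesgue. f x * cnj (g x) = f' x * cnj (g' x)"
    using assms(5,6) by eventually_elim simp
qed (use L2_prod_integrable assms in \<open>auto intro: borel_measurable_integrable\<close>)

lemma L2_inner_eq_0_disjoint: "(\<And>x. f x = 0 \<or> g x = 0) \<Longrightarrow> L2_inner f g = 0"
proof -
  assume "\<And>x. f x = 0 \<or> g x = 0"
  hence "(\<lambda>x. f x * cnj (g x)) = (\<lambda>x. 0)" by (metis complex_cnj_zero mult_eq_0_iff)
  thus ?thesis by (simp add: L2_inner_def)
qed

section \<open>Square integrable functions of compact support\<close>

definition L2_compact :: "(real \<Rightarrow> complex) \<Rightarrow> bool" where
  "L2_compact f \<longleftrightarrow> L2_fun f \<and> (\<exists>M. \<forall>x. \<bar>x\<bar> > M \<longrightarrow> f x = 0)"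

lemma L2_compactE:
  assumes "L2_compact f"
  obtains M where "M > 0" "\<And>x. \<bar>x\<bar> > M \<Longrightarrow> f x = 0" "L2_fun f"
proof -
  obtain M where M: "\<forall>x. \<bar>x\<bar> > M \<longrightarrow> f x = 0" and "L2_fun f"
    using assms unfolding L2_compact_def by auto
  thus ?thesis using that[of "max M 1"] by auto
qed

lemma L2_compact_L2 [simp]: "L2_compact f \<Longrightarrow> L2_fun f"
  by (simp add: L2_compact_def)

lemma L2_compact_diff:
  assumes "L2_compact f" "L2_compact g" shows "L2_compact (\<lambda>x. f x - g x)"
proof -
  obtain M N where "\<And>x. \<bar>x\<bar> > M \<Longrightarrow> f x = 0" "\<And>x. \<bar>x\<bar> > N \<Longrightarrow> g x = 0"
    using assms L2_compactE by metis
  thus ?thesis unfolding L2_compact_def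
    using L2_fun_diff[of f g] assms by (auto intro!: exI[of _ "max M N"])
qed

lemma L2_compact_cmult: "L2_compact f \<Longrightarrow> L2_compact (\<lambda>x. c * f x)"
  unfolding L2_compact_def by (auto intro: L2_fun_cmult)

lemma L2_compact_0: "L2_compact (\<lambda>x. 0)"
  by (simp add: L2_compact_def L2_fun_0)

lemma L2_compact_sum: "(\<And>i. i \<in> A \<Longrightarrow> L2_compact (f i)) \<Longrightarrow> L2_compact (\<lambda>x. \<Sum>i\<in>A. f i x)"
proof (induction A rule: infinite_finite_induct)
  case (insert a A)
  have "L2_compact (\<lambda>x. f a x - (-1) * (\<Sum>i\<in>A. f i x))"
    by (intro L2_compact_diff L2_compact_cmult) (use insert in auto)
  thus ?case using insert by simp
qed (auto intro: L2_compact_0)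

lemma integrable_bounded_support:
  fixes g :: "real \<Rightarrow> complex"
  assumes "g \<in> borel_measurable lebesgue" "\<And>x. cmod (g x) \<le> B" "\<And>x. \<bar>x\<bar> > M \<Longrightarrow> g x = 0"
  shows "integrable lebesgue g"
proof (rule Bochner_Integration.integrable_bound)
  show "integrable lebesgue (\<lambda>x. B * indicator {-M..M} x)"
      by (intro integrable_mult_right integrable_real_indicator) (auto simp: emeasure_lborel_Icc_eq)
  show "AE x in lebesgue. norm (g x) \<le> norm (B * indicator {-M..M} x)"
  proof (rule AE_I2)
    fix x show "norm (g x) \<le> norm (B * indicator {-M..M} x)"
      using assms(2,3)[of x] by (cases "\<bar>x\<bar> > M") (auto simp: indicator_def)
  qed
qed (use assms in auto)

lemma L2_fun_bounded_support:
  assumes "g \<in> borel_measurable lebesgue" "\<And>x. cmod (g x) \<le> B" "\<And>x. \<bar>x\<bar> > M \<Longrightarrow> g x = 0"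
  shows "L2_fun g"
proof -
  note [measurable] = assms(1)
  have "integrable lebesgue (\<lambda>x. complex_of_real ((cmod (g x))\<^sup>2))"
    by (rule integrable_bounded_support[where B="B\<^sup>2" and M=M])
      (use assms power_mono[OF assms(2), of _ 2] in \<open>auto simp: norm_power\<close>)
  hence "integrable lebesgue (\<lambda>x. Re (complex_of_real ((cmod (g x))\<^sup>2)))"
    by (rule integrable_Re)
  thus ?thesis using assms unfolding L2_fun_def by simp
qed

lemma L2_compact_bounded:
  assumes "g \<in> borel_measurable lebesgue" "\<And>x. cmod (g x) \<le> B" "\<And>x. \<bar>x\<bar> > M \<Longrightarrow> g x = 0"
  shows "L2_compact g"
  using L2_fun_bounded_support[OF assms] assms(3) unfolding L2_compact_def by blast

text \<open>The product with the indicator of a bounded interval around the support is integrable.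
  This is what makes the Fourier integrals of such functions converge absolutely.\<close>

lemma L2_compact_integrable:
  assumes "L2_compact f" shows "integrable lebesgue f"
proof -
  obtain M where M: "M > 0" "\<And>x. \<bar>x\<bar> > M \<Longrightarrow> f x = 0" "L2_fun f"
    using L2_compactE assms by metis
  have "L2_fun (\<lambda>x. complex_of_real (indicator {-M..M} x))"
  proof (rule L2_fun_bounded_support)
    show "(\<lambda>x. complex_of_real (indicator {-M..M} x)) \<in> borel_measurable lebesgue" by measurable
    show "cmod (complex_of_real (indicator {-M..M} x)) \<le> 1" for x by (simp split: split_indicator)
    show "\<bar>x\<bar> > M \<Longrightarrow> complex_of_real (indicator {-M..M} x) = 0" for x by (auto split: split_indicator)
  qed
  from L2_prod_integrable[OF M(3) this]
  have "integrable lebesgue (\<lambda>x. f x * cnj (complex_of_real (indicator {-M..M} x)))" .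
  moreover have "(\<lambda>x. f x * cnj (complex_of_real (indicator {-M..M} x))) = f"
    using M(2) by (force split: split_indicator)
  ultimately show ?thesis by simp
qed

lemma L2_compact_indicator_mult:
  "L2_fun f \<Longrightarrow> L2_compact (\<lambda>x. indicator {-R..R} x * f x)"
  unfolding L2_compact_def using L2_fun_indicator_mult[of f "{-R..R}"]
  by (auto intro!: exI[of _ R] split: split_indicator)

section \<open>Convergence in mean\<close>

lemma L2_dominated_convergence:
  assumes s: "\<And>n. s n \<in> borel_measurable lebesgue" and f: "f \<in> borel_measurable lebesgue"
    and w: "L2_fun w"
    and lim: "AE x in lebesgue. (\<lambda>n. s n x) \<longlonglongrightarrow> f x"
    and dom: "\<And>n. AE x in lebesgue. cmod (s n x) \<le> cmod (w x)"
  shows "(\<lambda>n. L2_sq (\<lambda>x. f x - s n x)) \<longlonglongrightarrow> 0"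
proof -
  note [measurable] = s f
  have "AE x in lebesgue. \<forall>n. cmod (s n x) \<le> cmod (w x)"
    using dom by (simp add: AE_all_countable)
  \<comment> \<open>The limit inherits the bound \<open>cmod (w x)\<close> from the terms, so four
    times the square of \<open>cmod (w x)\<close> dominates the squared differences.\<close>
  hence dom': "AE x in lebesgue. \<forall>n. cmod (f x - s n x) \<le> 2 * cmod (w x)"
    using lim
  proof eventually_elim
    case (elim x)
    have "cmod (f x) \<le> cmod (w x)"
      by (rule Lim_bounded[OF tendsto_norm[OF elim(2)], of 0]) (use elim in auto)
    thus ?case using elim(1) norm_triangle_ineq4[of "f x"]
      by (smt (verit, best))
  qed
  have "(\<lambda>n. LINT x|lebesgue. (cmod (f x - s n x))\<^sup>2) \<longlonglongrightarrow> (LINT x::real|lebesgue. (0::real))"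
  proof (rule integral_dominated_convergence)
    show "integrable lebesgue (\<lambda>x. 4 * (cmod (w x))\<^sup>2)"
      using L2_fun_integrable_sq[OF w] by simp
    show "AE x in lebesgue. norm ((cmod (f x - s n x))\<^sup>2) \<le> 4 * (cmod (w x))\<^sup>2" for n
      using dom'
    proof eventually_elim
      case (elim x)
      thus ?case using power_mono[of "cmod (f x - s n x)" "2 * cmod (w x)" 2] by (simp add: power_mult_distrib)
    qed
    show "AE x in lebesgue. (\<lambda>n. (cmod (f x - s n x))\<^sup>2) \<longlonglongrightarrow> 0"
      using lim
    proof eventually_elim
      case (elim x)
      have "(\<lambda>n. (cmod (f x - s n x))\<^sup>2) \<longlonglongrightarrow> (cmod (f x - f x))\<^sup>2"
        by (intro tendsto_intros elim)
      thus ?case by simp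
    qed
  qed measurable
  thus ?thesis by (simp add: L2_sq_def)
qed

text \<open>Stated for every sequence \<open>r\<close> that tends to infinity, so that it also
  yields the limit along the reals in the definition of the transform.\<close>

lemma L2_sq_indicator_tendsto:
  assumes "L2_fun f" "filterlim r at_top sequentially"
  shows "(\<lambda>n. L2_sq (\<lambda>x. f x - indicator {- r n..r n} x * f x)) \<longlonglongrightarrow> 0"
proof (rule L2_dominated_convergence[where w=f])
  note [measurable] = assms(1)
  show "f \<in> borel_measurable lebesgue" by measurable
  show "(\<lambda>x. indicator {- r n..r n} x * f x) \<in> borel_measurable lebesgue" for n
    by (rule L2_fun_measurable[OF L2_fun_indicator_mult[OF assms(1)]]) simp
  show "AE x in lebesgue. (\<lambda>n. indicator {- r n..r n} x * f x) \<longlonglongrightarrow> f x"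
  proof (rule AE_I2, rule tendsto_eventually)
    fix x
    have "\<forall>\<^sub>F n in sequentially. r n \<ge> \<bar>x\<bar>"
      using assms(2) by (simp add: filterlim_at_top)
    thus "\<forall>\<^sub>F n in sequentially. indicator {- r n..r n} x * f x = f x"
      by eventually_elim (auto simp: indicator_def)
  qed
  show "AE x in lebesgue. cmod (indicator {- r n..r n} x * f x) \<le> cmod (f x)" for n
    by (auto simp: indicator_def)
qed (use assms in auto)

subsection \<open>Density of the trigonometric polynomials\<close>

definition lin_span :: "('i \<Rightarrow> real \<Rightarrow> complex) \<Rightarrow> (real \<Rightarrow> complex) set" where
  "lin_span G = {p. \<exists>A c. finite A \<and> p = (\<lambda>x. \<Sum>i\<in>A. c i * G i x)}"

lemma lin_span_base: "G i \<in> lin_span G"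
  unfolding lin_span_def by (auto intro!: exI[of _ "{i}"] exI[of _ "\<lambda>_. 1"])

lemma lin_span_memI: "finite A \<Longrightarrow> (\<lambda>x. \<Sum>i\<in>A. c i * G i x) \<in> lin_span G"
  unfolding lin_span_def by blast

lemma lin_span_memE:
  assumes "p \<in> lin_span G"
  obtains A c where "finite A" "p = (\<lambda>x. \<Sum>i\<in>A. c i * G i x)"
  using assms unfolding lin_span_def by blast

lemma lin_span_cmult: "p \<in> lin_span G \<Longrightarrow> (\<lambda>x. a * p x) \<in> lin_span G"
proof -
  assume "p \<in> lin_span G"
  then obtain A c where "finite A" "p = (\<lambda>x. \<Sum>i\<in>A. c i * G i x)"
    unfolding lin_span_def by auto
  thus ?thesis unfolding lin_span_def
    by (auto intro!: exI[of _ A] exI[of _ "\<lambda>i. a * c i"] simp: sum_distrib_left mult.assoc)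
qed

lemma lin_span_add:
  assumes "p \<in> lin_span G" "q \<in> lin_span G" shows "(\<lambda>x. p x + q x) \<in> lin_span G"
proof -
  obtain A c where A: "finite A" "p = (\<lambda>x. \<Sum>i\<in>A. c i * G i x)"
    using assms(1) unfolding lin_span_def by auto
  obtain B d where B: "finite B" "q = (\<lambda>x. \<Sum>i\<in>B. d i * G i x)"
    using assms(2) unfolding lin_span_def by auto
  define e where "e = (\<lambda>i. (if i \<in> A then c i else 0) + (if i \<in> B then d i else 0))"
  have "p x + q x = (\<Sum>i\<in>A\<union>B. e i * G i x)" for x
  proof -
    have "p x = (\<Sum>i\<in>A\<union>B. (if i \<in> A then c i else 0) * G i x)"
      unfolding A(2) by (rule sum.mono_neutral_cong_left) (use A B in auto)
    moreover have "q x = (\<Sum>i\<in>A\<union>B. (if i \<in> B then d i else 0) * G i x)"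
      unfolding B(2) by (rule sum.mono_neutral_cong_left) (use A B in auto)
    ultimately show ?thesis by (simp add: e_def distrib_right sum.distrib)
  qed
  thus ?thesis unfolding lin_span_def using A B by blast
qed

lemma lin_span_0: "(\<lambda>x. 0) \<in> lin_span G"
  unfolding lin_span_def by (auto intro!: exI[of _ "{}"])

lemma lin_span_sum:
  "(\<And>i. i \<in> A \<Longrightarrow> p i \<in> lin_span G) \<Longrightarrow> (\<lambda>x. \<Sum>i\<in>A. p i x) \<in> lin_span G"
  by (induction A rule: infinite_finite_induct) (auto intro: lin_span_0 lin_span_add)

abbreviation trig_span :: "real \<Rightarrow> (real \<Rightarrow> complex) set" where
  "trig_span L \<equiv> lin_span (\<lambda>(k::int) x. cis (2 * pi * of_int k * x / L))"

lemma trig_span_cis: "(\<lambda>x. cis (2 * pi * of_int k * x / L)) \<in> trig_span L"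
  by (rule lin_span_base)

lemma trig_span_mult:
  assumes "p \<in> trig_span L" "q \<in> trig_span L" shows "(\<lambda>x. p x * q x) \<in> trig_span L"
proof -
  obtain A c where A: "finite A" "p = (\<lambda>x. \<Sum>k\<in>A. c k * cis (2 * pi * of_int k * x / L))"
    using assms(1) unfolding lin_span_def by auto
  obtain B d where B: "finite B" "q = (\<lambda>x. \<Sum>k\<in>B. d k * cis (2 * pi * of_int k * x / L))"
    using assms(2) unfolding lin_span_def by auto
  have "(\<lambda>x. p x * q x) =
    (\<lambda>x. \<Sum>k\<in>A. \<Sum>l\<in>B. c k * d l * cis (2 * pi * of_int (k + l) * x / L))"
  proof
    fix x
    have *: "cis (2 * pi * of_int (k + l) * x / L) =
        cis (2 * pi * of_int k * x / L) * cis (2 * pi * of_int l * x / L)" for k l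
      by (simp add: cis_mult add_divide_distrib[symmetric] algebra_simps)
    show "p x * q x = (\<Sum>k\<in>A. \<Sum>l\<in>B. c k * d l * cis (2 * pi * of_int (k + l) * x / L))"
      unfolding A B * sum_product by (simp add: mult_ac)
  qed
  also have "\<dots> \<in> trig_span L"
    by (intro lin_span_sum lin_span_cmult trig_span_cis)
  finally show ?thesis .
qed

lemma trig_span_const: "(\<lambda>x. a) \<in> trig_span L"
  using lin_span_cmult[OF trig_span_cis[of 0 L], of a] by simp

text \<open>On the unit circle a real-linear \<open>f\<close> satisfies
  \<open>f (cis t) = cos t * f 1 + sin t * f \<i>\<close>, a combination of \<open>cis t\<close> and
  \<open>cis (- t)\<close>; constants, sums and products stay in the span. The shift by
  \<open>c\<close> only rotates the two coefficients.\<close>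

lemma trig_span_polynomial:
  assumes "real_polynomial_function g"
  shows "(\<lambda>x. complex_of_real (g (cis (2 * pi * (x - c) / L)))) \<in> trig_span L"
  using assms
proof (induction g rule: real_polynomial_function.induct)
  case (linear f)
  interpret bounded_linear f by fact
  define u v :: complex where "u = (f 1 - \<i> * f \<i>) / 2 * cis (- (2 * pi * c / L))"
    and "v = (f 1 + \<i> * f \<i>) / 2 * cis (2 * pi * c / L)"
  have "complex_of_real (f (cis (2 * pi * (x - c) / L))) =
      u * cis (2 * pi * of_int 1 * x / L) + v * cis (2 * pi * of_int (-1) * x / L)" for x
  proof -
    define t where "t = 2 * pi * (x - c) / L"
    have "cis t = cos t *\<^sub>R 1 + sin t *\<^sub>R \<i>"
      by (simp add: complex_eq_iff)
    hence 1: "f (cis t) = cos t * f 1 + sin t * f \<i>"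
      by (simp add: add scaleR)
    have 2: "u * cis (2 * pi * of_int 1 * x / L) = (f 1 - \<i> * f \<i>) / 2 * cis t"
      by (simp add: u_def mult.assoc cis_mult t_def diff_divide_distrib[symmetric] algebra_simps)
    have 3: "v * cis (2 * pi * of_int (-1) * x / L) = (f 1 + \<i> * f \<i>) / 2 * cis (-t)"
    proof -
      have "2 * pi * c / L + 2 * pi * of_int (-1) * x / L = - t"
        by (cases "L = 0") (auto simp: t_def field_simps)
      thus ?thesis by (simp only: v_def mult.assoc cis_mult)
    qed
    show ?thesis
      unfolding 2 3 t_def[symmetric] 1 by (simp add: complex_eq_iff field_simps)
  qed
  thus ?case
    by (simp only:) (intro lin_span_add lin_span_cmult trig_span_cis)
qed (auto intro: trig_span_const lin_span_add trig_span_mult)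

text \<open>The interval is wrapped around the unit circle, where Stone-Weierstrass applies.\<close>

lemma trig_span_uniform_dense:
  assumes L: "L > 0" and h: "continuous_on {c..c + L} h" "h c = h (c + L)" and e: "e > 0"
  obtains p where "p \<in> trig_span L" "\<And>x. x \<in> {c..c + L} \<Longrightarrow> cmod (h x - p x) < e"
proof -
  define \<gamma> where "\<gamma> = (\<lambda>t. h (c + L * t))"
  have "continuous_on {0..1} \<gamma>"
    unfolding \<gamma>_def
    by (rule continuous_on_compose2[OF h(1)])
      (use L in \<open>auto intro!: continuous_intros mult_left_le\<close>)
  \<comment> \<open>The equality of the end values closes \<open>\<gamma>\<close>. As a loop
    homotopic to itself it induces a continuous map on the circle, also at 1, where
    \<open>Arg2pi\<close> jumps.\<close>
  hence "homotopic_loops UNIV \<gamma> \<gamma>"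
    using h(2) by (simp add: homotopic_loops_refl path_def pathfinish_def pathstart_def \<gamma>_def)
  hence cont: "continuous_on (sphere 0 1) (\<gamma> \<circ> (\<lambda>z. Arg2pi z / (2 * pi)))"
    using homotopic_with_imp_continuous homotopic_loops_imp_homotopic_circlemaps by blast
  obtain g where g: "polynomial_function g"
    "\<And>z. z \<in> sphere 0 1 \<Longrightarrow> cmod ((\<gamma> \<circ> (\<lambda>z. Arg2pi z / (2 * pi))) z - g z) < e"
    using Stone_Weierstrass_polynomial_function[OF _ cont e] by auto
  have re: "real_polynomial_function (Re \<circ> g)" "real_polynomial_function (Im \<circ> g)"
    using g(1) bounded_linear_Re bounded_linear_Im unfolding polynomial_function_def by auto
  define p where "p = (\<lambda>x. complex_of_real ((Re \<circ> g) (cis (2 * pi * (x - c) / L))) +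
     \<i> * complex_of_real ((Im \<circ> g) (cis (2 * pi * (x - c) / L))))"
  have p: "p x = g (cis (2 * pi * (x - c) / L))" for x
    by (simp add: p_def complex_eq_iff)
  show ?thesis
  proof (rule that)
    show "p \<in> trig_span L"
      unfolding p_def by (intro lin_span_add lin_span_cmult trig_span_polynomial re)
    fix x assume x: "x \<in> {c..c + L}"
    have "(\<gamma> \<circ> (\<lambda>z. Arg2pi z / (2 * pi))) (cis (2 * pi * (x - c) / L)) = h x"
    \<comment> \<open>The right end is wrapped to 1, whose \<open>Arg2pi\<close> is 0 and not
      \<open>2 * pi\<close>; the equality of the end values covers this point.\<close>
    proof (cases "x = c + L")
      case True
      hence "cis (2 * pi * (x - c) / L) = 1" using L by (simp add: complex_eq_iff)
      thus ?thesis using True h(2) by (simp add: \<gamma>_def Arg2pi_of_real[of 1, simplified])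
    next
      case False
      define t where "t = (x - c) / L"
      have t: "0 \<le> t" "t < 1" "2 * pi * (x - c) / L = 2 * pi * t"
        using x L False by (auto simp: t_def field_simps)
      have "Arg2pi (cis (2 * pi * (x - c) / L)) = 2 * pi * (x - c) / L"
        unfolding t(3) by (rule Arg2pi_unique[of 1]) (use t in \<open>auto simp: cis_conv_exp\<close>)
      thus ?thesis using L by (simp add: \<gamma>_def)
    qed
    thus "cmod (h x - p x) < e"
      using g(2)[of "cis (2 * pi * (x - c) / L)"] unfolding p by simp
  qed
qed

lemma trig_span_continuous: "p \<in> trig_span L \<Longrightarrow> continuous_on UNIV p"
  unfolding lin_span_def cis_conv_exp by (cases "L = 0") (auto intro!: continuous_intros)

lemma continuous_borel_measurable_lebesgue:
  fixes p :: "real \<Rightarrow> 'a::topological_space"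
  shows "continuous_on UNIV p \<Longrightarrow> p \<in> borel_measurable lebesgue"
  by (rule measurable_completion) (simp add: borel_measurable_continuous_onI)

text \<open>Three approximations: large values are cut off, the result is replaced by a continuous
  function that vanishes at both ends, and this one is approximated uniformly. Each costs
  \<open>e / 12\<close>; two uses of the triangle inequality bring the total to at most
  \<open>10 * e / 12\<close>.\<close>

theorem trig_span_L2_dense:
  assumes f: "L2_fun f" and L: "L > 0" and e: "e > 0"
  obtains p where "p \<in> trig_span L"
    "L2_sq (\<lambda>x. indicator {c..c + L} x * f x - indicator {c..c + L} x * p x) < e"
proof -
  note [measurable] = f
  let ?I = "indicator {c..c + L} :: real \<Rightarrow> complex"
  define M where "M = max \<bar>c\<bar> \<bar>c + L\<bar>"
  have out: "?I x = 0" if "\<bar>x\<bar> > M" for x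
    using that unfolding M_def by (auto split: split_indicator)
  have Im: "?I \<in> borel_measurable lebesgue" by measurable
  have If: "L2_fun (\<lambda>x. ?I x * f x)" by (intro L2_fun_indicator_mult f) simp
  define f1 where "f1 = (\<lambda>n::nat. \<lambda>x. if cmod (f x) \<le> real n then ?I x * f x else 0)"
  have f1m [measurable]: "f1 n \<in> borel_measurable lebesgue" for n
    unfolding f1_def by measurable
  have "(\<lambda>n. L2_sq (\<lambda>x. ?I x * f x - f1 n x)) \<longlonglongrightarrow> 0"
  proof (rule L2_dominated_convergence[OF f1m _ If])
    show "AE x in lebesgue. (\<lambda>n. f1 n x) \<longlonglongrightarrow> ?I x * f x"
    proof (rule AE_I2, rule tendsto_eventually)
      fix x
      have "\<forall>\<^sub>F n in sequentially. real n \<ge> cmod (f x)"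
        using filterlim_real_sequentially by (simp add: filterlim_at_top)
      thus "\<forall>\<^sub>F n in sequentially. f1 n x = ?I x * f x"
        by eventually_elim (simp add: f1_def)
    qed
  qed (use If in \<open>auto simp: f1_def\<close>)
  hence "\<forall>\<^sub>F n in sequentially. L2_sq (\<lambda>x. ?I x * f x - f1 n x) < e / 12"
    using e by (intro order_tendstoD(2)) auto
  then obtain B where B: "L2_sq (\<lambda>x. ?I x * f x - f1 B x) < e / 12"
    by (auto simp: eventually_sequentially)
  have f1_le: "cmod (f1 B x) \<le> real B" for x
    by (auto simp: f1_def split: split_indicator)
  have f1_out: "f1 B x = 0" if "\<bar>x\<bar> > M" for x using out that by (auto simp: f1_def)
  have f1_L2: "L2_fun (f1 B)"
    by (rule L2_fun_bounded_support[OF f1m f1_le f1_out])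
  have "f1 B measurable_on UNIV"
    using f1m[of B] by (simp add: lebesgue_measurable_imp_measurable_on)
  then obtain N g where N: "negligible N" "\<And>n. continuous_on UNIV (g n)"
      "\<And>x. x \<notin> N \<Longrightarrow> (\<lambda>n. g n x) \<longlonglongrightarrow> f1 B x"
    unfolding measurable_on_def by auto
  \<comment> \<open>The first factor vanishes at both ends, which gives the periodicity, and is
    eventually 1 at every interior point. The projection onto the ball keeps the continuous
    approximants below the bound \<open>B\<close> and fixes the values of
    \<open>f1 B\<close>.\<close>
  define h where "h = (\<lambda>n::nat. \<lambda>x. complex_of_real (min 1 (real n * ((x - c) * (c + L - x)))) *
     closest_point (cball 0 (real B)) (g n x))"
  have ball: "convex (cball (0::complex) (real B))" "closed (cball (0::complex) (real B))"
    "cball (0::complex) (real B) \<noteq> {}" by auto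
  have h_cont: "continuous_on UNIV (h n)" for n
    unfolding h_def
    by (intro continuous_intros continuous_on_compose2[OF continuous_on_closest_point[OF ball] N(2)]) auto
  have hm [measurable]: "h n \<in> borel_measurable lebesgue" for n
    by (rule continuous_borel_measurable_lebesgue[OF h_cont])
  have h_le: "cmod (?I x * h n x) \<le> cmod (?I x * of_real (real B))" for n x
  proof -
    have "cmod (closest_point (cball 0 (real B)) (g n x)) \<le> real B"
      using closest_point_in_set[OF ball(2,3)] by (metis mem_cball_0)
    moreover have "\<bar>min 1 (real n * ((x - c) * (c + L - x)))\<bar> \<le> 1" if "x \<in> {c..c+L}"
      using that by (auto simp: min_def abs_le_iff intro: order_trans[of _ 0])
    ultimately show ?thesis
      by (auto simp: h_def norm_mult split: split_indicator intro: mult_le_one mult_mono[of _ 1 _ "real B", simplified])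
  qed
  have wL2: "L2_fun (\<lambda>x. ?I x * of_real (real B))"
    by (rule L2_fun_bounded_support[of _ "real B" M]) (use out in \<open>auto simp: norm_mult split: split_indicator\<close>)
  have hL2: "L2_fun (\<lambda>x. ?I x * h n x)" for n
    by (rule L2_fun_dominated[OF wL2, of _ 1]) (use h_le in auto)
  have "(\<lambda>n. L2_sq (\<lambda>x. f1 B x - ?I x * h n x)) \<longlonglongrightarrow> 0"
  proof (rule L2_dominated_convergence[OF _ _ wL2])
    have "negligible (N \<union> {c, c + L})"
      by (intro negligible_Un N(1)) simp
    hence "AE x in lebesgue. x \<notin> N \<union> {c, c + L}"
      unfolding negligible_iff_null_sets by (rule AE_not_in)
    thus "AE x in lebesgue. (\<lambda>n. ?I x * h n x) \<longlonglongrightarrow> f1 B x"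
    proof eventually_elim
      case (elim x)
      show ?case
      proof (cases "x \<in> {c..c + L}")
        case False
        thus ?thesis by (simp add: f1_def)
      next
        case True
        with elim have "(x - c) * (c + L - x) > 0" by (auto intro!: mult_pos_pos)
        hence "filterlim (\<lambda>n. real n * ((x - c) * (c + L - x))) at_top sequentially"
          by (intro filterlim_at_top_mult_tendsto_pos[OF tendsto_const] filterlim_real_sequentially
             filterlim_tendsto_pos_mult_at_top) (simp add: mult.commute)
        hence "\<forall>\<^sub>F n in sequentially. real n * ((x - c) * (c + L - x)) \<ge> 1"
          by (simp add: filterlim_at_top)
        hence ev: "\<forall>\<^sub>F n in sequentially. closest_point (cball 0 (real B)) (g n x) = ?I x * h n x"
        proof eventually_elim
          case (elim n)
          thus ?case using True by (simp add: h_def min_def)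
        qed
        have "isCont (closest_point (cball (0::complex) (real B))) (f1 B x)"
          using continuous_on_closest_point[OF ball, of UNIV] by (simp add: continuous_on_eq_continuous_at)
        hence "(\<lambda>n. closest_point (cball 0 (real B)) (g n x)) \<longlonglongrightarrow>
            closest_point (cball 0 (real B)) (f1 B x)"
          using N(3) elim by (auto intro: isCont_tendsto_compose)
        moreover have "closest_point (cball 0 (real B)) (f1 B x) = f1 B x"
          using f1_le by (intro closest_point_self) simp
        ultimately show ?thesis using ev by (simp add: tendsto_cong)
      qed
    qed
  qed (use h_le in auto)
  hence "\<forall>\<^sub>F n in sequentially. L2_sq (\<lambda>x. f1 B x - ?I x * h n x) < e / 12"
    using e by (intro order_tendstoD(2)) auto
  then obtain n where n: "L2_sq (\<lambda>x. f1 B x - ?I x * h n x) < e / 12"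
    by (auto simp: eventually_sequentially)
  \<comment> \<open>\<open>L + 1\<close> in place of \<open>L\<close> makes the bound on the square
    of \<open>d\<close> times \<open>L\<close> strict.\<close>
  define d where "d = sqrt (e / (12 * (L + 1)))"
  have d: "d > 0" "d\<^sup>2 * L < e / 12"
    using e L by (auto simp: d_def field_simps)
  obtain p where p: "p \<in> trig_span L" "\<And>x. x \<in> {c..c + L} \<Longrightarrow> cmod (h n x - p x) < d"
  proof (rule trig_span_uniform_dense[OF L, of c "h n" d])
    show "continuous_on {c..c + L} (h n)" using h_cont continuous_on_subset by blast
    show "h n c = h n (c + L)" by (simp add: h_def)
  qed (use d in auto)
  have [measurable]: "p \<in> borel_measurable lebesgue"
    by (rule continuous_borel_measurable_lebesgue[OF trig_span_continuous[OF p(1)]])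
  have hpL2: "L2_fun (\<lambda>x. ?I x * h n x - ?I x * p x)"
    by (rule L2_fun_bounded_support[of _ d M])
      (use p(2) out d(1) in \<open>auto simp: less_imp_le split: split_indicator\<close>)
  have "L2_sq (\<lambda>x. ?I x * h n x - ?I x * p x) \<le> (LINT x|lebesgue. d\<^sup>2 * indicator {c..c + L} x)"
    unfolding L2_sq_def
  proof (rule integral_mono[OF L2_fun_integrable_sq[OF hpL2]])
    show "integrable lebesgue (\<lambda>x. d\<^sup>2 * indicator {c..c + L} x)"
      by (intro integrable_mult_right integrable_real_indicator) (auto simp: emeasure_lborel_Icc_eq)
    show "(cmod (?I x * h n x - ?I x * p x))\<^sup>2 \<le> d\<^sup>2 * indicator {c..c + L} x" for x
      using p(2)[of x] by (auto split: split_indicator intro!: power_mono)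
  qed
  also have "\<dots> = d\<^sup>2 * L" using L by simp
  finally have hp: "L2_sq (\<lambda>x. ?I x * h n x - ?I x * p x) < e / 12" using d by linarith
  have pL2: "L2_fun (\<lambda>x. ?I x * p x)"
    using L2_fun_diff[OF hL2[of n] hpL2] by simp
  have "L2_sq (\<lambda>x. ?I x * f x - ?I x * p x) \<le>
      2 * L2_sq (\<lambda>x. ?I x * f x - f1 B x) + 2 * L2_sq (\<lambda>x. f1 B x - ?I x * p x)"
    by (rule L2_sq_triangle[OF If f1_L2 pL2])
  moreover have "L2_sq (\<lambda>x. f1 B x - ?I x * p x) \<le>
      2 * L2_sq (\<lambda>x. f1 B x - ?I x * h n x) + 2 * L2_sq (\<lambda>x. ?I x * h n x - ?I x * p x)"
    by (rule L2_sq_triangle[OF f1_L2 hL2 pL2])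
  ultimately have "L2_sq (\<lambda>x. ?I x * f x - ?I x * p x) < e"
    using B n hp e by linarith
  thus ?thesis using that p(1) by blast
qed

subsection \<open>Parseval and Plancherel identities\<close>

text \<open>Needed for Fubini's theorem and for the measurability of parametrized integrals over the
  completed measure.\<close>

interpretation lebesgue: sigma_finite_measure "lebesgue :: real measure"
proof
  show "\<exists>A::real set set. countable A \<and> A \<subseteq> sets lebesgue \<and> \<Union>A = space lebesgue \<and> (\<forall>a\<in>A. emeasure lebesgue a \<noteq> (\<infinity>::ennreal))"
  proof (intro exI[of _ "range (\<lambda>n::nat. {- real n..real n})"] conjI ballI)
    have "\<exists>n::nat. x \<in> {- real n..real n}" for x
    proof -
      obtain n where "\<bar>x\<bar> \<le> real n" using real_arch_simple by blast
      thus ?thesis by (intro exI[of _ n]) auto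
    qed
    thus "\<Union> (range (\<lambda>n::nat. {- real n..real n})) = space lebesgue" by auto
  qed (auto simp: emeasure_lborel_Icc_eq)
qed

interpretation lebesgue_pair: pair_sigma_finite "lebesgue :: real measure" "lebesgue :: real measure" ..

section \<open>Affine changes of variable\<close>

lemma AE_lebesgue_affine:
  assumes "AE x in lebesgue. P (x::real)" "c \<noteq> 0"
  shows "AE x in lebesgue. P (t + c * x)"
proof -
  obtain N where N: "N \<in> null_sets lebesgue" "{x. \<not> P x} \<subseteq> N"
    using assms(1) unfolding eventually_ae_filter by auto
  have [measurable]: "N \<in> sets lebesgue" using N by auto
  have "0 = (\<integral>\<^sup>+x. indicator N x \<partial>lebesgue)" using N by (simp add: null_setsD1)
  also have "\<dots> = ennreal \<bar>c\<bar> * (\<integral>\<^sup>+x. indicator N (t + c * x) \<partial>lebesgue)"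
    by (rule nn_integral_real_affine_lebesgue) (use assms(2) in auto)
  finally have 0: "(\<integral>\<^sup>+x. indicator N (t + c * x) \<partial>lebesgue) = 0"
    using assms(2) by auto
  have "(\<lambda>x. indicator N (t + c * x)) \<in> borel_measurable lebesgue"
  proof -
    have "(\<lambda>x. t + c * x) \<in> lebesgue \<rightarrow>\<^sub>M lebesgue"
      using lebesgue_affine_measurable[where c= "\<lambda>x::real. c"] assms(2) by simp
    thus ?thesis by measurable
  qed
  with 0 have "AE x in lebesgue. indicator N (t + c * x) = (0::ennreal)"
    by (subst (asm) nn_integral_0_iff_AE) auto
  thus ?thesis
    by eventually_elim (use N(2) in \<open>auto split: split_indicator_asm\<close>)
qed

lemma borel_measurable_lebesgue_affine:
  fixes f :: "real \<Rightarrow> complex"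
  assumes "f \<in> borel_measurable lebesgue" "c \<noteq> 0"
  shows "(\<lambda>x. f (t + c * x)) \<in> borel_measurable lebesgue"
  using borel_measurable_affine[OF assms, of t] by simp

lemma L2_fun_affine:
  assumes "L2_fun f" "c \<noteq> 0" shows "L2_fun (\<lambda>x. f (t + c * x))"
  unfolding L2_fun_def
  using borel_measurable_lebesgue_affine[OF L2_fun_measurable[OF assms(1)] assms(2)]
    lebesgue_integrable_real_affine[OF L2_fun_integrable_sq[OF assms(1)] assms(2), of t] by auto

lemma L2_sq_affine:
  assumes "c \<noteq> 0" shows "L2_sq f = \<bar>c\<bar> * L2_sq (\<lambda>x. f (t + c * x))"
  unfolding L2_sq_def using lebesgue_integral_real_affine[OF assms, of "\<lambda>x. (cmod (f x))\<^sup>2" t] by simp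

lemma fourier_integral_cis:
  "fourier_integral f \<xi> = (LINT x|lebesgue. f x * cis (- (2 * pi * x * \<xi>)))"
  unfolding fourier_integral_def cis_conv_exp
  by (intro Bochner_Integration.integral_cong refl) (simp add: algebra_simps)

lemma integral_cis_period:
  assumes "L > 0"
  shows "(LINT x|lebesgue. indicator {c..c + L} x * cis (2 * pi * of_int m * x / L)) = (if m = 0 then of_real L else 0)"
proof (cases "m = 0")
  case True
  have "(LINT x|lebesgue. complex_of_real (indicator {c..c + L} x)) = of_real L"
    using assms by (simp add: integral_complex_of_real)
  moreover have "complex_of_real (indicator {c..c + L} x) = indicator {c..c + L} x" for x
    by (simp split: split_indicator)
  ultimately show ?thesis using True by (simp)
next
  case False
  define a where "a = 2 * pi * of_int m / L"
  have a: "a \<noteq> 0" using False assms by (simp add: a_def)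
  define F where "F = (\<lambda>x. cis (a * x) / (\<i> * of_real a))"
  have "(LINT x|lebesgue. indicator {c..c + L} x * cis (a * x)) = (LINT x|lborel. indicator {c..c + L} x * cis (a * x))"
  proof (rule integral_completion)
    have [measurable]: "(\<lambda>x. cis (a * x)) \<in> borel_measurable borel"
      unfolding cis_conv_exp by (intro borel_measurable_continuous_onI continuous_intros)
    show "(\<lambda>x. indicator {c..c + L} x * cis (a * x)) \<in> borel_measurable lborel"
      by simp
  qed
  also have "\<dots> = (LINT x|lborel. indicator {c..c + L} x *\<^sub>R cis (a * x))"
    by (intro Bochner_Integration.integral_cong) (auto split: split_indicator)
  also have "\<dots> = F (c + L) - F c"
  proof (rule integral_FTC_Icc)
    fix x
    have "((\<lambda>z. exp (\<i> * of_real a * z) / (\<i> * of_real a)) has_field_derivative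
       exp (\<i> * of_real a * of_real x)) (at (of_real x))"
      using a by (auto intro!: derivative_eq_intros)
    from has_vector_derivative_real_field[OF this]
    show "(F has_vector_derivative cis (a * x)) (at x within {c..c + L})"
      by (simp add: F_def[abs_def] cis_conv_exp mult.assoc)
  next
    show "continuous_on {c..c + L} (\<lambda>x. cis (a * x))"
      unfolding cis_conv_exp by (intro continuous_intros)
  qed (use assms in auto)
  also have "F (c + L) = F c"
  proof -
    have "a * (c + L) = a * c + 2 * pi * of_int m" using assms by (simp add: a_def field_simps)
    hence "cis (a * (c + L)) = cis (a * c)" by (simp add: cis_mult[symmetric] cis_multiple_2pi)
    thus ?thesis by (simp add: F_def)
  qed
  finally show ?thesis using False by (simp add: a_def mult_ac)
qed

lemma L2_fun_indicator_cis: "L2_fun (\<lambda>x. indicator {c..d} x * cis (a * x))"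
proof (rule L2_fun_bounded_support)
  show "(\<lambda>x. indicator {c..d} x * cis (a * x)) \<in> borel_measurable lebesgue"
    unfolding cis_conv_exp by measurable
  show "cmod (indicator {c..d} x * cis (a * x)) \<le> 1" for x by (auto split: split_indicator)
  show "indicator {c..d} x * cis (a * x) = 0" if "\<bar>x\<bar> > max \<bar>c\<bar> \<bar>d\<bar>" for x
    using that by (auto split: split_indicator)
qed

text \<open>Bessel's inequality gives one half, density of the trigonometric polynomials the other.
  \<open>int_decode\<close> lists the integers as a sequence; the order is harmless because the
  terms are nonnegative and every finite set of indices is eventually exhausted.\<close>

lemma parseval_sums:
  assumes f: "L2_fun f" and supp: "\<And>x. x \<notin> {c..c + L} \<Longrightarrow> f x = 0" and L: "L > 0"
  shows "(\<lambda>n. (cmod (fourier_integral f (of_int (int_decode n) / L)))\<^sup>2) sums (L * L2_sq f)"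
proof -
  define a where "a = (\<lambda>k::int. fourier_integral f (of_int k / L))"
  define e where "e = (\<lambda>(k::int) x. indicator {c..c + L} x * cis (2 * pi * of_int k * x / L))"
  have eL2: "L2_fun (e k)" for k
    using L2_fun_indicator_cis[of c "c + L" "2 * pi * of_int k / L"] by (simp add: e_def mult_ac)
  have fe: "L2_inner f (e k) = a k" for k
    unfolding L2_inner_def a_def fourier_integral_cis e_def
  proof (intro Bochner_Integration.integral_cong refl)
    fix x
    show "f x * cnj (indicator {c..c + L} x * cis (2 * pi * of_int k * x / L)) =
        f x * cis (- (2 * pi * x * (of_int k / L)))"
      using supp[of x] by (cases "x \<in> {c..c + L}") (simp_all add: cis_cnj mult_ac)
  qed
  have ee: "L2_inner (e k) (e l) = (if k = l then of_real L else 0)" for k l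
  proof -
    have "L2_inner (e k) (e l) = (LINT x|lebesgue. indicator {c..c + L} x * cis (2 * pi * of_int (k - l) * x / L))"
      unfolding L2_inner_def e_def
      by (intro Bochner_Integration.integral_cong refl)
        (auto simp: cis_cnj cis_mult diff_divide_distrib algebra_simps split: split_indicator)
    thus ?thesis unfolding integral_cis_period[OF L] by simp
  qed
  have sumL2: "L2_fun (\<lambda>x. \<Sum>k\<in>A. b k * e k x)" for A b
    by (intro L2_fun_sum L2_fun_cmult eL2)
  have inner_f: "L2_inner (\<lambda>x. \<Sum>k\<in>A. b k * e k x) f = (\<Sum>k\<in>A. b k * cnj (a k))" for A b
  proof -
    have "L2_inner (\<lambda>x. \<Sum>k\<in>A. b k * e k x) f = (\<Sum>k\<in>A. b k * L2_inner (e k) f)"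
      by (subst L2_inner_sum_left) (auto intro: L2_fun_cmult eL2 f simp: L2_inner_cmult_left)
    thus ?thesis by (simp add: L2_inner_commute[of _ f] fe)
  qed
  have inner_s: "L2_sq (\<lambda>x. \<Sum>k\<in>A. b k * e k x) = L * (\<Sum>k\<in>A. (cmod (b k))\<^sup>2)" if "finite A" for A b
  proof -
    let ?s = "\<lambda>x. \<Sum>k\<in>A. b k * e k x"
    have *: "L2_inner ?s (e l) = b l * of_real L" if "l \<in> A" for l
    proof -
      have "L2_inner ?s (e l) = (\<Sum>k\<in>A. b k * L2_inner (e k) (e l))"
        by (subst L2_inner_sum_left) (auto intro: L2_fun_cmult eL2 simp: L2_inner_cmult_left)
      also have "\<dots> = (\<Sum>k\<in>A. if k = l then b k * of_real L else 0)"
        by (intro sum.cong) (auto simp: ee)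
      finally show ?thesis using \<open>finite A\<close> \<open>l \<in> A\<close> by simp
    qed
    have "L2_inner ?s ?s = (\<Sum>k\<in>A. b k * cnj (L2_inner ?s (e k)))"
      by (subst L2_inner_sum_left)
        (auto intro: L2_fun_cmult eL2 sumL2 simp: L2_inner_cmult_left L2_inner_commute[of _ ?s])
    also have "\<dots> = (\<Sum>k\<in>A. of_real (L * (cmod (b k))\<^sup>2))"
      by (intro sum.cong refl) (simp add: * complex_norm_square mult_ac del: of_real_power)
    finally have "complex_of_real (L2_sq ?s) = of_real (\<Sum>k\<in>A. L * (cmod (b k))\<^sup>2)"
      unfolding L2_inner_self by simp
    thus ?thesis by (simp only: of_real_eq_iff sum_distrib_left)
  qed
  \<comment> \<open>The square is completed in each coefficient. The choice
    \<open>b k = a k / L\<close> yields Bessel's inequality; dropping the last, nonnegative term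
    bounds the coefficient sum from below by the quality of any approximant.\<close>
  have expand: "L2_sq (\<lambda>x. f x - (\<Sum>k\<in>A. b k * e k x)) =
      L2_sq f - (\<Sum>k\<in>A. (cmod (a k))\<^sup>2) / L + L * (\<Sum>k\<in>A. (cmod (b k - a k / L))\<^sup>2)"
    if "finite A" for A b
  proof -
    have "Re (L2_inner f (\<lambda>x. \<Sum>k\<in>A. b k * e k x)) = (\<Sum>k\<in>A. Re (b k * cnj (a k)))"
      by (subst L2_inner_commute) (simp add: inner_f)
    hence "L2_sq (\<lambda>x. f x - (\<Sum>k\<in>A. b k * e k x)) =
        L2_sq f - 2 * (\<Sum>k\<in>A. Re (b k * cnj (a k))) + L * (\<Sum>k\<in>A. (cmod (b k))\<^sup>2)"
      by (subst L2_sq_diff[OF f sumL2]) (simp add: inner_s[OF that])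
    also have "\<dots> = L2_sq f - (\<Sum>k\<in>A. 2 * Re (b k * cnj (a k)) - L * (cmod (b k))\<^sup>2)"
      by (simp add: sum_subtractf sum_distrib_left)
    also have "(\<Sum>k\<in>A. 2 * Re (b k * cnj (a k)) - L * (cmod (b k))\<^sup>2) =
        (\<Sum>k\<in>A. (cmod (a k))\<^sup>2 / L - L * (cmod (b k - a k / L))\<^sup>2)"
    proof (intro sum.cong refl)
      fix k
      show "2 * Re (b k * cnj (a k)) - L * (cmod (b k))\<^sup>2 = (cmod (a k))\<^sup>2 / L - L * (cmod (b k - a k / L))\<^sup>2"
        using L unfolding cmod_power2 by (simp add: power2_eq_square field_simps)
    qed
    finally show ?thesis by (simp add: sum_subtractf sum_distrib_left sum_divide_distrib)
  qed
  have upper: "(\<Sum>k\<in>A. (cmod (a k))\<^sup>2) \<le> L * L2_sq f" if "finite A" for A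
  proof -
    have "0 \<le> L2_sq f - (\<Sum>k\<in>A. (cmod (a k))\<^sup>2) / L"
      using expand[OF that, of "\<lambda>k. a k / L"]
        L2_sq_nonneg[of "\<lambda>x. f x - (\<Sum>k\<in>A. a k / L * e k x)"] by simp
    thus ?thesis using L by (simp add: field_simps)
  qed
  have lower: "\<exists>A. finite A \<and> (\<Sum>k\<in>A. (cmod (a k))\<^sup>2) > L * L2_sq f - \<epsilon>" if "\<epsilon> > 0" for \<epsilon>
  proof -
    have "\<epsilon> / L > 0" using that L by simp
    then obtain p where p: "p \<in> trig_span L"
      "L2_sq (\<lambda>x. indicator {c..c + L} x * f x - indicator {c..c + L} x * p x) < \<epsilon> / L"
      using trig_span_L2_dense[OF f L, of "\<epsilon> / L" c] by blast
    then obtain A b where A: "finite A" "p = (\<lambda>x. \<Sum>k\<in>A. b k * cis (2 * pi * of_int k * x / L))"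
      unfolding lin_span_def by auto
    have 1: "indicator {c..c + L} x * f x = f x" for x
      using supp[of x] by (auto split: split_indicator)
    have 2: "indicator {c..c + L} x * p x = (\<Sum>k\<in>A. b k * e k x)" for x
      by (simp add: A(2) e_def sum_distrib_left mult_ac)
    have "(\<lambda>x. indicator {c..c + L} x * f x - indicator {c..c + L} x * p x) =
        (\<lambda>x. f x - (\<Sum>k\<in>A. b k * e k x))"
      by (intro ext arg_cong2[of _ _ _ _ minus] 1 2)
    with p(2) have lt: "L2_sq (\<lambda>x. f x - (\<Sum>k\<in>A. b k * e k x)) < \<epsilon> / L" by simp
    hence "L2_sq f - (\<Sum>k\<in>A. (cmod (a k))\<^sup>2) / L < \<epsilon> / L"
    proof -
      have "0 \<le> L * (\<Sum>k\<in>A. (cmod (b k - a k / L))\<^sup>2)"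
        using L by (intro mult_nonneg_nonneg sum_nonneg) auto
      thus ?thesis using lt unfolding expand[OF A(1)] by linarith
    qed
    hence "L2_sq f < (\<epsilon> + (\<Sum>k\<in>A. (cmod (a k))\<^sup>2)) / L"
      by (simp add: add_divide_distrib)
    thus ?thesis using A(1) L by (intro exI[of _ A]) (simp add: pos_less_divide_eq mult.commute)
  qed
  let ?t = "\<lambda>n. (cmod (a (int_decode n)))\<^sup>2"
  have part: "(\<Sum>n<N. ?t n) = (\<Sum>k\<in>int_decode ` {..<N}. (cmod (a k))\<^sup>2)" for N
    by (subst sum.reindex) (auto intro: inj_on_subset[OF inj_int_decode])
  have "?t sums (L * L2_sq f)"
    unfolding sums_def
  proof (rule LIMSEQ_I)
    fix r :: real assume "r > 0"
    then obtain A where A: "finite A" "(\<Sum>k\<in>A. (cmod (a k))\<^sup>2) > L * L2_sq f - r"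
      using lower by blast
    obtain N where N: "int_encode ` A \<subseteq> {..<N}"
      using A(1) finite_nat_iff_bounded by blast
    show "\<exists>N. \<forall>n\<ge>N. norm ((\<Sum>i<n. ?t i) - L * L2_sq f) < r"
    proof (intro exI allI impI)
      fix n assume "n \<ge> N"
      have "A \<subseteq> int_decode ` {..<n}"
      proof
        fix k assume "k \<in> A"
        hence "int_encode k < n" using N \<open>n \<ge> N\<close> by auto
        thus "k \<in> int_decode ` {..<n}" by (intro image_eqI[of _ _ "int_encode k"]) auto
      qed
      hence "(\<Sum>k\<in>A. (cmod (a k))\<^sup>2) \<le> (\<Sum>i<n. ?t i)"
        unfolding part by (intro sum_mono2) auto
      moreover have "(\<Sum>i<n. ?t i) \<le> L * L2_sq f" unfolding part by (rule upper) simp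
      ultimately show "norm ((\<Sum>i<n. ?t i) - L * L2_sq f) < r" using A(2) by auto
    qed
  qed
  thus ?thesis by (simp add: a_def)
qed

lemma fourier_integral_measurable:
  assumes [measurable]: "f \<in> borel_measurable lebesgue"
  shows "fourier_integral f \<in> borel_measurable lebesgue"
proof -
  have "(\<lambda>\<xi>. LINT x|lebesgue. f x * cis (- (2 * pi * x * \<xi>))) \<in> borel_measurable lebesgue"
    unfolding cis_conv_exp
    by (rule lebesgue.borel_measurable_lebesgue_integral) measurable
  thus ?thesis by (simp add: fourier_integral_cis[abs_def])
qed

lemma nn_integral_periodize:
  fixes u :: "real \<Rightarrow> ennreal"
  assumes [measurable]: "u \<in> borel_measurable lebesgue" and p: "p > 0"
  shows "(\<integral>\<^sup>+x. u x \<partial>lebesgue) =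
    (\<integral>\<^sup>+x. (\<Sum>n. u (x + of_int (int_decode n) * p)) * indicator {0..<p} x \<partial>lebesgue)"
proof -
  define B where "B = (\<lambda>n. {of_int (int_decode n) * p..<(of_int (int_decode n) + 1) * p})"
  have mem: "x \<in> B n \<longleftrightarrow> int_decode n = \<lfloor>x / p\<rfloor>" for x n
    using p by (auto simp: B_def eq_commute[of _ "\<lfloor>x / p\<rfloor>"] floor_eq_iff pos_le_divide_eq pos_divide_less_eq)
  have "disjoint_family B"
    unfolding disjoint_family_on_def
  proof (intro ballI impI)
    fix m n :: nat assume "m \<noteq> n"
    hence "int_decode m \<noteq> int_decode n" using inj_int_decode[of UNIV] by (auto dest: injD)
    thus "B m \<inter> B n = {}" using mem by auto
  qed
  moreover have "\<Union> (range B) = UNIV"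
  proof -
    have "x \<in> B (int_encode \<lfloor>x / p\<rfloor>)" for x unfolding mem by simp
    thus ?thesis by blast
  qed
  ultimately have split: "(\<integral>\<^sup>+x. u x \<partial>lebesgue) = (\<Sum>n. \<integral>\<^sup>+x. u x * indicator (B n) x \<partial>lebesgue)"
    using nn_integral_disjoint_family[of u lebesgue B] by (simp add: B_def)
  have shift: "(\<integral>\<^sup>+x. u x * indicator (B n) x \<partial>lebesgue) =
      (\<integral>\<^sup>+x. u (x + of_int (int_decode n) * p) * indicator {0..<p} x \<partial>lebesgue)" for n
  proof -
    have [measurable]: "B n \<in> sets lebesgue" by (simp add: B_def)
    have "(\<integral>\<^sup>+x. u x * indicator (B n) x \<partial>lebesgue) =
        ennreal \<bar>1\<bar> * (\<integral>\<^sup>+x. u (of_int (int_decode n) * p + 1 * x) *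
          indicator (B n) (of_int (int_decode n) * p + 1 * x) \<partial>lebesgue)"
      by (rule nn_integral_real_affine_lebesgue) auto
    also have "\<dots> = (\<integral>\<^sup>+x. u (x + of_int (int_decode n) * p) * indicator {0..<p} x \<partial>lebesgue)"
      by (simp, intro nn_integral_cong)
        (auto simp: B_def algebra_simps split: split_indicator)
    finally show ?thesis .
  qed
  have "(\<Sum>n. \<integral>\<^sup>+x. u (x + of_int (int_decode n) * p) * indicator {0..<p} x \<partial>lebesgue) =
      (\<integral>\<^sup>+x. (\<Sum>n. u (x + of_int (int_decode n) * p) * indicator {0..<p} x) \<partial>lebesgue)"
  proof (rule nn_integral_suminf[symmetric])
    fix n
    have "(\<lambda>x. x + of_int (int_decode n) * p) \<in> lebesgue \<rightarrow>\<^sub>M lebesgue"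
      using lebesgue_affine_measurable[where c= "\<lambda>x::real. 1" and t="of_int (int_decode n) * p"]
      by (simp add: add.commute)
    thus "(\<lambda>x. u (x + of_int (int_decode n) * p) * indicator {0..<p} x) \<in> borel_measurable lebesgue"
      by measurable
  qed
  thus ?thesis unfolding split shift by simp
qed

lemma fourier_integral_add:
  "fourier_integral f (\<xi> + \<eta>) = fourier_integral (\<lambda>x. f x * cis (- (2 * pi * x * \<xi>))) \<eta>"
  unfolding fourier_integral_cis by (simp add: mult.assoc cis_mult distrib_left)

theorem plancherel_compact:
  assumes "L2_compact f"
  shows "L2_fun (fourier_integral f)" "L2_sq (fourier_integral f) = L2_sq f"
proof -
  obtain M where M: "M > 0" "\<And>x. \<bar>x\<bar> > M \<Longrightarrow> f x = 0" "L2_fun f"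
    using L2_compactE[OF assms] by metis
  define L where "L = 2 * M"
  have L: "L > 0" using M by (simp add: L_def)
  note [measurable] = M(3)
  let ?F = "fourier_integral f"
  have Fm [measurable]: "?F \<in> borel_measurable lebesgue"
    by (rule fourier_integral_measurable) measurable
  \<comment> \<open>The values at \<open>\<xi> + k / L\<close> are the Fourier coefficients of
    \<open>f\<close> modulated by a unimodular factor. Its norm is that of \<open>f\<close>, so the
    sum does not depend on \<open>\<xi>\<close>.\<close>
  have sums: "(\<Sum>n. ennreal ((cmod (?F (\<xi> + of_int (int_decode n) * (1 / L))))\<^sup>2)) = ennreal (L * L2_sq f)" for \<xi>
  proof -
    let ?g = "\<lambda>x. f x * cis (- (2 * pi * x * \<xi>))"
    have gm: "?g \<in> borel_measurable lebesgue" unfolding cis_conv_exp by measurable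
    have g: "L2_fun ?g" by (rule L2_fun_dominated[OF M(3) gm, of 1]) (simp add: norm_mult)
    have "(\<lambda>n. (cmod (fourier_integral ?g (of_int (int_decode n) / L)))\<^sup>2) sums (L * L2_sq ?g)"
      by (rule parseval_sums[of _ "-M"]) (use g M L in \<open>auto simp: L_def\<close>)
    moreover have "L2_sq ?g = L2_sq f" by (simp add: L2_sq_def norm_mult)
    ultimately have "(\<lambda>n. (cmod (?F (\<xi> + of_int (int_decode n) * (1 / L))))\<^sup>2) sums (L * L2_sq f)"
      by (simp add: fourier_integral_add)
    thus ?thesis by (intro suminf_ennreal_eq) auto
  qed
  \<comment> \<open>A constant is integrated over one period, whose length \<open>1 / L\<close>
    cancels the factor \<open>L\<close>.\<close>
  have "(\<integral>\<^sup>+\<xi>. ennreal ((cmod (?F \<xi>))\<^sup>2) \<partial>lebesgue) =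
      (\<integral>\<^sup>+\<xi>. ennreal (L * L2_sq f) * indicator {0..<1 / L} \<xi> \<partial>lebesgue)"
    by (subst nn_integral_periodize[of _ "1 / L"]) (use L in \<open>simp_all only: sums, auto\<close>)
  also have "\<dots> = ennreal (L * L2_sq f) * ennreal (1 / L)"
    using L by (subst nn_integral_cmult_indicator) auto
  also have "\<dots> = ennreal (L2_sq f)"
    using L by (simp add: ennreal_mult'[symmetric] L2_sq_nonneg)
  finally have nn: "(\<integral>\<^sup>+\<xi>. ennreal ((cmod (?F \<xi>))\<^sup>2) \<partial>lebesgue) = ennreal (L2_sq f)" .
  show "L2_fun ?F"
    unfolding L2_fun_def by (intro conjI Fm integrableI_bounded) (use nn in auto)
  show "L2_sq ?F = L2_sq f"
    unfolding L2_sq_def[of ?F] by (subst integral_eq_nn_integral) (use nn L2_sq_nonneg in auto)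
qed

subsection \<open>Wavelet systems on the Fourier side\<close>

definition inv_fourier :: "(real \<Rightarrow> complex) \<Rightarrow> real \<Rightarrow> complex" where
  "inv_fourier f x = fourier_integral f (- x)"

lemma inv_fourier_L2: "L2_compact f \<Longrightarrow> L2_fun (inv_fourier f)"
  using L2_fun_affine[OF plancherel_compact(1), of f "-1" 0] by (simp add: inv_fourier_def[abs_def])

lemma L2_sq_inv_fourier: "L2_compact f \<Longrightarrow> L2_sq (inv_fourier f) = L2_sq f"
  using plancherel_compact(2)[of f] L2_sq_affine[of "-1" "fourier_integral f" 0]
  by (simp add: inv_fourier_def[abs_def])

lemma integrable_mult_cis:
  assumes "L2_compact f" shows "integrable lebesgue (\<lambda>x. f x * cis (a * x))"
proof (rule Bochner_Integration.integrable_bound[OF L2_compact_integrable[OF assms]])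
  have [measurable]: "f \<in> borel_measurable lebesgue"
    using assms by (auto simp: L2_compact_def)
  show "(\<lambda>x. f x * cis (a * x)) \<in> borel_measurable lebesgue"
    unfolding cis_conv_exp by measurable
qed (simp add: norm_mult)

lemma inv_fourier_integral: "inv_fourier f x = (LINT \<xi>|lebesgue. f \<xi> * cis (2 * pi * x * \<xi>))"
  by (simp add: inv_fourier_def fourier_integral_cis mult_ac)

lemma inv_fourier_diff:
  assumes "L2_compact f" "L2_compact g"
  shows "inv_fourier (\<lambda>x. f x - g x) x = inv_fourier f x - inv_fourier g x"
  unfolding inv_fourier_integral left_diff_distrib
  by (rule Bochner_Integration.integral_diff) (use assms integrable_mult_cis in auto)

lemma inv_fourier_cmult: "inv_fourier (\<lambda>x. c * f x) x = c * inv_fourier f x"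
  unfolding inv_fourier_integral by (simp add: mult.assoc)

lemma inv_fourier_sum:
  assumes "\<And>i. i \<in> A \<Longrightarrow> L2_compact (f i)"
  shows "inv_fourier (\<lambda>x. \<Sum>i\<in>A. f i x) x = (\<Sum>i\<in>A. inv_fourier (f i) x)"
  unfolding inv_fourier_integral sum_distrib_right
  by (rule Bochner_Integration.integral_sum) (use assms integrable_mult_cis in auto)

text \<open>Fubini's theorem for \<open>g x \<xi>\<close>, which is integrable on the plane because
  its modulus is the product of those of \<open>f\<close> and \<open>h\<close>.\<close>

lemma fourier_inner_adjoint:
  assumes f: "L2_compact f" and h: "L2_compact h"
  shows "L2_inner f (inv_fourier h) = L2_inner (fourier_integral f) h"
proof -
  note fh = f[THEN L2_compact_L2] h[THEN L2_compact_L2]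
  note [measurable] = fh
  define g where "g = (\<lambda>x \<xi>. f x * cnj (h \<xi>) * cis (- (2 * pi * x * \<xi>)))"
  have fi: "integrable lebesgue f" and hi: "integrable lebesgue h"
    using f h by (auto intro: L2_compact_integrable)
  have cnj_m [measurable]: "cnj \<in> borel_measurable borel"
    by (intro borel_measurable_continuous_onI continuous_intros)
  have gm [measurable]: "case_prod g \<in> borel_measurable (lebesgue \<Otimes>\<^sub>M lebesgue)"
  proof -
    have [measurable]: "f \<in> borel_measurable lebesgue" "h \<in> borel_measurable lebesgue"
      using fh by (auto dest: L2_fun_measurable)
    have [measurable]: "(\<lambda>z. f (fst z)) \<in> borel_measurable (lebesgue \<Otimes>\<^sub>M lebesgue)"
      "(\<lambda>z. h (snd z)) \<in> borel_measurable (lebesgue \<Otimes>\<^sub>M lebesgue)"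
      by (rule measurable_compose[OF measurable_fst] measurable_compose[OF measurable_snd], fact)+
    have [measurable]: "(\<lambda>z. fst z) \<in> borel_measurable ((lebesgue :: real measure) \<Otimes>\<^sub>M (lebesgue :: real measure))"
      "(\<lambda>z. snd z) \<in> borel_measurable ((lebesgue :: real measure) \<Otimes>\<^sub>M (lebesgue :: real measure))"
      by (rule measurable_compose[OF measurable_fst ident_borel_measurable_lebesgue]
          measurable_compose[OF measurable_snd ident_borel_measurable_lebesgue])+
    have [measurable]: "(\<lambda>z. cnj (h (snd z))) \<in> borel_measurable (lebesgue \<Otimes>\<^sub>M lebesgue)"
      by (rule measurable_compose[OF _ cnj_m]) measurable
    show ?thesis
      unfolding g_def cis_conv_exp case_prod_unfold by measurable
  qed
  have ng: "norm (g x \<xi>) = cmod (f x) * cmod (h \<xi>)" for x \<xi>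
    by (simp add: g_def norm_mult)
  have int: "integrable (lebesgue \<Otimes>\<^sub>M lebesgue) (case_prod g)"
  proof (rule lebesgue_pair.Fubini_integrable)
    show "integrable lebesgue (\<lambda>x. LINT y|lebesgue. norm (case_prod g (x, y)))"
      using fi by (simp add: ng)
    show "AE x in lebesgue. integrable lebesgue (\<lambda>y. case_prod g (x, y))"
    proof (rule AE_I2)
      fix x
      have "integrable lebesgue (\<lambda>y. f x * h y)" using hi by simp
      thus "integrable lebesgue (\<lambda>y. case_prod g (x, y))"
        by (rule Bochner_Integration.integrable_bound)
          (auto simp: g_def cis_conv_exp norm_mult)
    qed
  qed simp
  have "L2_inner f (inv_fourier h) = (LINT x|lebesgue. LINT \<xi>|lebesgue. g x \<xi>)"
    unfolding L2_inner_def
  proof (intro Bochner_Integration.integral_cong refl)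
    fix x
    have "cnj (inv_fourier h x) = (LINT \<xi>|lebesgue. cnj (h \<xi> * cis (2 * pi * x * \<xi>)))"
      unfolding inv_fourier_integral by (rule Bochner_Integration.integral_cnj[symmetric])
    also have "f x * \<dots> = (LINT \<xi>|lebesgue. f x * cnj (h \<xi> * cis (2 * pi * x * \<xi>)))"
      by (rule Bochner_Integration.integral_mult_right_zero[symmetric])
    finally show "f x * cnj (inv_fourier h x) = (LINT \<xi>|lebesgue. g x \<xi>)"
      by (simp add: g_def cis_cnj mult.assoc)
  qed
  also have "\<dots> = (LINT \<xi>|lebesgue. LINT x|lebesgue. g x \<xi>)"
    by (rule lebesgue_pair.Fubini_integral[OF int, symmetric])
  also have "\<dots> = L2_inner (fourier_integral f) h"
    unfolding L2_inner_def
  proof (intro Bochner_Integration.integral_cong refl)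
    fix \<xi>
    have "fourier_integral f \<xi> * cnj (h \<xi>) =
        (LINT x|lebesgue. f x * cis (- (2 * pi * x * \<xi>)) * cnj (h \<xi>))"
      unfolding fourier_integral_cis by (rule Bochner_Integration.integral_mult_left_zero[symmetric])
    thus "(LINT x|lebesgue. g x \<xi>) = fourier_integral f \<xi> * cnj (h \<xi>)"
      by (simp add: g_def mult_ac)
  qed
  finally show ?thesis .
qed

text \<open>After expanding both squares the norms agree by Plancherel's identity and the mixed
  terms by adjointness. Closeness of the Fourier integral of \<open>f\<close> to \<open>h\<close>
  thus means closeness of \<open>f\<close> to the inverse transform of \<open>h\<close>.\<close>

lemma L2_sq_diff_inv_fourier:
  assumes f: "L2_compact f" and h: "L2_compact h"
  shows "L2_sq (\<lambda>x. f x - inv_fourier h x) = L2_sq (\<lambda>\<xi>. fourier_integral f \<xi> - h \<xi>)"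
  using assms
  by (simp add: L2_sq_diff inv_fourier_L2 plancherel_compact fourier_inner_adjoint L2_sq_inv_fourier)

text \<open>Polarization: norms of differences determine the real part, and replacing
  \<open>g\<close> by \<open>\<i> * g\<close> turns the imaginary part into a real one.\<close>

lemma inner_inv_fourier:
  assumes f: "L2_compact f" and g: "L2_compact g"
  shows "L2_inner (inv_fourier f) (inv_fourier g) = L2_inner f g"
proof -
  have re: "Re (L2_inner (inv_fourier f) (inv_fourier g)) = Re (L2_inner f g)" if "L2_compact g" for g
  proof -
    have "L2_sq (\<lambda>x. inv_fourier f x - inv_fourier g x) = L2_sq (\<lambda>x. f x - g x)"
      using L2_sq_inv_fourier[OF L2_compact_diff[OF f that]]
      by (simp add: inv_fourier_diff[OF f that, abs_def])
    thus ?thesis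
      using f that by (simp add: L2_sq_diff inv_fourier_L2 L2_sq_inv_fourier)
  qed
  have cm: "L2_inner u (\<lambda>x. \<i> * v x) = - \<i> * L2_inner u v" for u v
    by (subst (1 2) L2_inner_commute) (simp add: L2_inner_cmult_left)
  have "Im (L2_inner (inv_fourier f) (inv_fourier g)) =
      Re (L2_inner (inv_fourier f) (inv_fourier (\<lambda>x. \<i> * g x)))"
    by (simp add: inv_fourier_cmult[abs_def] cm)
  also have "\<dots> = Im (L2_inner f g)"
    by (subst re[OF L2_compact_cmult[OF g]]) (simp add: cm)
  finally show ?thesis using re[OF g] by (simp add: complex_eq_iff)
qed

text \<open>By the preceding identity the truncations of \<open>\<psi>\<close> have the same distance from
  \<open>inv_fourier g\<close> as their Fourier transforms have from \<open>g\<close>.\<close>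

theorem has_L2_fourier_transform_compact_iff:
  assumes \<psi>: "L2_fun \<psi>" and g: "L2_compact g"
  shows "has_L2_fourier_transform \<psi> g \<longleftrightarrow> (AE x in lebesgue. \<psi> x = inv_fourier g x)"
proof -
  let ?t = "\<lambda>R x. indicator {-R..R} x * \<psi> x"
  have tc: "L2_compact (?t R)" for R by (rule L2_compact_indicator_mult[OF \<psi>])
  have Fg: "L2_fun (inv_fourier g)" by (rule inv_fourier_L2[OF g])
  have dist: "L2_sqdist (fourier_integral (?t R)) g = ennreal (L2_sq (\<lambda>x. ?t R x - inv_fourier g x))" for R
    using L2_sqdist_eq[OF plancherel_compact(1)[OF tc[of R]] L2_compact_L2[OF g]]
    by (simp add: L2_sq_diff_inv_fourier[OF tc g])
  show ?thesis
  proof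
    assume "has_L2_fourier_transform \<psi> g"
    hence "((\<lambda>R. ennreal (L2_sq (\<lambda>x. ?t R x - inv_fourier g x))) \<longlongrightarrow> 0) at_top"
      unfolding has_L2_fourier_transform_def dist by auto
    hence "(\<lambda>n. ennreal (L2_sq (\<lambda>x. ?t (real n) x - inv_fourier g x))) \<longlonglongrightarrow> 0"
      by (rule filterlim_compose[OF _ filterlim_real_sequentially])
    hence 1: "(\<lambda>n. L2_sq (\<lambda>x. ?t (real n) x - inv_fourier g x)) \<longlonglongrightarrow> 0"
      by (simp add: ennreal_tendsto_0_iff L2_sq_nonneg)
    have 2: "(\<lambda>n. L2_sq (\<lambda>x. \<psi> x - ?t (real n) x)) \<longlonglongrightarrow> 0"
      by (rule L2_sq_indicator_tendsto[OF \<psi> filterlim_real_sequentially])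
    have "(\<lambda>n. 2 * L2_sq (\<lambda>x. \<psi> x - ?t (real n) x) +
        2 * L2_sq (\<lambda>x. ?t (real n) x - inv_fourier g x)) \<longlonglongrightarrow> 2 * 0 + 2 * 0"
      by (intro tendsto_intros 1 2)
    hence "L2_sq (\<lambda>x. \<psi> x - inv_fourier g x) \<le> 2 * 0 + 2 * 0"
      by (rule Lim_bounded2) (use L2_sq_triangle[OF \<psi> L2_compact_L2[OF tc] Fg] in blast)
    hence "L2_sq (\<lambda>x. \<psi> x - inv_fourier g x) = 0"
      using L2_sq_nonneg by (simp add: order_antisym)
    hence "AE x in lebesgue. \<psi> x - inv_fourier g x = 0"
      by (subst (asm) L2_sq_eq_0_iff) (auto intro: L2_fun_diff \<psi> Fg)
    thus "AE x in lebesgue. \<psi> x = inv_fourier g x" by simp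
  next
    assume ae: "AE x in lebesgue. \<psi> x = inv_fourier g x"
    have eq: "L2_sq (\<lambda>x. ?t R x - inv_fourier g x) = L2_sq (\<lambda>x. \<psi> x - ?t R x)" for R
    proof -
      have "L2_sq (\<lambda>x. ?t R x - inv_fourier g x) = L2_sq (\<lambda>x. ?t R x - \<psi> x)"
      proof (rule L2_sq_cong_AE)
        show "AE x in lebesgue. ?t R x - inv_fourier g x = ?t R x - \<psi> x"
          using ae by eventually_elim simp
      qed (intro L2_fun_measurable L2_fun_diff L2_compact_L2[OF tc] \<psi> Fg)+
      thus ?thesis by (simp add: L2_sq_sym)
    qed
    have "((\<lambda>R. L2_sq (\<lambda>x. ?t R x - inv_fourier g x)) \<longlongrightarrow> 0) at_top"
      unfolding eq by (rule tendsto_at_topI_sequentially) (rule L2_sq_indicator_tendsto[OF \<psi>])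
    from tendsto_ennrealI[OF this] show "has_L2_fourier_transform \<psi> g"
      unfolding has_L2_fourier_transform_def dist using \<psi> g by simp
  qed
qed

text \<open>\<open>f\<close> is truncated to \<open>u\<close>, then the Fourier integral of
  \<open>u\<close> is truncated to \<open>h\<close>; the distance identity carries the second error
  back.\<close>

lemma inv_fourier_dense:
  assumes f: "L2_fun f" and e: "e > 0"
  obtains h where "L2_compact h" "L2_sq (\<lambda>x. f x - inv_fourier h x) < e"
proof -
  have trunc: "\<exists>n::nat. L2_sq (\<lambda>x. u x - indicator {-real n..real n} x * u x) < e / 4" if "L2_fun u" for u
  proof -
    have "\<forall>\<^sub>F n in sequentially. L2_sq (\<lambda>x. u x - indicator {-real n..real n} x * u x) < e / 4"
      by (rule order_tendstoD(2)[OF L2_sq_indicator_tendsto[OF that filterlim_real_sequentially]])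
        (use e in auto)
    thus ?thesis by (auto simp: eventually_sequentially)
  qed
  obtain n :: nat where n: "L2_sq (\<lambda>x. f x - indicator {-real n..real n} x * f x) < e / 4"
    using trunc[OF f] by blast
  define u where "u = (\<lambda>x. indicator {-real n..real n} x * f x)"
  have u: "L2_compact u" unfolding u_def by (rule L2_compact_indicator_mult[OF f])
  obtain m :: nat where m: "L2_sq (\<lambda>x. fourier_integral u x -
      indicator {-real m..real m} x * fourier_integral u x) < e / 4"
    using trunc[OF plancherel_compact(1)[OF u]] by blast
  define h where "h = (\<lambda>x. indicator {-real m..real m} x * fourier_integral u x)"
  have h: "L2_compact h" unfolding h_def by (rule L2_compact_indicator_mult[OF plancherel_compact(1)[OF u]])
  have "L2_sq (\<lambda>x. u x - inv_fourier h x) < e / 4"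
    unfolding L2_sq_diff_inv_fourier[OF u h] using m by (simp add: h_def)
  moreover have "L2_sq (\<lambda>x. f x - inv_fourier h x) \<le>
      2 * L2_sq (\<lambda>x. f x - u x) + 2 * L2_sq (\<lambda>x. u x - inv_fourier h x)"
    by (intro L2_sq_triangle f inv_fourier_L2 h L2_compact_L2 u)
  ultimately have "L2_sq (\<lambda>x. f x - inv_fourier h x) < e" using n by (simp add: u_def)
  with h show ?thesis by (rule that)
qed

section \<open>Dilates on the frequency side\<close>

definition dilates :: "(real \<Rightarrow> complex) \<Rightarrow> int \<times> int \<Rightarrow> real \<Rightarrow> complex" where
  "dilates g = (\<lambda>(j, k) \<xi>. of_real (2 powr (- of_int j / 2)) *
     (g (2 powi (- j) * \<xi>) * cis (- (2 * pi * of_int k * (2 powi (- j) * \<xi>)))))"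

lemma powr_half_mult_powi: "2 powi j * 2 powr (- of_int j / 2) = (2 powr (of_int j / 2) :: real)"
proof -
  have "(2::real) powi j = 2 powr (of_int j)" by (simp add: powr_real_of_int')
  thus ?thesis by (simp add: powr_add[symmetric])
qed

lemma powr_half_sq: "(2 powr (- of_int j / 2))\<^sup>2 = (2 powi (- j) :: real)"
proof -
  have "(2 powr (- of_int j / 2))\<^sup>2 = (2::real) powr (of_int (- j))"
    by (simp add: power2_eq_square powr_add[symmetric])
  also have "\<dots> = 2 powi (- j)" by (rule powr_real_of_int') auto
  finally show ?thesis .
qed

lemma powi_minus_mult: "(2::real) powi (- j) * (2 powi j * x) = x"
  by (simp add: power_int_minus)

text \<open>The Jacobian \<open>2 powi j\<close> turns the normalization of the frequency side into
  that of the wavelet system, and the exponential factor becomes the translation by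
  \<open>k\<close>.\<close>

lemma inv_fourier_dilates:
  "inv_fourier (dilates g i) = wavelet_system (inv_fourier g) i"
proof
  fix x
  obtain j k where i: "i = (j, k)" by (cases i)
  have "inv_fourier (dilates g i) x =
      \<bar>2 powi j\<bar> *\<^sub>R (LINT \<xi>|lebesgue. dilates g i (0 + 2 powi j * \<xi>) *
        cis (2 * pi * x * (0 + 2 powi j * \<xi>)))"
    unfolding inv_fourier_integral by (rule lebesgue_integral_real_affine) simp
  also have "(\<lambda>\<xi>. dilates g i (0 + 2 powi j * \<xi>) * cis (2 * pi * x * (0 + 2 powi j * \<xi>))) =
      (\<lambda>\<xi>. of_real (2 powr (- of_int j / 2)) * (g \<xi> * cis (2 * pi * (2 powi j * x - of_int k) * \<xi>)))"
  proof
    fix \<xi>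
    have "- (2 * pi * of_int k * \<xi>) + 2 * pi * x * (2 powi j * \<xi>) =
        2 * pi * (2 powi j * x - of_int k) * \<xi>" by (simp add: algebra_simps)
    hence "cis (- (2 * pi * of_int k * \<xi>)) * cis (2 * pi * x * (2 powi j * \<xi>)) =
        cis (2 * pi * (2 powi j * x - of_int k) * \<xi>)" by (simp only: cis_mult)
    thus "dilates g i (0 + 2 powi j * \<xi>) * cis (2 * pi * x * (0 + 2 powi j * \<xi>)) =
      of_real (2 powr (- of_int j / 2)) * (g \<xi> * cis (2 * pi * (2 powi j * x - of_int k) * \<xi>))"
      by (simp add: i dilates_def powi_minus_mult mult.assoc)
  qed
  also have "\<bar>2 powi j\<bar> *\<^sub>R (LINT \<xi>|lebesgue. of_real (2 powr (- of_int j / 2)) *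
      (g \<xi> * cis (2 * pi * (2 powi j * x - of_int k) * \<xi>))) =
      of_real (2 powi j * 2 powr (- of_int j / 2)) * inv_fourier g (2 powi j * x - of_int k)"
    by (simp add: inv_fourier_integral scaleR_conv_of_real)
  finally show "inv_fourier (dilates g i) x = wavelet_system (inv_fourier g) i x"
    unfolding powr_half_mult_powi by (simp add: i wavelet_system_def)
qed

lemma L2_compact_dilates:
  assumes "L2_compact g" shows "L2_compact (dilates g i)"
proof -
  obtain j k where i: "i = (j, k)" by (cases i)
  obtain M where M: "M > 0" "\<And>x. \<bar>x\<bar> > M \<Longrightarrow> g x = 0" "L2_fun g" using L2_compactE[OF assms] by metis
  have L2: "L2_fun (\<lambda>\<xi>. g (2 powi (- j) * \<xi>))"
    using L2_fun_affine[OF M(3), of "2 powi (- j)" 0] by simp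
  note [measurable] = L2
  have "dilates g i \<in> borel_measurable lebesgue"
    unfolding dilates_def i case_prod_conv cis_conv_exp by measurable
  hence "L2_fun (dilates g i)"
    by (rule L2_fun_dominated[OF L2, of _ "2 powr (- of_int j / 2)"])
      (simp add: dilates_def i norm_mult)
  moreover have "dilates g i x = 0" if "\<bar>x\<bar> > 2 powi j * M" for x
  proof -
    have "\<bar>2 powi (- j) * x\<bar> > M"
      using that by (simp add: abs_mult power_int_minus field_simps)
    thus ?thesis by (simp add: dilates_def i M(2))
  qed
  ultimately show ?thesis unfolding L2_compact_def by blast
qed

lemma L2_fun_wavelet_system: "L2_fun \<psi> \<Longrightarrow> L2_fun (wavelet_system \<psi> i)"
proof -
  assume \<psi>: "L2_fun \<psi>"
  obtain j k where i: "i = (j, k)" by (cases i)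
  show ?thesis
    using L2_fun_cmult[OF L2_fun_affine[OF \<psi>, of "2 powi j" "- of_int k"]]
    by (simp add: i wavelet_system_def algebra_simps)
qed

lemma wavelet_system_cong_AE:
  assumes "AE x in lebesgue. \<psi> x = \<phi> x"
  shows "AE x in lebesgue. wavelet_system \<psi> i x = wavelet_system \<phi> i x"
proof -
  obtain j k where i: "i = (j, k)" by (cases i)
  have "AE x in lebesgue. \<psi> (- of_int k + 2 powi j * x) = \<phi> (- of_int k + 2 powi j * x)"
    by (rule AE_lebesgue_affine[OF assms]) simp
  thus ?thesis
    by eventually_elim (simp add: i wavelet_system_def algebra_simps)
qed

definition L2_orthonormal :: "('i \<Rightarrow> real \<Rightarrow> complex) \<Rightarrow> bool" where
  "L2_orthonormal G \<longleftrightarrow> (\<forall>i i'. L2_inner (G i) (G i') = (if i = i' then 1 else 0))"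

text \<open>Compactly supported \<open>h\<close> suffice as test functions, because their inverse
  transforms are dense by \<open>inv_fourier_dense\<close>.\<close>

definition L2_total :: "('i \<Rightarrow> real \<Rightarrow> complex) \<Rightarrow> bool" where
  "L2_total G \<longleftrightarrow> (\<forall>h r. L2_compact h \<longrightarrow> r > 0 \<longrightarrow> (\<exists>q\<in>lin_span G. L2_sq (\<lambda>x. h x - q x) < r))"

theorem wavelet_basis_iff:
  assumes \<psi>: "L2_fun \<psi>" and g: "L2_compact g" and ae: "AE x in lebesgue. \<psi> x = inv_fourier g x"
  shows "L2_orthonormal_basis (wavelet_system \<psi>) \<longleftrightarrow>
    L2_orthonormal (dilates g) \<and> L2_total (dilates g)"
proof -
  let ?e = "wavelet_system \<psi>" and ?G = "dilates g"
  have eL2: "L2_fun (?e i)" for i by (rule L2_fun_wavelet_system[OF \<psi>])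
  have Gc: "L2_compact (?G i)" for i by (rule L2_compact_dilates[OF g])
  have IG: "L2_fun (inv_fourier (?G i))" for i by (rule inv_fourier_L2[OF Gc])
  have eG: "AE x in lebesgue. ?e i x = inv_fourier (?G i) x" for i
    unfolding inv_fourier_dilates by (rule wavelet_system_cong_AE[OF ae])
  have inner: "L2_inner (?e i) (?e i') = L2_inner (?G i) (?G i')" for i i'
    unfolding inner_inv_fourier[OF Gc Gc, symmetric]
    by (rule L2_inner_cong_AE) (use eL2 IG eG in auto)
  have sumL2: "L2_fun (\<lambda>x. \<Sum>i\<in>F. c i * ?e i x)" for F c
    by (intro L2_fun_sum L2_fun_cmult eL2)
  have dist: "L2_sq (\<lambda>x. inv_fourier h x - (\<Sum>i\<in>F. c i * ?e i x)) = L2_sq (\<lambda>x. h x - (\<Sum>i\<in>F. c i * ?G i x))"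
    if "finite F" and h: "L2_compact h" for F c h
  proof -
    let ?s = "\<lambda>x. \<Sum>i\<in>F. c i * ?G i x"
    have sc: "L2_compact ?s" by (intro L2_compact_sum L2_compact_cmult Gc)
    have "AE x in lebesgue. \<forall>i\<in>F. ?e i x = inv_fourier (?G i) x"
      using eG \<open>finite F\<close> by (simp add: AE_finite_all)
    hence "AE x in lebesgue. inv_fourier h x - (\<Sum>i\<in>F. c i * ?e i x) = inv_fourier (\<lambda>x. h x - ?s x) x"
      by eventually_elim
        (simp add: inv_fourier_diff[OF h sc] inv_fourier_sum L2_compact_cmult Gc inv_fourier_cmult)
    hence "L2_sq (\<lambda>x. inv_fourier h x - (\<Sum>i\<in>F. c i * ?e i x)) = L2_sq (inv_fourier (\<lambda>x. h x - ?s x))"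
      by (intro L2_sq_cong_AE)
        (auto intro!: L2_fun_measurable L2_fun_diff inv_fourier_L2 h sumL2 L2_compact_diff sc)
    thus ?thesis by (simp add: L2_sq_inv_fourier[OF L2_compact_diff[OF h sc]])
  qed
  show ?thesis (is "_ \<longleftrightarrow> ?on \<and> ?dense")
  proof
    assume basis: "L2_orthonormal_basis ?e"
    hence ?on unfolding L2_orthonormal_basis_def L2_orthonormal_def inner by auto
    moreover have ?dense
      unfolding L2_total_def
    proof (intro allI impI)
      fix h :: "real \<Rightarrow> complex" and r :: real
      assume h: "L2_compact h" and r: "r > 0"
      have hL: "L2_fun (inv_fourier h)" by (rule inv_fourier_L2[OF h])
      obtain F c where F: "finite F" "L2_sqdist (inv_fourier h) (\<lambda>x. \<Sum>i\<in>F. c i * ?e i x) < ennreal r"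
        using basis hL r unfolding L2_orthonormal_basis_def by blast
      have "ennreal (L2_sq (\<lambda>x. h x - (\<Sum>i\<in>F. c i * ?G i x))) < ennreal r"
        using F(2) unfolding L2_sqdist_eq[OF hL sumL2] dist[OF F(1) h] .
      hence "L2_sq (\<lambda>x. h x - (\<Sum>i\<in>F. c i * ?G i x)) < r"
        by (simp add: ennreal_less_iff L2_sq_nonneg)
      thus "\<exists>q\<in>lin_span ?G. L2_sq (\<lambda>x. h x - q x) < r"
        by (intro bexI[of _ "\<lambda>x. \<Sum>i\<in>F. c i * ?G i x"] lin_span_memI F(1))
    qed
    ultimately show "?on \<and> ?dense" ..
  next
    assume *: "?on \<and> ?dense"
    show "L2_orthonormal_basis ?e"
      unfolding L2_orthonormal_basis_def
    proof (intro conjI allI impI)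
      fix f :: "real \<Rightarrow> complex" and r :: real
      assume f: "L2_fun f" and r: "r > 0"
      obtain h where h: "L2_compact h" "L2_sq (\<lambda>x. f x - inv_fourier h x) < r / 4"
        using inv_fourier_dense[OF f, of "r / 4"] r by auto
      have "r / 4 > 0" using r by simp
      then obtain q where q: "q \<in> lin_span ?G" "L2_sq (\<lambda>x. h x - q x) < r / 4"
        using * h(1) unfolding L2_total_def by blast
      obtain F c where F: "finite F" "q = (\<lambda>x. \<Sum>i\<in>F. c i * ?G i x)"
        using q(1) by (rule lin_span_memE)
      have "L2_sq (\<lambda>x. f x - (\<Sum>i\<in>F. c i * ?e i x)) \<le> 2 * L2_sq (\<lambda>x. f x - inv_fourier h x) +
          2 * L2_sq (\<lambda>x. inv_fourier h x - (\<Sum>i\<in>F. c i * ?e i x))"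
        by (intro L2_sq_triangle f inv_fourier_L2 h sumL2)
      also have "\<dots> < r" using h(2) q(2) unfolding dist[OF F(1) h(1)] F(2) by linarith
      finally have "L2_sqdist f (\<lambda>x. \<Sum>i\<in>F. c i * ?e i x) < ennreal r"
        unfolding L2_sqdist_eq[OF f sumL2] using L2_sq_nonneg r by (simp add: ennreal_less_iff)
      thus "\<exists>F c. finite F \<and> L2_sqdist f (\<lambda>x. \<Sum>i\<in>F. c i * ?e i x) < ennreal r"
        using F(1) by blast
    next
      fix i i' :: "int \<times> int"
      show "L2_fun (?e i)" by (rule eL2)
      show "L2_inner (?e i) (?e i') = (if i = i' then 1 else 0)"
        unfolding inner using * unfolding L2_orthonormal_def by blast
    qed
  qed
qed

subsection \<open>Wavelet sets and tilings\<close>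

lemma integral_periodize:
  fixes u :: "real \<Rightarrow> 'a::euclidean_space"
  assumes u: "integrable lebesgue u" and supp: "\<And>x. \<bar>x\<bar> > of_int M \<Longrightarrow> u x = 0"
  shows "(LINT x|lebesgue. u x) =
    (LINT x|lebesgue. indicator {0..<1} x *\<^sub>R (\<Sum>m\<in>{-M..M}. u (of_int m + x)))"
proof -
  have int: "integrable lebesgue (\<lambda>x. indicator S x *\<^sub>R v x)"
    if "integrable lebesgue v" "S \<in> sets lebesgue" for v :: "real \<Rightarrow> 'a" and S
    using integrable_mult_indicator[OF that(2,1)] .
  have ush: "integrable lebesgue (\<lambda>x. u (of_int m + x))" for m
    using lebesgue_integrable_real_affine[OF u, of 1 "of_int m"] by simp
  have dec: "u x = (\<Sum>m\<in>{-M..M}. indicator {of_int m..<of_int m + 1} x *\<^sub>R u x)" for x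
  proof (cases "u x = 0")
    case False
    hence "\<bar>x\<bar> \<le> of_int M" using supp[of x] by force
    hence mem: "\<lfloor>x\<rfloor> \<in> {-M..M}"
      by (auto simp: floor_le_iff le_floor_iff)
    have "indicator {of_int m..<of_int m + 1} x = (if m = \<lfloor>x\<rfloor> then 1 else 0 :: real)" for m :: int
      by (auto simp: indicator_def eq_commute[of _ "\<lfloor>x\<rfloor>"] floor_eq_iff)
    hence "(\<Sum>m\<in>{-M..M}. indicator {of_int m..<of_int m + 1} x *\<^sub>R u x) =
        (\<Sum>m\<in>{-M..M}. if m = \<lfloor>x\<rfloor> then u x else 0)"
      by (intro sum.cong) auto
    thus ?thesis using mem by simp
  qed simp
  have "(LINT x|lebesgue. u x) = (LINT x|lebesgue. (\<Sum>m\<in>{-M..M}. indicator {of_int m..<of_int m + 1} x *\<^sub>R u x))"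
    by (intro Bochner_Integration.integral_cong refl dec)
  also have "\<dots> = (\<Sum>m\<in>{-M..M}. LINT x|lebesgue. indicator {of_int m..<of_int m + 1} x *\<^sub>R u x)"
    by (rule Bochner_Integration.integral_sum) (intro int u, simp)
  also have "\<dots> = (\<Sum>m\<in>{-M..M}. LINT x|lebesgue. indicator {0..<1} x *\<^sub>R u (of_int m + x))"
  proof (intro sum.cong refl)
    fix m
    have "(LINT x|lebesgue. indicator {of_int m..<of_int m + 1} x *\<^sub>R u x) =
        \<bar>1\<bar> *\<^sub>R (LINT x|lebesgue. indicator {of_int m..<of_int m + 1} (of_int m + 1 * x) *\<^sub>R u (of_int m + 1 * x))"
      by (rule lebesgue_integral_real_affine) simp
    also have "\<dots> = (LINT x|lebesgue. indicator {0..<1} x *\<^sub>R u (of_int m + x))"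
      by (simp, intro Bochner_Integration.integral_cong refl) (auto split: split_indicator)
    finally show "(LINT x|lebesgue. indicator {of_int m..<of_int m + 1} x *\<^sub>R u x) =
        (LINT x|lebesgue. indicator {0..<1} x *\<^sub>R u (of_int m + x))" .
  qed
  also have "\<dots> = (LINT x|lebesgue. (\<Sum>m\<in>{-M..M}. indicator {0..<1} x *\<^sub>R u (of_int m + x)))"
    by (rule Bochner_Integration.integral_sum[symmetric]) (intro int ush, simp)
  finally show ?thesis by (simp add: scaleR_sum_right)
qed

lemma cis_int_shift: "cis (2 * pi * of_int k * (of_int m + x)) = cis (2 * pi * of_int k * x)"
proof -
  have "cis (2 * pi * of_int k * (of_int m + x)) =
      cis (2 * pi * of_int (k * m)) * cis (2 * pi * of_int k * x)"
    by (simp add: cis_mult algebra_simps)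
  thus ?thesis by (simp only: cis_multiple_2pi[OF Ints_of_int] mult_1_left)
qed

lemma AE_endpoint: "AE x in lebesgue. (x::real) \<noteq> c"
proof -
  have "{c} \<in> null_sets lebesgue" by (simp flip: negligible_iff_null_sets)
  from AE_not_in[OF this] show ?thesis by simp
qed

lemma integral_cis_unit:
  "(LINT x|lebesgue. indicator {0..<1} x *\<^sub>R cis (2 * pi * of_int k * x)) = (if k = 0 then 1 else 0)"
proof -
  have "(LINT x|lebesgue. indicator {0..<1} x *\<^sub>R cis (2 * pi * of_int k * x)) =
      (LINT x|lebesgue. indicator {0..0 + 1} x * cis (2 * pi * of_int k * x / 1))"
  proof (rule integral_cong_AE)
    show "AE x in lebesgue. indicator {0..<1} x *\<^sub>R cis (2 * pi * of_int k * x) =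
        indicator {0..0 + 1} x * cis (2 * pi * of_int k * x / 1)"
      using AE_endpoint[of 1] by eventually_elim (auto split: split_indicator)
    have [measurable]: "(\<lambda>x. cis (2 * pi * of_int k * x)) \<in> borel_measurable lebesgue"
      unfolding cis_conv_exp by measurable
    show "(\<lambda>x. indicator {0..<1} x *\<^sub>R cis (2 * pi * of_int k * x)) \<in> borel_measurable lebesgue"
      "(\<lambda>x. indicator {0..0 + 1} x * cis (2 * pi * of_int k * x / 1)) \<in> borel_measurable lebesgue"
      by simp_all
  qed
  thus ?thesis using integral_cis_period[of 1 0 k] by simp
qed

lemma AE_of_unit_interval:
  assumes "AE x in lebesgue. x \<in> {0..<1} \<longrightarrow> P x" "\<And>x k. P x \<Longrightarrow> P (x + of_int k)"
  shows "AE x in lebesgue. P (x::real)"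
proof -
  have "AE x in lebesgue. of_int (-k) + 1 * x \<in> {0..<1} \<longrightarrow> P (of_int (-k) + 1 * x)" for k :: int
    by (rule AE_lebesgue_affine[OF assms(1)]) simp
  hence "AE x in lebesgue. \<forall>k::int. of_int (-k) + 1 * x \<in> {0..<1} \<longrightarrow> P (of_int (-k) + 1 * x)"
    by (simp only: AE_all_countable) blast
  thus ?thesis
  proof eventually_elim
    case (elim x)
    have "of_int (-\<lfloor>x\<rfloor>) + 1 * x \<in> {0..<1}" by (auto, linarith)
    with elim have "P (of_int (-\<lfloor>x\<rfloor>) + 1 * x)" by blast
    from assms(2)[OF this, of "\<lfloor>x\<rfloor>"] show ?case by simp
  qed
qed

lemma AE_all_dyadic:
  assumes "AE x in lebesgue. P (x::real)" shows "AE x in lebesgue. \<forall>j::int. P (2 powi j * x)"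
proof -
  have "AE x in lebesgue. P (0 + 2 powi j * x)" for j :: int
    by (rule AE_lebesgue_affine[OF assms]) simp
  thus ?thesis by (simp add: AE_all_countable)
qed

text \<open>The exponentials are 1-periodic, so the Fourier coefficients of the periodization are
  the integrals of \<open>u\<close> against them. All are 0, and Parseval's identity makes the norm
  0.\<close>

lemma periodization_eq_0:
  assumes u: "L2_compact u" and supp: "\<And>x. \<bar>x\<bar> > of_int M \<Longrightarrow> u x = 0"
    and zero: "\<And>k::int. (LINT x|lebesgue. u x * cis (2 * pi * of_int k * x)) = 0"
  shows "AE x in lebesgue. x \<in> {0..<1} \<longrightarrow> (\<Sum>m\<in>{-M..M}. u (of_int m + x)) = 0"
proof -
  define U where "U = (\<lambda>x. indicator {0..<1} x * (\<Sum>m\<in>{-M..M}. u (of_int m + x)))"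
  have UL2: "L2_fun U"
    unfolding U_def
    using L2_fun_affine[OF L2_compact_L2[OF u], of 1]
    by (intro L2_fun_indicator_mult L2_fun_sum) auto
  have "fourier_integral U (of_int k / 1) = 0" for k
  proof -
    let ?v = "\<lambda>x. u x * cis (2 * pi * of_int (- k) * x)"
    have "(LINT x|lebesgue. ?v x) =
        (LINT x|lebesgue. indicator {0..<1} x *\<^sub>R (\<Sum>m\<in>{-M..M}. ?v (of_int m + x)))"
      by (rule integral_periodize[OF integrable_mult_cis[OF u]]) (simp add: supp)
    also have "\<dots> = (LINT x|lebesgue. U x * cis (- (2 * pi * x * (of_int k / 1))))"
    proof (intro Bochner_Integration.integral_cong refl)
      fix x
      show "indicator {0..<1} x *\<^sub>R (\<Sum>m\<in>{-M..M}. ?v (of_int m + x)) = U x * cis (- (2 * pi * x * (of_int k / 1)))"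
        unfolding cis_int_shift
        by (simp add: U_def sum_distrib_right mult_ac split: split_indicator)
    qed
    finally show ?thesis unfolding fourier_integral_cis using zero[of "- k"] by simp
  qed
  moreover have "(\<lambda>n. (cmod (fourier_integral U (of_int (int_decode n) / 1)))\<^sup>2) sums (1 * L2_sq U)"
    by (rule parseval_sums[OF UL2, of 0]) (auto simp: U_def)
  ultimately have "(\<lambda>n. 0) sums L2_sq U" by simp
  hence "L2_sq U = 0" using sums_unique by fastforce
  hence "AE x in lebesgue. U x = 0" using L2_sq_eq_0_iff[OF UL2] by simp
  thus ?thesis by eventually_elim (simp add: U_def indicator_def)
qed

section \<open>From tilings to orthonormal bases\<close>

definition translation_tile :: "real set \<Rightarrow> bool" where
  "translation_tile K \<longleftrightarrow> (AE x in lebesgue. \<exists>!m::int. of_int m + x \<in> K)"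

definition dyadic_tile :: "real set \<Rightarrow> bool" where
  "dyadic_tile K \<longleftrightarrow> (AE x in lebesgue. \<exists>!j::int. 2 powi j * x \<in> K)"

lemma sum_eq_single:
  assumes "finite A" "a \<in> A" "\<And>b. b \<in> A \<Longrightarrow> b \<noteq> a \<Longrightarrow> f b = (0::'a::comm_monoid_add)"
  shows "sum f A = f a"
  using sum.mono_neutral_right[of A "{a}" f] assms by auto

text \<open>The bound \<open>M\<close> is an integer, so the integers that carry a point of the unit
  interval into \<open>K\<close> lie in \<open>{-M..M}\<close>.\<close>

context
  fixes K :: "real set" and M :: int
  assumes Km: "K \<in> sets lebesgue" and KM: "K \<subseteq> {- of_int M..of_int M}"
begin

lemma in_K_bound: "x \<in> K \<Longrightarrow> \<bar>x\<bar> \<le> of_int M"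
  using subsetD[OF KM, of x] by auto

lemma not_in_K: "\<bar>x\<bar> > of_int M \<Longrightarrow> x \<notin> K"
  using in_K_bound[of x] by auto

lemma shift_in_K_bound: "of_int m + x \<in> K \<Longrightarrow> x \<in> {0..<1} \<Longrightarrow> m \<in> {-M..M}"
proof -
  assume "of_int m + x \<in> K" "x \<in> {0..<1}"
  hence "real_of_int m \<le> of_int M" "real_of_int m > - of_int M - 1"
    using in_K_bound[of "of_int m + x"] by auto
  thus ?thesis by auto
qed

lemma indicator_K_L2: "L2_compact (indicator K)"
  by (rule L2_compact_bounded[of _ 1 "of_int M"])
    (use Km not_in_K in \<open>auto split: split_indicator\<close>)

text \<open>Exactly one term of the periodization survives, and by periodicity it is the exponential
  itself. So \<open>K\<close> has the same Fourier integrals at the integers as the unit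
  interval.\<close>

lemma integral_cis_tile:
  assumes "translation_tile K"
  shows "(LINT x|lebesgue. indicator K x * cis (2 * pi * of_int k * x)) = (if k = 0 then 1 else 0)"
proof -
  let ?v = "\<lambda>x. indicator K x * cis (2 * pi * of_int k * x)"
  have "(LINT x|lebesgue. ?v x) = (LINT x|lebesgue. indicator {0..<1} x *\<^sub>R (\<Sum>m\<in>{-M..M}. ?v (of_int m + x)))"
    by (rule integral_periodize[OF integrable_mult_cis[OF indicator_K_L2]])
      (simp add: not_in_K)
  also have "\<dots> = (LINT x|lebesgue. indicator {0..<1} x *\<^sub>R cis (2 * pi * of_int k * x))"
  proof (rule integral_cong_AE)
    have [measurable]: "(\<lambda>x. cis (2 * pi * of_int k * x)) \<in> borel_measurable lebesgue"
      unfolding cis_conv_exp by measurable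
    show "(\<lambda>x. indicator {0..<1} x *\<^sub>R cis (2 * pi * of_int k * x)) \<in> borel_measurable lebesgue"
      by simp
    have "?v \<in> borel_measurable lebesgue"
      using integrable_mult_cis[OF indicator_K_L2] by (rule borel_measurable_integrable)
    from borel_measurable_lebesgue_affine[OF this, of 1]
    have [measurable]: "(\<lambda>x. ?v (of_int m + x)) \<in> borel_measurable lebesgue" for m by simp
    show "(\<lambda>x. indicator {0..<1} x *\<^sub>R (\<Sum>m\<in>{-M..M}. ?v (of_int m + x))) \<in> borel_measurable lebesgue"
      by (intro borel_measurable_scaleR borel_measurable_sum borel_measurable_indicator) auto
    show "AE x in lebesgue. indicator {0..<1} x *\<^sub>R (\<Sum>m\<in>{-M..M}. ?v (of_int m + x)) =
        indicator {0..<1} x *\<^sub>R cis (2 * pi * of_int k * x)"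
      using assms[unfolded translation_tile_def]
    proof eventually_elim
      case (elim x)
      show ?case
      proof (cases "x \<in> {0..<1}")
        case True
        from elim obtain n where n: "of_int n + x \<in> K" "\<And>m. of_int m + x \<in> K \<Longrightarrow> m = n" by auto
        have other: "of_int m + x \<notin> K" if "m \<noteq> n" for m using n(2) that by blast
        have "(\<Sum>m\<in>{-M..M}. ?v (of_int m + x)) = ?v (of_int n + x)"
          by (rule sum_eq_single[OF _ shift_in_K_bound[OF n(1) True]]) (simp_all add: other)
        thus ?thesis using n(1) by (simp add: cis_int_shift)
      qed simp
    qed
  qed
  finally show ?thesis by (simp add: integral_cis_unit)
qed

text \<open>Periodizing functions on a translation tile is an isometry onto the functions on the
  unit interval that fixes 1-periodic factors.\<close>

lemma trig_dense_on_tile: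
  assumes tile: "translation_tile K" and F: "L2_fun F" "\<And>x. x \<notin> K \<Longrightarrow> F x = 0" and e: "e > 0"
  obtains p where "p \<in> trig_span 1" "L2_sq (\<lambda>x. F x - indicator K x * p x) < e"
proof -
  define P where "P = (\<lambda>x. \<Sum>m\<in>{-M..M}. F (of_int m + x))"
  have P: "L2_fun P"
    unfolding P_def using L2_fun_affine[OF F(1), of 1] by (intro L2_fun_sum) auto
  obtain p where p: "p \<in> trig_span 1"
      "L2_sq (\<lambda>x. indicator {0..0 + 1} x * P x - indicator {0..0 + 1} x * p x) < e"
    using trig_span_L2_dense[OF P, of 1 e 0] e by auto
  have per: "p (of_int m + x) = p x" for m x
  proof -
    obtain A c where "p = (\<lambda>x. \<Sum>k\<in>A. c k * cis (2 * pi * of_int k * x / 1))"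
      using p(1) unfolding lin_span_def by auto
    thus ?thesis by (simp add: cis_int_shift)
  qed
  have pm [measurable]: "p \<in> borel_measurable lebesgue"
    by (rule continuous_borel_measurable_lebesgue[OF trig_span_continuous[OF p(1)]])
  have Kp: "L2_fun (\<lambda>x. indicator K x * p x)"
  proof -
    obtain A c where A: "p = (\<lambda>x. \<Sum>k\<in>A. c k * cis (2 * pi * of_int k * x / 1))"
      using p(1) unfolding lin_span_def by auto
    have "cmod (p x) \<le> (\<Sum>k\<in>A. cmod (c k))" for x
      unfolding A by (rule order_trans[OF norm_sum]) (simp add: norm_mult)
    thus ?thesis
      by (intro L2_fun_dominated[OF L2_compact_L2[OF indicator_K_L2], of _ "\<Sum>k\<in>A. cmod (c k)"])
        (use Km in \<open>auto simp: norm_mult split: split_indicator\<close>)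
  qed
  define u where "u = (\<lambda>x. (cmod (F x - indicator K x * p x))\<^sup>2)"
  have u: "integrable lebesgue u"
    unfolding u_def by (rule L2_fun_integrable_sq[OF L2_fun_diff[OF F(1) Kp]])
  have "L2_sq (\<lambda>x. F x - indicator K x * p x) = (LINT x|lebesgue. u x)"
    by (simp add: L2_sq_def u_def)
  also have "\<dots> = (LINT x|lebesgue. indicator {0..<1} x *\<^sub>R (\<Sum>m\<in>{-M..M}. u (of_int m + x)))"
    by (rule integral_periodize[OF u]) (simp add: u_def F(2) not_in_K)
  also have "\<dots> = L2_sq (\<lambda>x. indicator {0..0 + 1} x * P x - indicator {0..0 + 1} x * p x)"
    unfolding L2_sq_def
  proof (rule integral_cong_AE)
    have [measurable]: "(\<lambda>x. u (of_int m + x)) \<in> borel_measurable lebesgue" for m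
      using lebesgue_integrable_real_affine[OF u, of 1 "of_int m"] by (auto dest: borel_measurable_integrable)
    show "(\<lambda>x. indicator {0..<1} x *\<^sub>R (\<Sum>m\<in>{-M..M}. u (of_int m + x))) \<in> borel_measurable lebesgue"
      by (intro borel_measurable_scaleR borel_measurable_sum borel_measurable_indicator) auto
    have [measurable]: "P \<in> borel_measurable lebesgue" using P by (rule L2_fun_measurable)
    show "(\<lambda>x. (cmod (indicator {0..0 + 1} x * P x - indicator {0..0 + 1} x * p x))\<^sup>2) \<in> borel_measurable lebesgue"
      by measurable
    show "AE x in lebesgue. indicator {0..<1} x *\<^sub>R (\<Sum>m\<in>{-M..M}. u (of_int m + x)) =
        (cmod (indicator {0..0 + 1} x * P x - indicator {0..0 + 1} x * p x))\<^sup>2"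
      using tile[unfolded translation_tile_def] AE_endpoint[of 1]
    proof eventually_elim
      case (elim x)
      show ?case
      proof (cases "x \<in> {0..<1}")
        case True
        from elim(1) obtain n where n: "of_int n + x \<in> K" "\<And>m. of_int m + x \<in> K \<Longrightarrow> m = n" by auto
        note mem = shift_in_K_bound[OF n(1) True]
        have other: "of_int m + x \<notin> K" if "m \<noteq> n" for m using n(2) that by blast
        have "(\<Sum>m\<in>{-M..M}. u (of_int m + x)) = u (of_int n + x)"
          by (rule sum_eq_single[OF _ mem]) (simp_all add: u_def other F(2))
        moreover have "P x = F (of_int n + x)"
          unfolding P_def by (rule sum_eq_single[OF _ mem]) (simp_all add: other F(2))
        ultimately show ?thesis using True n(1) by (simp add: u_def per)
      qed (use elim in \<open>auto split: split_indicator\<close>)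
    qed
  qed
  also note p(2)
  finally show ?thesis using p(1) that by blast
qed

lemma dyadic_piece_approx:
  assumes tile: "translation_tile K" and h: "L2_fun h" and e: "e > 0"
  shows "\<exists>q\<in>lin_span (dilates (indicator K)).
    L2_sq (\<lambda>x. indicator K (2 powi (- j) * x) * h x - q x) < e"
proof -
  define F where "F = (\<lambda>x. indicator K x * h (0 + 2 powi j * x))"
  have F: "L2_fun F"
    unfolding F_def by (intro L2_fun_indicator_mult L2_fun_affine h Km) simp
  \<comment> \<open>Scaling back by \<open>2 powi j\<close> multiplies squared norms by that factor,
    hence the tolerance \<open>e / 2 powi j\<close>.\<close>
  obtain p where p: "p \<in> trig_span 1" "L2_sq (\<lambda>x. F x - indicator K x * p x) < e / 2 powi j"
    using trig_dense_on_tile[OF tile F, of "e / 2 powi j"] e by (auto simp: F_def)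
  obtain A c where A: "finite A" "p = (\<lambda>x. \<Sum>k\<in>A. c k * cis (2 * pi * of_int k * x / 1))"
    using p(1) unfolding lin_span_def by auto
  \<comment> \<open>The factor \<open>2 powr (of_int j / 2)\<close> cancels the normalization in
    \<open>dilates\<close>, whose exponentials carry the opposite sign, hence the index
    \<open>- k\<close>.\<close>
  define q where "q = (\<lambda>x. \<Sum>k\<in>A. (c k * of_real (2 powr (of_int j / 2))) * dilates (indicator K) (j, - k) x)"
  have q: "q x = indicator K (2 powi (- j) * x) * p (2 powi (- j) * x)" for x
  proof -
    have "complex_of_real (2 powr (of_int j / 2)) * of_real (2 powr (- of_int j / 2)) = 1"
      by (simp only: of_real_mult[symmetric] powr_add[symmetric]) simp
    hence "\<And>k. (c k * of_real (2 powr (of_int j / 2))) * dilates (indicator K) (j, - k) x =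
        indicator K (2 powi (- j) * x) * (c k * cis (2 * pi * of_int k * (2 powi (- j) * x) / 1))"
      by (simp add: dilates_def mult_ac)
    hence "q x = (\<Sum>k\<in>A. indicator K (2 powi (- j) * x) * (c k * cis (2 * pi * of_int k * (2 powi (- j) * x) / 1)))"
      unfolding q_def by (intro sum.cong refl)
    thus ?thesis by (simp add: A(2) sum_distrib_left)
  qed
  have "q \<in> lin_span (dilates (indicator K))"
    unfolding q_def by (intro lin_span_sum lin_span_cmult lin_span_base)
  moreover have "L2_sq (\<lambda>x. indicator K (2 powi (- j) * x) * h x - q x) < e"
  proof -
    have "L2_sq (\<lambda>x. indicator K (2 powi (- j) * x) * h x - q x) =
        2 powi j * L2_sq (\<lambda>x. F x - indicator K x * p x)"
      by (subst L2_sq_affine[of "2 powi j" _ 0]) (simp_all add: q F_def powi_minus_mult)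
    also have "\<dots> < e" using p(2) by (simp add: pos_less_divide_eq mult.commute)
    finally show ?thesis .
  qed
  ultimately show ?thesis by blast
qed

lemma dilates_L2: "L2_compact (dilates (indicator K) i)"
  by (rule L2_compact_dilates[OF indicator_K_L2])

text \<open>The dyadic multiples of \<open>K\<close> partition the line up to a null set, so
  \<open>h\<close> is the limit in mean of finite sums of its pieces \<open>t j\<close>, and each
  piece can be approximated within its own scale.\<close>

lemma tile_total:
  assumes tile: "translation_tile K" and dy: "dyadic_tile K"
  shows "L2_total (dilates (indicator K))"
  unfolding L2_total_def
proof (intro allI impI)
  fix h :: "real \<Rightarrow> complex" and r :: real
  assume "L2_compact h" and r: "r > 0"
  hence h: "L2_fun h" by simp
  let ?S = "lin_span (dilates (indicator K))"
  define t where "t = (\<lambda>(j::int) x. indicator K (2 powi (- j) * x) * h x)"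
  have tL2: "L2_fun (t j)" for j
  proof -
    have "(\<lambda>x. indicator K (0 + 2 powi (- j) * x) :: complex) \<in> borel_measurable lebesgue"
      by (rule borel_measurable_lebesgue_affine) (use Km in auto)
    with h have "t j \<in> borel_measurable lebesgue" by (auto simp: t_def dest: L2_fun_measurable)
    thus ?thesis by (rule L2_fun_dominated[OF h, of _ 1]) (auto simp: t_def norm_mult split: split_indicator)
  qed
  have approx: "\<exists>q\<in>?S. L2_sq (\<lambda>x. (\<Sum>j\<in>A. t j x) - q x) < d" if "finite A" "d > 0" for A d
    using that
  proof (induction A arbitrary: d rule: finite_induct)
    case empty
    thus ?case using lin_span_0 by (auto intro!: bexI[of _ "\<lambda>x. 0"] simp: L2_sq_def)
  next
    case (insert j A)
    obtain q1 where q1: "q1 \<in> ?S" "L2_sq (\<lambda>x. (\<Sum>j\<in>A. t j x) - q1 x) < d / 4"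
      using insert.IH[of "d / 4"] insert.prems by auto
    obtain q2 where q2: "q2 \<in> ?S" "L2_sq (\<lambda>x. t j x - q2 x) < d / 4"
      using dyadic_piece_approx[OF tile h, of "d / 4" j] insert.prems unfolding t_def by auto
    have L: "L2_fun q" if "q \<in> ?S" for q
      using that dilates_L2 unfolding lin_span_def
      by (auto intro!: L2_fun_sum L2_fun_cmult)
    have sL: "L2_fun (\<lambda>x. \<Sum>j\<in>A. t j x)" by (intro L2_fun_sum tL2)
    \<comment> \<open>The triangle inequality is applied through the zero function, so that it
      bounds a sum of two errors.\<close>
    have "L2_sq (\<lambda>x. (\<lambda>x. t j x - q2 x) x - (\<lambda>x. q1 x - (\<Sum>j\<in>A. t j x)) x) \<le>
        2 * L2_sq (\<lambda>x. (\<lambda>x. t j x - q2 x) x - (\<lambda>x. 0) x) + 2 * L2_sq (\<lambda>x. (\<lambda>x. 0) x - (\<lambda>x. q1 x - (\<Sum>j\<in>A. t j x)) x)"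
      by (rule L2_sq_triangle) (intro L2_fun_diff tL2 L q1 q2 sL L2_fun_0)+
    also have "\<dots> < d" using q1(2) q2(2) by simp
    finally have "L2_sq (\<lambda>x. (\<Sum>j\<in>insert j A. t j x) - (q2 x + q1 x)) < d"
      using insert.hyps by (simp add: algebra_simps)
    thus ?case by (intro bexI[of _ "\<lambda>x. q2 x + q1 x"] lin_span_add q1(1) q2(1))
  qed
  define s where "s = (\<lambda>n::nat. \<lambda>x. \<Sum>j\<in>{-int n..int n}. t j x)"
  have sL2: "L2_fun (s n)" for n unfolding s_def by (intro L2_fun_sum tL2)
  \<comment> \<open>Only one piece is nonzero at \<open>x\<close>, so a partial sum is either
    \<open>h x\<close> or 0 there. This gives both the pointwise limit and the domination by
    \<open>h\<close>.\<close>
  have one: "\<exists>i. \<forall>n. s n x = (if i \<in> {-int n..int n} then h x else 0)"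
    if "\<exists>!j::int. 2 powi j * x \<in> K" for x
  proof -
    from that obtain l where l: "2 powi l * x \<in> K" "\<And>j. 2 powi j * x \<in> K \<Longrightarrow> j = l" by blast
    have "t j x = (if j = - l then h x else 0)" for j
    proof (cases "j = - l")
      case True
      thus ?thesis using l(1) by (simp add: t_def)
    next
      case False
      have "2 powi (- j) * x \<notin> K"
      proof
        assume "2 powi (- j) * x \<in> K"
        from l(2)[OF this] False show False by simp
      qed
      thus ?thesis using False by (simp add: t_def)
    qed
    thus ?thesis by (intro exI[of _ "- l"]) (simp add: s_def)
  qed
  have "(\<lambda>n. L2_sq (\<lambda>x. h x - s n x)) \<longlonglongrightarrow> 0"
  proof (rule L2_dominated_convergence[OF _ _ h])
    show "AE x in lebesgue. (\<lambda>n. s n x) \<longlonglongrightarrow> h x"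
      using dy[unfolded dyadic_tile_def]
    proof eventually_elim
      case (elim x)
      from one[OF elim] obtain i where i: "\<And>n. s n x = (if i \<in> {-int n..int n} then h x else 0)" by blast
      have "\<forall>\<^sub>F n in sequentially. s n x = h x"
        unfolding eventually_sequentially
        by (intro exI[of _ "nat \<bar>i\<bar>"] allI impI) (auto simp: i)
      thus ?case by (rule tendsto_eventually)
    qed
    show "AE x in lebesgue. cmod (s n x) \<le> cmod (h x)" for n
      using dy[unfolded dyadic_tile_def]
    proof eventually_elim
      case (elim x)
      from one[OF elim] obtain i where "\<And>n. s n x = (if i \<in> {-int n..int n} then h x else 0)" by blast
      thus ?case by simp
    qed
  qed (use sL2 h in auto)
  hence "\<forall>\<^sub>F n in sequentially. L2_sq (\<lambda>x. h x - s n x) < r / 4"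
    using r by (intro order_tendstoD(2)) auto
  then obtain n where n: "L2_sq (\<lambda>x. h x - s n x) < r / 4"
    by (auto simp: eventually_sequentially)
  obtain q where q: "q \<in> ?S" "L2_sq (\<lambda>x. s n x - q x) < r / 4"
    using approx[of "{-int n..int n}" "r / 4"] r unfolding s_def by auto
  have "L2_fun q"
    using q(1) dilates_L2 unfolding lin_span_def by (auto intro!: L2_fun_sum L2_fun_cmult)
  hence "L2_sq (\<lambda>x. h x - q x) \<le> 2 * L2_sq (\<lambda>x. h x - s n x) + 2 * L2_sq (\<lambda>x. s n x - q x)"
    by (intro L2_sq_triangle h sL2)
  also have "\<dots> < r" using n q(2) by linarith
  finally show "\<exists>q\<in>?S. L2_sq (\<lambda>x. h x - q x) < r" using q(1) by blast
qed

text \<open>Different scales have supports that are disjoint up to null sets, by the dyadic tiling.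
  Equal scales reduce by substitution to the integrals of exponentials over \<open>K\<close>, that
  is, to the translation tiling.\<close>

lemma tile_orthonormal:
  assumes tile: "translation_tile K" and dy: "dyadic_tile K"
  shows "L2_orthonormal (dilates (indicator K))"
  unfolding L2_orthonormal_def
proof (intro allI)
  fix i i' :: "int \<times> int"
  obtain j k where i: "i = (j, k)" by (cases i)
  obtain j' k' where i': "i' = (j', k')" by (cases i')
  let ?G = "dilates (indicator K)"
  show "L2_inner (?G i) (?G i') = (if i = i' then 1 else 0)"
  proof (cases "j = j'")
    case False
    have "L2_inner (?G i) (?G i') = (LINT x::real|lebesgue. (0::complex))"
      unfolding L2_inner_def
    proof (rule integral_cong_AE)
      show "AE x in lebesgue. ?G i x * cnj (?G i' x) = 0"
        using dy[unfolded dyadic_tile_def]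
      proof eventually_elim
        case (elim x)
        then obtain l where l: "\<And>i. 2 powi i * x \<in> K \<Longrightarrow> i = l" by blast
        have "\<not> (2 powi (- j) * x \<in> K \<and> 2 powi (- j') * x \<in> K)"
          using False l[of "- j"] l[of "- j'"] by auto
        thus ?case by (auto simp: i i' dilates_def split: split_indicator)
      qed
      show "(\<lambda>x. ?G i x * cnj (?G i' x)) \<in> borel_measurable lebesgue"
        by (rule borel_measurable_integrable, rule L2_prod_integrable) (simp_all add: dilates_L2)
    qed simp
    thus ?thesis using False by (simp add: i i')
  next
    case True
    have "L2_inner (?G i) (?G i') = \<bar>2 powi j\<bar> *\<^sub>R (LINT x|lebesgue. ?G i (0 + 2 powi j * x) * cnj (?G i' (0 + 2 powi j * x)))"
      unfolding L2_inner_def by (rule lebesgue_integral_real_affine) simp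
    also have "(\<lambda>x. ?G i (0 + 2 powi j * x) * cnj (?G i' (0 + 2 powi j * x))) =
        (\<lambda>x. of_real (2 powi (- j)) * (indicator K x * cis (2 * pi * of_int (k' - k) * x)))"
    proof
      fix x
      have 1: "complex_of_real (2 powr (- of_int j / 2)) * of_real (2 powr (- of_int j / 2)) = of_real (2 powi (- j))"
        using powr_half_sq[of j] by (simp only: of_real_mult[symmetric] power2_eq_square)
      have 2: "cis (- (2 * pi * of_int k * x)) * cis (2 * pi * of_int k' * x) = cis (2 * pi * of_int (k' - k) * x)"
        by (simp add: cis_mult algebra_simps)
      show "?G i (0 + 2 powi j * x) * cnj (?G i' (0 + 2 powi j * x)) =
        of_real (2 powi (- j)) * (indicator K x * cis (2 * pi * of_int (k' - k) * x))"
        unfolding 1[symmetric] 2[symmetric]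
        by (simp add: i i' True[symmetric] dilates_def powi_minus_mult cis_cnj split: split_indicator)
    qed
    also have "\<bar>2 powi j\<bar> *\<^sub>R (LINT x|lebesgue. of_real (2 powi (- j)) * (indicator K x * cis (2 * pi * of_int (k' - k) * x))) =
        (LINT x|lebesgue. indicator K x * cis (2 * pi * of_int (k' - k) * x))"
      by (simp add: scaleR_conv_of_real power_int_minus)
    also have "\<dots> = (if k' - k = 0 then 1 else 0)" by (rule integral_cis_tile[OF tile])
    finally show ?thesis by (simp add: i i' True)
  qed
qed

section \<open>From orthonormal bases to tilings\<close>

context
  fixes g :: "real \<Rightarrow> complex"
  assumes gm: "g \<in> borel_measurable lebesgue" and gK: "\<And>x. cmod (g x) = indicator K x"
    and on: "L2_orthonormal (dilates g)"
begin

lemma g_eq_0_iff: "g x = 0 \<longleftrightarrow> x \<notin> K"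
proof (cases "x \<in> K")
  case True
  hence "cmod (g x) \<noteq> 0" using gK[of x] by simp
  thus ?thesis using True by (simp only: norm_eq_zero) simp
next
  case False
  hence "cmod (g x) = 0" using gK[of x] by simp
  thus ?thesis using False by (simp only: norm_eq_zero) simp
qed

text \<open>The phase of \<open>g\<close> is unknown; conclusions about \<open>K\<close> come from
  this product and from the zeros of \<open>g\<close>.\<close>

lemma g_mult_cnj: "g x * cnj (g x) = indicator K x"
proof -
  have "g x * cnj (g x) = of_real ((cmod (g x))\<^sup>2)" by (rule complex_norm_square[symmetric])
  also have "\<dots> = indicator K x" unfolding gK by (simp split: split_indicator)
  finally show ?thesis .
qed

text \<open>Orthonormality within scale 0 says that the indicators of \<open>K\<close> and of the
  unit interval have equal Fourier integrals at the integers. Hence their periodizations agree: the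
  number of integer translates of a point that lie in \<open>K\<close> is 1.\<close>

lemma orthonormal_imp_translation_tile: "translation_tile K"
proof -
  \<comment> \<open>The bound must cover the unit interval as well as \<open>K\<close>.\<close>
  define N where "N = max M 1"
  have out: "x \<notin> K" "x \<notin> {0..<1}" if "\<bar>x\<bar> > of_int N" for x
    using that in_K_bound[of x] by (auto simp: N_def)
  define u where "u = (\<lambda>x. indicator K x - indicator {0..<1} x :: complex)"
  have ind: "L2_compact (indicator {0..<1::real})"
    by (rule L2_compact_bounded[of _ 1 1]) (auto split: split_indicator)
  have u: "L2_compact u" unfolding u_def by (rule L2_compact_diff[OF indicator_K_L2 ind])
  have zero: "(LINT x|lebesgue. u x * cis (2 * pi * of_int k * x)) = 0" for k
  proof -
    have "L2_inner (dilates g (0, 0)) (dilates g (0, k)) = (if k = 0 then 1 else 0)"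
      using on unfolding L2_orthonormal_def by auto
    moreover have "L2_inner (dilates g (0, 0)) (dilates g (0, k)) =
        (LINT x|lebesgue. indicator K x * cis (2 * pi * of_int k * x))"
      unfolding L2_inner_def g_mult_cnj[symmetric]
      by (intro Bochner_Integration.integral_cong refl) (simp add: dilates_def cis_cnj mult_ac)
    moreover have "(LINT x|lebesgue. indicator {0..<1} x * cis (2 * pi * of_int k * x)) = (if k = 0 then 1 else 0)"
      using integral_cis_unit[of k] by (simp add: scaleR_conv_of_real of_real_indicator)
    ultimately show ?thesis
      unfolding u_def left_diff_distrib
      using integrable_mult_cis[OF indicator_K_L2, of "2 * pi * of_int k"] integrable_mult_cis[OF ind, of "2 * pi * of_int k"]
      by (subst Bochner_Integration.integral_diff) auto
  qed
  have "AE x in lebesgue. x \<in> {0..<1} \<longrightarrow> (\<Sum>m\<in>{-N..N}. u (of_int m + x)) = 0"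
    by (rule periodization_eq_0[OF u _ zero]) (use out in \<open>simp add: u_def\<close>)
  hence "AE x in lebesgue. x \<in> {0..<1} \<longrightarrow> (\<exists>!m::int. of_int m + x \<in> K)"
  proof eventually_elim
    case (elim x)
    show ?case
    proof
      assume x: "x \<in> {0..<1}"
      have N1: "N \<ge> 1" by (simp add: N_def)
      have "(\<Sum>m\<in>{-N..N}. indicator {0..<1} (of_int m + x) :: complex) = indicator {0..<1} (of_int 0 + x)"
      proof (rule sum_eq_single)
        fix m :: int assume "m \<noteq> 0"
        hence "m \<ge> 1 \<or> m \<le> -1" by auto
        hence "real_of_int m \<ge> 1 \<or> real_of_int m \<le> -1" by linarith
        thus "indicator {0..<1} (of_int m + x) = (0::complex)" using x by (auto split: split_indicator)
      qed (use N1 in auto)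
      hence "(\<Sum>m\<in>{-N..N}. indicator K (of_int m + x) :: complex) = 1"
        using elim x by (simp add: u_def sum_subtractf)
      moreover have "(\<Sum>m\<in>{-N..N}. indicator K (of_int m + x) :: complex) = of_nat (card {m\<in>{-N..N}. of_int m + x \<in> K})"
        by (simp add: indicator_def sum.If_cases Int_def)
      ultimately have "card {m\<in>{-N..N}. of_int m + x \<in> K} = 1" by (metis of_nat_eq_1_iff)
      moreover have "{m\<in>{-N..N}. of_int m + x \<in> K} = {m. of_int m + x \<in> K}"
        using shift_in_K_bound[OF _ x] by (force simp: N_def)
      ultimately obtain m where "{m. of_int m + x \<in> K} = {m}" by (auto simp: card_1_singleton_iff)
      thus "\<exists>!m::int. of_int m + x \<in> K" by (auto simp: set_eq_iff)
    qed
  qed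
  thus ?thesis unfolding translation_tile_def
  proof (rule AE_of_unit_interval)
    fix x :: real and k :: int
    assume "\<exists>!m::int. of_int m + x \<in> K"
    then obtain m where m: "of_int m + x \<in> K" "\<And>n. of_int n + x \<in> K \<Longrightarrow> n = m" by auto
    show "\<exists>!m::int. of_int m + (x + of_int k) \<in> K"
    proof (rule ex1I[of _ "m - k"])
      show "of_int (m - k) + (x + of_int k) \<in> K" using m(1) by simp
      fix n assume "of_int n + (x + of_int k) \<in> K"
      thus "n = m - k" using m(2)[of "n + k"] by (simp add: algebra_simps)
    qed
  qed
qed

lemma gL2: "L2_compact g"
  by (rule L2_compact_bounded[OF gm, of 1 "of_int M"])
    (auto simp: gK g_eq_0_iff not_in_K split: split_indicator)

text \<open>Orthogonality of \<open>g\<close> times all exponentials to the dilate of \<open>g\<close> says that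
  all Fourier coefficients of the periodization of \<open>u\<close> vanish.\<close>

lemma orthonormal_imp_dyadic_disjoint:
  assumes "j \<noteq> 0"
  shows "AE x in lebesgue. \<not> (x \<in> K \<and> 2 powi (- j) * x \<in> K)"
proof -
  define u where "u = (\<lambda>x. g x * cnj (g (2 powi (- j) * x)))"
  have g2: "L2_compact (dilates g (j, 0))" by (rule L2_compact_dilates[OF gL2])
  have gj: "g (2 powi (- j) * x) = of_real (2 powr (of_int j / 2)) * dilates g (j, 0) x" for x
  proof -
    have "complex_of_real (2 powr (of_int j / 2)) * of_real (2 powr (- of_int j / 2)) = 1"
      by (simp only: of_real_mult[symmetric] powr_add[symmetric]) simp
    thus ?thesis by (simp add: dilates_def mult.assoc[symmetric])
  qed
  have um: "u \<in> borel_measurable lebesgue"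
    unfolding u_def gj
    by (rule borel_measurable_integrable, rule L2_prod_integrable) (intro L2_fun_cmult L2_compact_L2[OF gL2] L2_compact_L2[OF g2])+
  have u: "L2_compact u"
    by (rule L2_compact_bounded[OF um, of 1 "of_int M"])
      (auto simp: u_def norm_mult gK g_eq_0_iff not_in_K split: split_indicator)
  have zero: "(LINT x|lebesgue. u x * cis (2 * pi * of_int k * x)) = 0" for k
  proof -
    have "(LINT x|lebesgue. u x * cis (2 * pi * of_int k * x)) =
        (LINT x|lebesgue. of_real (2 powr (of_int j / 2)) * (dilates g (0, - k) x * cnj (dilates g (j, 0) x)))"
      unfolding u_def gj
      by (intro Bochner_Integration.integral_cong refl) (simp add: dilates_def[of g] mult_ac)
    also have "\<dots> = of_real (2 powr (of_int j / 2)) * L2_inner (dilates g (0, - k)) (dilates g (j, 0))"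
      unfolding L2_inner_def by (rule Bochner_Integration.integral_mult_right_zero)
    also have "L2_inner (dilates g (0, - k)) (dilates g (j, 0)) = 0"
      using on assms unfolding L2_orthonormal_def by auto
    finally show ?thesis by simp
  qed
  have "AE x in lebesgue. x \<in> {0..<1} \<longrightarrow> (\<Sum>m\<in>{-M..M}. u (of_int m + x)) = 0"
    by (rule periodization_eq_0[OF u _ zero]) (simp add: u_def g_eq_0_iff not_in_K)
  \<comment> \<open>By the translation tiling at most one term of the sum is nonzero, so no
    cancellation between terms is possible and each term vanishes.\<close>
  hence "AE x in lebesgue. x \<in> {0..<1} \<longrightarrow> (\<forall>m::int. u (of_int m + x) = 0)"
    using orthonormal_imp_translation_tile[unfolded translation_tile_def]
  proof eventually_elim
    case (elim x)
    show ?case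
    proof
      assume x: "x \<in> {0..<1}"
      from elim(2) obtain n where n: "of_int n + x \<in> K" "\<And>m. of_int m + x \<in> K \<Longrightarrow> m = n" by auto
      have other: "u (of_int m + x) = 0" if "m \<noteq> n" for m
        using n(2)[of m] that by (auto simp: u_def g_eq_0_iff)
      have "(\<Sum>m\<in>{-M..M}. u (of_int m + x)) = u (of_int n + x)"
        by (rule sum_eq_single) (use other shift_in_K_bound[OF n(1) x] in auto)
      thus "\<forall>m::int. u (of_int m + x) = 0" using elim(1) x other by metis
    qed
  qed
  hence "AE x in lebesgue. \<forall>m::int. u (of_int m + x) = 0"
  proof (rule AE_of_unit_interval)
    fix x :: real and k :: int
    assume *: "\<forall>m::int. u (of_int m + x) = 0"
    show "\<forall>m::int. u (of_int m + (x + of_int k)) = 0"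
      using *[rule_format, of "_ + k"] by (simp add: algebra_simps)
  qed
  thus ?thesis
  proof eventually_elim
    case (elim x)
    from elim[rule_format, of 0] show ?case by (auto simp: u_def g_eq_0_iff)
  qed
qed

text \<open>The indicator of the uncovered set is orthogonal to all dilates, so it has norm 0 by
  totality. The restriction to \<open>\<bar>x\<bar> \<le> real R\<close> gives it compact
  support.\<close>

lemma basis_imp_dyadic_cover:
  assumes total: "L2_total (dilates g)"
  shows "AE x in lebesgue. \<exists>j::int. 2 powi j * x \<in> K"
proof -
  have "AE x in lebesgue. \<bar>x\<bar> \<le> real R \<longrightarrow> (\<exists>j::int. 2 powi j * x \<in> K)" for R :: nat
  proof -
    define E where "E = {x. \<bar>x\<bar> \<le> real R \<and> (\<forall>j::int. 2 powi j * x \<notin> K)}"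
    have Em: "E \<in> sets lebesgue"
    proof -
      have pre: "{x. 2 powi j * x \<in> K} \<in> sets lebesgue" for j :: int
      proof -
        have "(\<lambda>x. 0 + 2 powi j * x) \<in> lebesgue \<rightarrow>\<^sub>M (lebesgue :: real measure)"
          using lebesgue_affine_measurable[where c= "\<lambda>x::real. 2 powi j" and t=0] by simp
        from measurable_sets[OF this Km] show ?thesis by (simp add: vimage_def)
      qed
      have "E = {-real R..real R} - (\<Union>j::int. {x. 2 powi j * x \<in> K})" by (auto simp: E_def abs_le_iff)
      also have "\<dots> \<in> sets lebesgue" by (intro sets.Diff sets.countable_UN) (use pre in auto)
      finally show ?thesis .
    qed
    define h where "h = (indicator E :: real \<Rightarrow> complex)"
    have h: "L2_compact h" unfolding h_def
      by (rule L2_compact_bounded[of _ 1 "real R"]) (use Em in \<open>auto simp: E_def split: split_indicator\<close>)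
    have "L2_sq h \<le> r" if r: "r > 0" for r
    proof -
      obtain F c where F: "finite F" "L2_sq (\<lambda>x. h x - (\<Sum>i\<in>F. c i * dilates g i x)) < r"
      proof -
        obtain q where q: "q \<in> lin_span (dilates g)" "L2_sq (\<lambda>x. h x - q x) < r"
          using total h r unfolding L2_total_def by blast
        from q(1) show ?thesis by (rule lin_span_memE) (use q(2) that in simp)
      qed
      let ?s = "\<lambda>x. \<Sum>i\<in>F. c i * dilates g i x"
      have s: "L2_fun ?s"
        by (intro L2_fun_sum L2_fun_cmult L2_compact_L2 L2_compact_dilates gL2)
      have "L2_inner h ?s = 0"
      proof (rule L2_inner_eq_0_disjoint)
        fix x
        have "dilates g i x = 0" if "x \<in> E" for i
          using that by (cases i) (auto simp: dilates_def E_def g_eq_0_iff)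
        thus "h x = 0 \<or> ?s x = 0" by (simp add: h_def indicator_def)
      qed
      hence "L2_sq (\<lambda>x. h x - ?s x) = L2_sq h + L2_sq ?s"
        using L2_sq_diff[OF L2_compact_L2[OF h] s] by simp
      thus ?thesis using F(2) L2_sq_nonneg[of ?s] by linarith
    qed
    hence "L2_sq h = 0" using L2_sq_nonneg[of h] by (meson dense_ge order_antisym)
    hence "AE x in lebesgue. h x = 0" using L2_sq_eq_0_iff h by simp
    thus ?thesis by eventually_elim (auto simp: h_def E_def split: split_indicator_asm)
  qed
  hence "AE x in lebesgue. \<forall>R::nat. \<bar>x\<bar> \<le> real R \<longrightarrow> (\<exists>j::int. 2 powi j * x \<in> K)"
    unfolding AE_all_countable by blast
  thus ?thesis by eventually_elim (use real_arch_simple in blast)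
qed

lemma basis_imp_dyadic_tile:
  assumes "L2_total (dilates g)"
  shows "dyadic_tile K"
proof -
  have "AE x in lebesgue. j \<noteq> 0 \<longrightarrow> \<not> (x \<in> K \<and> 2 powi (- j) * x \<in> K)" for j
    using orthonormal_imp_dyadic_disjoint[of j] by (cases "j = 0") auto
  hence "AE x in lebesgue. \<forall>j. j \<noteq> 0 \<longrightarrow> \<not> (x \<in> K \<and> 2 powi (- j) * x \<in> K)"
    by (simp add: AE_all_countable)
  from AE_all_dyadic[OF this]
  have "AE x in lebesgue. \<forall>l::int. \<forall>j. j \<noteq> 0 \<longrightarrow> \<not> (2 powi l * x \<in> K \<and> 2 powi (- j) * (2 powi l * x) \<in> K)" .
  from this basis_imp_dyadic_cover[OF assms] show ?thesis
    unfolding dyadic_tile_def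
  proof eventually_elim
    case (elim x)
    obtain l where l: "2 powi l * x \<in> K" using elim(2) by blast
    show ?case
    proof (rule ex1I[of _ l])
      fix j :: int assume j: "2 powi j * x \<in> K"
      have "2 powi (- (l - j)) * (2 powi l * x) = 2 powi j * x"
        by (simp add: power_int_diff)
      moreover have "\<not> (2 powi l * x \<in> K \<and> 2 powi (- (l - j)) * (2 powi l * x) \<in> K)" if "l - j \<noteq> 0"
        using elim(1) that by blast
      ultimately show "j = l" using l j by (metis right_minus_eq)
    qed (rule l)
  qed
qed

end

lemma wavelet_set_iff_tile_cell: "wavelet_set K \<longleftrightarrow> translation_tile K \<and> dyadic_tile K"
proof
  assume "wavelet_set K"
  then obtain \<psi> g0 where \<psi>: "orthonormal_wavelet \<psi>" "has_L2_fourier_transform \<psi> g0"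
    "AE \<xi> in lebesgue. cmod (g0 \<xi>) = indicator K \<xi>" unfolding wavelet_set_def by blast
  have [measurable]: "g0 \<in> borel_measurable lebesgue"
    using \<psi>(2) unfolding has_L2_fourier_transform_def by (auto dest: L2_fun_measurable)
  note Km [measurable]
  \<comment> \<open>A change on a null set makes the modulus equal to the indicator at every point;
    in particular \<open>g\<close> then has bounded support.\<close>
  define g where "g = (\<lambda>x. if cmod (g0 x) = indicator K x then g0 x else indicator K x)"
  have gm: "g \<in> borel_measurable lebesgue" unfolding g_def by measurable
  have gK: "cmod (g x) = indicator K x" for x by (auto simp: g_def split: split_indicator)
  have eq: "AE x in lebesgue. g0 x = g x"
    using \<psi>(3) by eventually_elim (simp add: g_def)
  have g0: "g x = 0" if "x \<notin> K" for x using gK[of x] that by simp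
  have gL2: "L2_compact g"
    by (rule L2_compact_bounded[OF gm, of 1 "of_int M"])
      (auto simp: gK g0 not_in_K split: split_indicator)
  have "L2_sqdist f g0 = L2_sqdist f g" for f
    unfolding L2_sqdist_def by (rule nn_integral_cong_AE) (use eq in eventually_elim, simp)
  hence "has_L2_fourier_transform \<psi> g"
    using \<psi>(2) gL2 unfolding has_L2_fourier_transform_def by simp
  moreover have \<psi>L2: "L2_fun \<psi>" using \<psi>(1) by (simp add: orthonormal_wavelet_def)
  ultimately have ae: "AE x in lebesgue. \<psi> x = inv_fourier g x"
    by (simp add: has_L2_fourier_transform_compact_iff gL2)
  have "L2_orthonormal_basis (wavelet_system \<psi>)" using \<psi>(1) by (simp add: orthonormal_wavelet_def)
  hence "L2_orthonormal (dilates g)" "L2_total (dilates g)"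
    unfolding wavelet_basis_iff[OF \<psi>L2 gL2 ae] by blast+
  thus "translation_tile K \<and> dyadic_tile K"
    using orthonormal_imp_translation_tile[OF gm gK] basis_imp_dyadic_tile[OF gm gK] by blast
next
  assume tiles: "translation_tile K \<and> dyadic_tile K"
  \<comment> \<open>Any phase would do; the constant phase 1 is chosen.\<close>
  let ?g = "indicator K :: real \<Rightarrow> complex"
  define \<psi> where "\<psi> = inv_fourier ?g"
  note g = indicator_K_L2
  have \<psi>: "L2_fun \<psi>" unfolding \<psi>_def by (rule inv_fourier_L2[OF g])
  have ae: "AE x in lebesgue. \<psi> x = inv_fourier ?g x" by (simp add: \<psi>_def)
  have "L2_orthonormal_basis (wavelet_system \<psi>)"
    unfolding wavelet_basis_iff[OF \<psi> g ae]
    using tiles tile_orthonormal tile_total by blast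
  moreover have "has_L2_fourier_transform \<psi> ?g"
    unfolding has_L2_fourier_transform_compact_iff[OF \<psi> g] by (simp add: \<psi>_def)
  moreover have "cmod (?g x) = indicator K x" for x by (simp split: split_indicator)
  ultimately show "wavelet_set K"
    unfolding wavelet_set_def orthonormal_wavelet_def using Km \<psi> by auto
qed

end

theorem wavelet_set_iff_tile:
  assumes "K \<in> sets lebesgue" "bounded K"
  shows "wavelet_set K \<longleftrightarrow> translation_tile K \<and> dyadic_tile K"
proof -
  obtain B where B: "\<And>x. x \<in> K \<Longrightarrow> \<bar>x\<bar> \<le> B" using assms(2) by (auto simp: bounded_iff)
  have "K \<subseteq> {- of_int \<lceil>B\<rceil>..of_int \<lceil>B\<rceil>}"
  proof
    fix x assume "x \<in> K"
    hence "\<bar>x\<bar> \<le> of_int \<lceil>B\<rceil>" using B[of x] by linarith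
    thus "x \<in> {- of_int \<lceil>B\<rceil>..of_int \<lceil>B\<rceil>}" by auto
  qed
  thus ?thesis by (rule wavelet_set_iff_tile_cell[OF assms(1)])
qed

subsection \<open>From data to wavelet sets\<close>

lemma strict_chain_less:
  fixes f :: "nat \<Rightarrow> real"
  assumes "\<And>k. k \<in> {1..n} \<Longrightarrow> f (k - 1) < f k" "i < j" "j \<le> n"
  shows "f i < f j"
  using assms(2,3)
proof (induction j)
  case (Suc j)
  have "f j < f (Suc j)" using assms(1)[of "Suc j"] Suc.prems by simp
  thus ?case using Suc by (cases "i = j") auto
qed simp

lemma strict_chain_le:
  fixes f :: "nat \<Rightarrow> real"
  assumes "\<And>k. k \<in> {1..n} \<Longrightarrow> f (k - 1) < f k" "i \<le> j" "j \<le> n"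
  shows "f i \<le> f j"
  using strict_chain_less[of n f i j, OF assms(1)] assms(2,3) by (cases "i = j") auto

lemma strict_chain_inj:
  fixes f :: "nat \<Rightarrow> real"
  assumes "\<And>k. k \<in> {1..n} \<Longrightarrow> f (k - 1) < f k" "f i = f j" "i \<le> n" "j \<le> n"
  shows "i = j"
  using strict_chain_less[of n f i j, OF assms(1)] strict_chain_less[of n f j i, OF assms(1)] assms(2-4)
  by (cases i j rule: linorder_cases) auto

lemma chain_cell:
  fixes f :: "nat \<Rightarrow> real"
  assumes "f 0 < y" "y \<le> f n"
  obtains j where "j \<in> {1..n}" "f (j - 1) < y" "y \<le> f j"
proof -
  define j where "j = (LEAST j. y \<le> f j)"
  have j: "y \<le> f j" unfolding j_def by (rule LeastI[of _ n]) (rule assms(2))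
  have "j \<le> n" unfolding j_def by (rule Least_le) (rule assms(2))
  moreover have j0: "j \<noteq> 0"
  proof
    assume "j = 0"
    with j have "y \<le> f 0" by metis
    thus False using assms(1) by simp
  qed
  moreover have "\<not> y \<le> f (j - 1)"
  proof
    assume "y \<le> f (j - 1)"
    hence "j \<le> j - 1" unfolding j_def by (rule Least_le)
    thus False using j0 by linarith
  qed
  ultimately show ?thesis using that[of j] j by auto
qed

lemma cell_unique:
  fixes f :: "nat \<Rightarrow> real"
  assumes f: "\<And>k. k \<in> {1..n} \<Longrightarrow> f (k - 1) < f k" and "i \<in> {1..n}" "j \<in> {1..n}"
    and "f (i - 1) < y" "y < f i" "f (j - 1) \<le> y" "y \<le> f j"
  shows "i = j"
proof (rule ccontr)
  assume "i \<noteq> j"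
  then consider "i \<le> j - 1" | "j \<le> i - 1" by linarith
  thus False
  proof cases
    case 1
    hence "f i \<le> f (j - 1)" using strict_chain_le[of n f i "j - 1", OF f] assms(3) by auto
    thus False using assms by linarith
  next
    case 2
    hence "f j \<le> f (i - 1)" using strict_chain_le[of n f j "i - 1", OF f] assms(2) by auto
    thus False using assms by linarith
  qed
qed

text \<open>\<open>[0, 1/2]\<close> is a fundamental domain of the group generated by integer
  translations and the reflection. As \<open>y\<close> is strictly inside,
  \<open>k = s y - e z\<close> has modulus below 1; at 0 or 1/2 the sign and the integer would not
  be determined.\<close>

lemma fold_unique:
  fixes y z :: real and s e k :: int
  assumes y: "0 < y" "y < 1 / 2" and z: "0 \<le> z" "z \<le> 1 / 2"
    and s: "s \<in> {-1, 1}" and e: "e \<in> {-1, 1}"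
    and eq: "of_int s * y = of_int e * z + of_int k"
  shows "z = y \<and> s = e \<and> k = 0"
proof -
  have k: "real_of_int k = of_int s * y - of_int e * z" using eq by simp
  have "-1 < real_of_int k" "real_of_int k < 1" unfolding k using s e y z by auto
  hence "k = 0" by linarith
  with eq have "of_int s * y = of_int e * z" by simp
  with s e y z \<open>k = 0\<close> show ?thesis by auto
qed

lemma fold_exists:
  fixes x :: real
  obtains s q :: int and y where "s \<in> {-1, 1}" "x = of_int s * y + of_int q" "0 \<le> y" "y \<le> 1 / 2"
proof (cases "x - of_int \<lfloor>x\<rfloor> \<le> 1 / 2")
  case True
  thus ?thesis using that[of 1 "x - of_int \<lfloor>x\<rfloor>" "\<lfloor>x\<rfloor>"] by auto
next
  case False
  hence "of_int \<lfloor>x\<rfloor> + 1 - x \<le> 1 / 2" "0 \<le> of_int \<lfloor>x\<rfloor> + 1 - x" by linarith+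
  thus ?thesis using that[of "-1" "of_int \<lfloor>x\<rfloor> + 1 - x" "\<lfloor>x\<rfloor> + 1"] by simp
qed

lemma powi_le_iff: "(2::real) powi i \<le> 2 powi j \<longleftrightarrow> i \<le> j"
  using power_int_increasing[of i j "2::real"] power_int_strict_increasing[of j i "2::real"] by force

lemma dyadic_exists:
  fixes x b :: real
  assumes "x > 0" "b > 0"
  obtains i :: int where "b / 2 \<le> 2 powi i * x" "2 powi i * x < b"
proof -
  define f where "f = \<lfloor>log 2 (x / b)\<rfloor>"
  have y: "x / b > 0" using assms by simp
  have "2 powr (of_int f) \<le> 2 powr (log 2 (x / b))"
    by (rule powr_mono) (auto simp: f_def)
  hence 1: "2 powi f \<le> x / b" using y by (simp add: powr_real_of_int')
  have "2 powr (log 2 (x / b)) < 2 powr (of_int (f + 1))"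
    by (rule powr_less_mono) (simp_all add: f_def)
  hence 2: "x / b < 2 powi (f + 1)" using y by (simp add: powr_real_of_int' del: of_int_add)
  have 3: "2 powi (- (f + 1)) * (2 powi (f + 1) * b) = b" by (rule powi_minus_mult)
  show ?thesis
  proof (rule that[of "- (f + 1)"])
    have "x < 2 powi (f + 1) * b" using 2 assms by (simp add: pos_divide_less_eq)
    hence "2 powi (- (f + 1)) * x < 2 powi (- (f + 1)) * (2 powi (f + 1) * b)"
      by (intro mult_strict_left_mono) auto
    thus "2 powi (- (f + 1)) * x < b" unfolding 3 .
    have "2 powi (f + 1) = 2 * (2::real) powi f" by (simp add: power_int_add)
    hence "2 powi (f + 1) * (b / 2) \<le> x" using 1 assms by (simp add: pos_le_divide_eq)
    hence "2 powi (- (f + 1)) * (2 powi (f + 1) * (b / 2)) \<le> 2 powi (- (f + 1)) * x"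
      by (intro mult_left_mono) auto
    thus "b / 2 \<le> 2 powi (- (f + 1)) * x" unfolding powi_minus_mult .
  qed
qed

text \<open>The analogue of \<open>fold_unique\<close> for dilations: \<open>[b/2, b]\<close> is a
  fundamental domain of multiplication by powers of 2 on the positive half-line, and
  \<open>x\<close> is interior to it.\<close>

lemma dyadic_unique:
  fixes x y b :: real
  assumes "b / 2 < x" "x < b" "b / 2 \<le> 2 powi i * x" "2 powi i * x \<le> b"
  shows "i = 0"
proof (rule ccontr)
  assume "i \<noteq> 0"
  have x: "x > 0" "b > 0" using assms(1,2) by auto
  consider "i \<ge> 1" | "i \<le> -1" using \<open>i \<noteq> 0\<close> by linarith
  thus False
  proof cases
    case 1
    hence "(2::real) powi 1 \<le> 2 powi i" unfolding powi_le_iff .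
    hence "2 * x \<le> 2 powi i * x" using x by (intro mult_right_mono) auto
    thus False using assms by linarith
  next
    case 2
    hence "(2::real) powi i \<le> 2 powi (- 1)" unfolding powi_le_iff .
    hence "2 powi i * x \<le> 1 / 2 * x" using x by (intro mult_right_mono) (auto simp: power_int_minus)
    thus False using assms by linarith
  qed
qed

lemma data_interval_mem:
  "x \<in> data_interval \<epsilon> a m j \<longleftrightarrow> (\<exists>z\<in>{a (j - 1)..a j}. x = of_int (\<epsilon> j) * z + of_nat (m j))"
  unfolding data_interval_def by auto

lemma data_set_symmetric: "x \<in> data_set n \<epsilon> a m \<longleftrightarrow> - x \<in> data_set n \<epsilon> a m"
  unfolding data_set_def by force

lemma AE_countable_exception: "countable C \<Longrightarrow> AE x in lebesgue. (x::real) \<notin> C"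
  by (intro AE_not_in null_sets_completionI countable_imp_null_set_lborel)

section \<open>The set described by the data\<close>

locale wavelet_configuration =
  fixes n :: nat and \<epsilon> :: "nat \<Rightarrow> int" and \<tau> :: "nat \<Rightarrow> nat" and a :: "nat \<Rightarrow> real"
    and m :: "nat \<Rightarrow> nat" and lam :: "nat \<Rightarrow> int" and \<alpha> \<beta> :: "nat \<Rightarrow> real"
  assumes n: "n \<ge> 1" and \<epsilon>: "\<And>j. j \<in> {1..n} \<Longrightarrow> \<epsilon> j \<in> {-1, 1}"
    and \<tau>: "\<tau> permutes {1..n - 1}"
    and a0: "a 0 = 0" and a_less: "\<And>j. j \<in> {1..n} \<Longrightarrow> a (j - 1) < a j" and an: "a n = 1 / 2"
    and H: "\<And>j. j \<in> {1..n - 1} \<Longrightarrow> {\<alpha> (\<tau> j)..\<beta> (\<tau> j)} = (\<lambda>x. 2 powi (- lam j) * x) ` data_interval \<epsilon> a m j"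
    and Hn: "{\<alpha> n..\<beta> n} = data_interval \<epsilon> a m n"
    and top: "2 * \<alpha> 1 = \<beta> n"
    and adj: "\<And>k. k \<in> {1..n - 1} \<Longrightarrow> \<beta> k = \<alpha> (k + 1)"
    and sep: "\<And>j. j \<in> {1..n - 1} \<Longrightarrow> \<epsilon> j = \<epsilon> (j + 1) \<Longrightarrow> m j \<noteq> m (j + 1)"
begin

abbreviation "I \<equiv> data_interval \<epsilon> a m"
abbreviation "K \<equiv> data_set n \<epsilon> a m"

definition lo where "lo j = (if \<epsilon> j = 1 then a (j - 1) + of_nat (m j) else of_nat (m j) - a j)"
definition hi where "hi j = (if \<epsilon> j = 1 then a j + of_nat (m j) else of_nat (m j) - a (j - 1))"
text \<open>Together with \<open>\<tau> n = n\<close>, the exponent 0 for the last interval lets it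
  be treated like the others.\<close>

definition expo where "expo j = (if j = n then 0 else lam j)"
text \<open>The cut points of the partition of \<open>[\<beta> n / 2, \<beta> n]\<close> into the
  intervals H; the left end of the first one is stored at index 0.\<close>

definition cut where "cut k = (if k = 0 then \<alpha> 1 else \<beta> k)"

lemma a_bounds: "j \<le> n \<Longrightarrow> 0 \<le> a j \<and> a j \<le> 1 / 2"
  using strict_chain_le[of n a 0 j, OF a_less] strict_chain_le[of n a j n, OF a_less] a0 an by auto

lemma lo_less_hi: "j \<in> {1..n} \<Longrightarrow> lo j < hi j"
  using a_less[of j] by (auto simp: lo_def hi_def)

lemma I_eq: "j \<in> {1..n} \<Longrightarrow> I j = {lo j..hi j}"
proof -
  assume j: "j \<in> {1..n}"
  show ?thesis
  proof (cases "\<epsilon> j = 1")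
    case True
    show ?thesis
    proof (intro set_eqI iffI)
      fix x assume "x \<in> {lo j..hi j}"
      thus "x \<in> I j" unfolding data_interval_mem using True
        by (intro bexI[of _ "x - of_nat (m j)"]) (auto simp: lo_def hi_def)
    qed (auto simp: data_interval_mem True lo_def hi_def)
  next
    case False
    hence e: "\<epsilon> j = -1" using \<epsilon>[OF j] by auto
    show ?thesis
    proof (intro set_eqI iffI)
      fix x assume "x \<in> {lo j..hi j}"
      thus "x \<in> I j" unfolding data_interval_mem using e
        by (intro bexI[of _ "of_nat (m j) - x"]) (auto simp: lo_def hi_def)
    qed (auto simp: data_interval_mem e lo_def hi_def)
  qed
qed

lemma \<tau>_n: "\<tau> n = n"
  using permutes_not_in[OF \<tau>, of n] n by auto

lemma \<tau>_permutes: "\<tau> permutes {1..n}"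
  by (rule permutes_subset[OF \<tau>]) auto

lemma scale_interval: "(\<lambda>x::real. 2 powi i * x) ` {u..v} = {2 powi i * u..2 powi i * v}" if "u \<le> v"
  using that by (simp add: image_mult_atLeastAtMost)

lemma H_expo: "j \<in> {1..n} \<Longrightarrow> {\<alpha> (\<tau> j)..\<beta> (\<tau> j)} = {2 powi (- expo j) * lo j..2 powi (- expo j) * hi j}"
  using H[of j] Hn I_eq[of j] scale_interval[of "lo j" "hi j"] lo_less_hi[of j]
  by (cases "j = n") (auto simp: expo_def \<tau>_n)

lemma \<alpha>_\<tau>: "j \<in> {1..n} \<Longrightarrow> \<alpha> (\<tau> j) = 2 powi (- expo j) * lo j \<and> \<beta> (\<tau> j) = 2 powi (- expo j) * hi j"
proof -
  assume j: "j \<in> {1..n}"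
  have "2 powi (- expo j) * lo j < 2 powi (- expo j) * hi j"
    using lo_less_hi[OF j] by (intro mult_strict_left_mono) auto
  thus ?thesis using H_expo[OF j] by (metis Icc_eq_Icc less_imp_le)
qed

lemma \<tau>_surj: "k \<in> {1..n} \<Longrightarrow> \<exists>j\<in>{1..n}. \<tau> j = k"
  by (metis imageE permutes_image[OF \<tau>_permutes])

lemma \<alpha>_less_\<beta>: "k \<in> {1..n} \<Longrightarrow> \<alpha> k < \<beta> k"
proof -
  assume "k \<in> {1..n}"
  then obtain j where "j \<in> {1..n}" "k = \<tau> j" using \<tau>_surj by blast
  thus ?thesis using \<alpha>_\<tau>[of j] lo_less_hi[of j] by auto
qed

lemma cut_eq: "k \<in> {1..n} \<Longrightarrow> cut (k - 1) = \<alpha> k \<and> cut k = \<beta> k"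
proof -
  assume k: "k \<in> {1..n}"
  show ?thesis
  proof (cases "k = 1")
    case False
    hence "k - 1 \<in> {1..n - 1}" using k by auto
    from adj[OF this] show ?thesis using k False by (simp add: cut_def)
  qed (simp add: cut_def)
qed

lemma cut_less: "k \<in> {1..n} \<Longrightarrow> cut (k - 1) < cut k"
  using cut_eq \<alpha>_less_\<beta> by metis

lemma cut_0: "cut 0 = \<beta> n / 2" and cut_n: "cut n = \<beta> n" and \<beta>_pos: "\<beta> n > 0"
proof -
  show 1: "cut 0 = \<beta> n / 2" using top by (simp add: cut_def)
  show 2: "cut n = \<beta> n" using n by (simp add: cut_def)
  have "cut 0 < cut n" using strict_chain_less[of n cut 0 n, OF cut_less] n by auto
  thus "\<beta> n > 0" using 1 2 by simp
qed

lemma \<alpha>_\<beta>_bounds: "k \<in> {1..n} \<Longrightarrow> \<beta> n / 2 \<le> \<alpha> k \<and> \<beta> k \<le> \<beta> n"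
  using strict_chain_le[of n cut 0 "k - 1", OF cut_less] strict_chain_le[of n cut k n, OF cut_less]
    cut_eq[of k] cut_0 cut_n by auto

lemma \<tau>_in: "j \<in> {1..n} \<Longrightarrow> \<tau> j \<in> {1..n}"
  using permutes_in_image[OF \<tau>_permutes] by blast

text \<open>Positivity is a consequence of (b): the chain increases from
  \<open>\<beta> n / 2\<close> to \<open>\<beta> n\<close>, which forces
  \<open>\<beta> n > 0\<close>, and every rescaled interval lies to the right of
  \<open>\<beta> n / 2\<close>.\<close>

lemma lo_pos: "j \<in> {1..n} \<Longrightarrow> lo j > 0"
proof -
  assume j: "j \<in> {1..n}"
  have "0 < 2 powi (- expo j) * lo j"
    using \<alpha>_\<tau>[OF j] \<alpha>_\<beta>_bounds[OF \<tau>_in[OF j]] \<beta>_pos by simp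
  thus ?thesis by (rule zero_less_mult_pos) simp
qed

lemma I_pos: "j \<in> {1..n} \<Longrightarrow> x \<in> I j \<Longrightarrow> x > 0"
  using lo_pos[of j] I_eq[of j] by auto

lemma K_nonneg: "x \<ge> 0 \<Longrightarrow> x \<in> K \<longleftrightarrow> (\<exists>j\<in>{1..n}. x \<in> I j)"
proof
  assume "x \<ge> 0" "x \<in> K"
  then obtain j where j: "j \<in> {1..n}" "x \<in> I j \<or> - x \<in> I j" unfolding data_set_def by force
  thus "\<exists>j\<in>{1..n}. x \<in> I j" using I_pos[of j "- x"] \<open>x \<ge> 0\<close> by auto
qed (auto simp: data_set_def)

text \<open>A common point forces equal integers, equal signs and \<open>z = w\<close>, because the
  integer difference has modulus below 1. The two cells then share an end point, so they are
  adjacent, and this is the case that (c) rules out.\<close>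

lemma I_disjoint:
  assumes i: "i \<in> {1..n}" and j: "j \<in> {1..n}" and "i < j"
  shows "I i \<inter> I j = {}"
proof (rule ccontr)
  assume "I i \<inter> I j \<noteq> {}"
  then obtain z w where z: "z \<in> {a (i - 1)..a i}" and w: "w \<in> {a (j - 1)..a j}"
    and eq: "of_int (\<epsilon> i) * z + of_nat (m i) = of_int (\<epsilon> j) * w + of_nat (m j)"
    using data_interval_mem by (metis disjoint_iff)
  define k where "k = int (m j) - int (m i)"
  have k: "real_of_int k = of_int (\<epsilon> i) * z - of_int (\<epsilon> j) * w" using eq by (simp add: k_def)
  have ai: "0 \<le> a (i - 1)" "a i \<le> a (j - 1)" "a j \<le> 1 / 2"
    using a_bounds[of "i - 1"] a_bounds[of j] strict_chain_le[of n a i "j - 1", OF a_less] assms by auto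
  have lt: "a (i - 1) < a i" "a (j - 1) < a j" using a_less i j by auto
  have b: "0 \<le> z" "z \<le> w" "w \<le> 1 / 2" using ai z w lt by auto
  have zl: "z < 1 / 2" using z ai lt by auto
  have w0: "w > 0" using w ai lt by auto
  have "-1 < real_of_int k" "real_of_int k < 1" unfolding k
    using \<epsilon>[OF i] \<epsilon>[OF j] b zl w0 by auto
  hence k0: "k = 0" by linarith
  hence "of_int (\<epsilon> i) * z = of_int (\<epsilon> j) * w" using k by simp
  hence zw: "\<epsilon> i = \<epsilon> j \<and> z = w" using \<epsilon>[OF i] \<epsilon>[OF j] b w0 by auto
  hence "a i = a (j - 1)" using z w ai by auto
  hence "i = j - 1" using strict_chain_inj[of n a i "j - 1", OF a_less] i j by auto
  hence ij: "j = i + 1" "i \<in> {1..n - 1}" using i j \<open>i < j\<close> by auto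
  show False using sep[OF ij(2)] zw k0 unfolding k_def ij(1) by simp
qed

lemma K_disjoint_union:
  "\<exists>J. disjoint_intervals (2 * n) J \<and> K = (\<Union>i\<in>{1..2 * n}. J i)"
proof (intro exI conjI)
  \<comment> \<open>The indices above \<open>n\<close> carry the reflections; by
    \<open>lo_pos\<close> these do not meet the intervals themselves.\<close>
  define J where "J = (\<lambda>i. if i \<le> n then I i else uminus ` I (i - n))"
  have J1: "J i = {lo i..hi i}" if "i \<in> {1..n}" for i using that I_eq by (simp add: J_def)
  have J2: "J i = {- hi (i - n)..- lo (i - n)}" if "i \<in> {1..2 * n}" "\<not> i \<le> n" for i
  proof -
    have "i - n \<in> {1..n}" using that by auto
    thus ?thesis using that(2) by (simp add: J_def I_eq)
  qed
  have Jdata: "\<exists>u v. J i = {u..v} \<and> u < v" if "i \<in> {1..2 * n}" for i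
  proof (cases "i \<le> n")
    case True
    thus ?thesis using that J1[of i] lo_less_hi[of i] by auto
  next
    case False
    have "i - n \<in> {1..n}" using that False by auto
    from lo_less_hi[OF this] show ?thesis using J2[OF that False]
      by (intro exI[of _ "- hi (i - n)"] exI[of _ "- lo (i - n)"]) auto
  qed
  have disj: "J i \<inter> J j = {}" if "i \<in> {1..2 * n}" "j \<in> {1..2 * n}" "i < j" for i j
  proof (cases "j \<le> n")
    case True
    thus ?thesis using I_disjoint[of i j] that by (auto simp: J_def)
  next
    case j: False
    show ?thesis
    proof (cases "i \<le> n")
      case True
      have "j - n \<in> {1..n}" "i \<in> {1..n}" using True j that by auto
      thus ?thesis using J1[of i] J2[OF that(2) j] lo_pos[of i] lo_pos[of "j - n"] by auto
    next
      case False
      hence "i - n \<in> {1..n}" "j - n \<in> {1..n}" "i - n < j - n" using that j by auto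
      hence "I (i - n) \<inter> I (j - n) = {}" by (rule I_disjoint)
      thus ?thesis using False j by (auto simp: J_def)
    qed
  qed
  show "disjoint_intervals (2 * n) J"
    unfolding disjoint_intervals_def
  proof (intro conjI ballI)
    fix i assume "i \<in> {1..2 * n}"
    then obtain u v where "J i = {u..v}" "u < v" using Jdata by blast
    thus "is_interval (J i)" "closed (J i)" "interior (J i) \<noteq> {}"
      by (simp_all add: is_interval_cc interior_atLeastAtMost_real)
  next
    show "disjoint_family_on J {1..2 * n}"
      unfolding disjoint_family_on_def
    proof (intro ballI impI)
      fix i j assume "i \<in> {1..2 * n}" "j \<in> {1..2 * n}" "i \<noteq> j"
      thus "J i \<inter> J j = {}" using disj[of i j] disj[of j i] by (cases "i < j") auto
    qed
  qed
  show "K = (\<Union>i\<in>{1..2 * n}. J i)"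
  proof (intro set_eqI iffI)
    fix x assume "x \<in> K"
    then obtain j where j: "j \<in> {1..n}" "x \<in> I j \<or> x \<in> uminus ` I j" unfolding data_set_def by blast
    have "x \<in> J j \<or> x \<in> J (j + n)" using j by (auto simp: J_def)
    thus "x \<in> (\<Union>i\<in>{1..2 * n}. J i)" using j(1) by force
  next
    fix x assume "x \<in> (\<Union>i\<in>{1..2 * n}. J i)"
    then obtain i where i: "i \<in> {1..2 * n}" "x \<in> J i" by blast
    show "x \<in> K"
    proof (cases "i \<le> n")
      case True
      thus ?thesis using i unfolding data_set_def by (auto simp: J_def)
    next
      case False
      hence "i - n \<in> {1..n}" using i by auto
      thus ?thesis using i False unfolding data_set_def by (auto simp: J_def)
    qed
  qed
qed

lemma K_translation_tile: "translation_tile K"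
proof -
  \<comment> \<open>The points that fold onto a cell boundary. Off this countable set the folded
    point is interior to one cell, and the cell determines the translation.\<close>
  define C where "C = (\<Union>p::int. \<Union>s\<in>{-1, 1::int}. \<Union>i\<in>{0..n}. {of_int s * a i + of_int p})"
  have "countable C" unfolding C_def by (intro countable_UN) auto
  from AE_countable_exception[OF this] show ?thesis
    unfolding translation_tile_def
  proof eventually_elim
    case (elim x)
    obtain s q :: int and y where s: "s \<in> {-1, 1}" and x: "x = of_int s * y + of_int q" and y: "0 \<le> y" "y \<le> 1 / 2"
      by (rule fold_exists)
    have ya: "y \<noteq> a i" if "i \<le> n" for i
    proof
      assume "y = a i"
      hence "x \<in> C" unfolding C_def using s x that
        by (intro UN_I[of q] UN_I[of s] UN_I[of i]) auto
      thus False using elim by simp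
    qed
    have y': "0 < y" "y < 1 / 2" using y ya[of 0] ya[of n] a0 an by auto
    obtain j where j: "j \<in> {1..n}" "a (j - 1) < y" "y \<le> a j"
      using chain_cell[of a y n] y' a0 an by auto
    have j': "y < a j" using j ya[of j] by auto
    \<comment> \<open>The point \<open>\<epsilon> j y + m j\<close> lies in \<open>I j\<close>.
      Multiplied by the sign \<open>s * \<epsilon> j\<close> it becomes
      \<open>s y + s \<epsilon> j m j\<close>, and \<open>s y = x - q\<close>.\<close>
    show ?case
    proof (rule ex1I[of _ "s * \<epsilon> j * int (m j) - q"])
      have "of_int (\<epsilon> j) * y + of_nat (m j) \<in> I j" unfolding data_interval_mem using j by auto
      hence "of_int (\<epsilon> j) * y + of_nat (m j) \<in> K" using j(1) unfolding data_set_def by blast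
      moreover have "of_int (s * \<epsilon> j * int (m j) - q) + x = of_int (s * \<epsilon> j) * (of_int (\<epsilon> j) * y + of_nat (m j))"
        using \<epsilon>[OF j(1)] by (auto simp: x algebra_simps)
      moreover have "s * \<epsilon> j = 1 \<or> s * \<epsilon> j = -1" using s \<epsilon>[OF j(1)] by auto
      hence "of_int (s * \<epsilon> j) * w = w \<or> of_int (s * \<epsilon> j) * w = - w" for w :: real
        by (elim disjE) (simp_all del: of_int_mult)
      ultimately show "of_int (s * \<epsilon> j * int (m j) - q) + x \<in> K"
        using data_set_symmetric[of "of_int (\<epsilon> j) * y + of_nat (m j)"] by metis
    next
      fix k :: int assume "of_int k + x \<in> K"
      then obtain i s' where i: "i \<in> {1..n}" and s': "s' \<in> {-1, 1::int}" and mem: "of_int s' * (of_int k + x) \<in> I i"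
        unfolding data_set_def by force
      then obtain z where z: "z \<in> {a (i - 1)..a i}" "of_int s' * (of_int k + x) = of_int (\<epsilon> i) * z + of_nat (m i)"
        unfolding data_interval_mem by blast
      have "of_int (s' * s) * y = of_int (\<epsilon> i) * z + of_int (int (m i) - s' * (k + q))"
        using z(2) by (simp add: x algebra_simps)
      moreover have "s' * s \<in> {-1, 1}" using s s' by auto
      moreover have "i - 1 \<le> n" "i \<le> n" using i by auto
      hence "0 \<le> z" "z \<le> 1 / 2" using z(1) a_bounds[of "i - 1"] a_bounds[of i] by auto
      ultimately have *: "z = y" "s' * s = \<epsilon> i" "int (m i) - s' * (k + q) = 0"
        using fold_unique[of y z "s' * s" "\<epsilon> i"] y' \<epsilon>[OF i] by blast+
      have "j = i"
        by (rule cell_unique[of n a j i y, OF a_less j(1) i j(2) j']) (use z *(1) in auto)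
      hence eqs: "\<epsilon> j = s' * s" "int (m j) = s' * (k + q)" using *(2,3) by simp_all
      show "k = s * \<epsilon> j * int (m j) - q"
        unfolding eqs using s s' by auto
    qed
  qed
qed

lemma K_dyadic_tile: "dyadic_tile K"
proof -
  \<comment> \<open>Zero and the points with a dyadic multiple that is, up to sign, a cut
    point.\<close>
  define C where "C = insert 0 (\<Union>p::int. \<Union>s\<in>{-1, 1::real}. \<Union>i\<in>{0..n}. {s * (2 powi p * cut i)})"
  have "countable C" unfolding C_def by (intro countable_insert countable_UN) auto
  from AE_countable_exception[OF this] show ?thesis
    unfolding dyadic_tile_def
  proof eventually_elim
    case (elim x)
    have "\<bar>x\<bar> > 0" using elim by (auto simp: C_def)
    then obtain i0 :: int where i0: "\<beta> n / 2 \<le> 2 powi i0 * \<bar>x\<bar>" "2 powi i0 * \<bar>x\<bar> < \<beta> n"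
      using dyadic_exists \<beta>_pos by metis
    define y where "y = 2 powi i0 * \<bar>x\<bar>"
    have ycut: "y \<noteq> cut i" if "i \<le> n" for i
    proof
      assume "y = cut i"
      hence "\<bar>x\<bar> = 2 powi (- i0) * cut i" using powi_minus_mult[of i0 "\<bar>x\<bar>"] by (simp add: y_def)
      hence "x = 1 * (2 powi (- i0) * cut i) \<or> x = (-1) * (2 powi (- i0) * cut i)" by (auto simp: abs_if split: if_splits)
      hence "\<exists>s\<in>{-1, 1}. x = s * (2 powi (- i0) * cut i)" by blast
      hence "x \<in> C" unfolding C_def using that
        by (intro insertI2 UN_I[of "- i0"]) (auto intro!: bexI[of _ i])
      thus False using elim by simp
    qed
    have y: "\<beta> n / 2 < y" "y < \<beta> n" using i0 ycut[of 0] cut_0 by (auto simp: y_def)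
    obtain l where l: "l \<in> {1..n}" "cut (l - 1) < y" "y \<le> cut l"
      using chain_cell[of cut y n] y cut_0 cut_n by auto
    have l': "y < cut l" using l ycut[of l] by auto
    obtain j where j: "j \<in> {1..n}" "\<tau> j = l" using \<tau>_surj[OF l(1)] by blast
    \<comment> \<open>Everything is moved to the representative \<open>y\<close> in the fundamental
      interval. There the intervals H form a partition, so the remaining exponent
      \<open>k - i0 - expo i\<close> can only be 0.\<close>
    have mem: "2 powi k * x \<in> K \<longleftrightarrow> (\<exists>i\<in>{1..n}. 2 powi (k - i0 - expo i) * y \<in> {\<alpha> (\<tau> i)..\<beta> (\<tau> i)})" for k
    proof -
      have "2 powi k * x \<in> K \<longleftrightarrow> 2 powi k * \<bar>x\<bar> \<in> K"
        using data_set_symmetric[of "2 powi k * x"] by (auto simp: abs_if)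
      also have "\<dots> \<longleftrightarrow> (\<exists>i\<in>{1..n}. 2 powi k * \<bar>x\<bar> \<in> I i)" by (rule K_nonneg) simp
      also have "\<dots> \<longleftrightarrow> (\<exists>i\<in>{1..n}. 2 powi (k - i0 - expo i) * y \<in> {\<alpha> (\<tau> i)..\<beta> (\<tau> i)})"
      proof (intro bex_cong refl)
        fix i assume i: "i \<in> {1..n}"
        have "2 powi (k - i0 - expo i) * y = 2 powi (- expo i) * (2 powi k * \<bar>x\<bar>)"
        proof -
          have "(2::real) powi (k - i0 - expo i) * 2 powi i0 = 2 powi (- expo i) * 2 powi k"
            by (simp add: power_int_add[symmetric])
          thus ?thesis by (simp add: y_def mult.assoc[symmetric])
        qed
        thus "2 powi k * \<bar>x\<bar> \<in> I i \<longleftrightarrow> 2 powi (k - i0 - expo i) * y \<in> {\<alpha> (\<tau> i)..\<beta> (\<tau> i)}"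
          unfolding H_expo[OF i] I_eq[OF i] by (simp add: mult_le_cancel_left_pos)
      qed
      finally show ?thesis .
    qed
    show ?case
    proof (rule ex1I[of _ "i0 + expo j"])
      show "2 powi (i0 + expo j) * x \<in> K" unfolding mem
        by (rule bexI[OF _ j(1)]) (use j(2) l l' cut_eq[OF l(1)] in auto)
    next
      fix k :: int assume "2 powi k * x \<in> K"
      then obtain i where i: "i \<in> {1..n}" "2 powi (k - i0 - expo i) * y \<in> {\<alpha> (\<tau> i)..\<beta> (\<tau> i)}"
        unfolding mem by blast
      have b: "\<beta> n / 2 \<le> \<alpha> (\<tau> i) \<and> \<beta> (\<tau> i) \<le> \<beta> n" by (rule \<alpha>_\<beta>_bounds[OF \<tau>_in[OF i(1)]])
      have z: "k - i0 - expo i = 0"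
        by (rule dyadic_unique[OF y]) (use i(2) b in auto)
      hence "y \<in> {\<alpha> (\<tau> i)..\<beta> (\<tau> i)}" using i(2) by simp
      hence c: "cut (\<tau> i - 1) \<le> y" "y \<le> cut (\<tau> i)" using cut_eq[OF \<tau>_in[OF i(1)]] by auto
      have "l = \<tau> i"
        by (rule cell_unique[of n cut l "\<tau> i" y, OF cut_less l(1) \<tau>_in[OF i(1)] l(2) l' c])
      hence "i = j" using j permutes_inj[OF \<tau>_permutes] by (auto dest: injD)
      thus "k = i0 + expo j" using z by simp
    qed
  qed
qed

lemma K_wavelet_set: "wavelet_set K"
proof -
  obtain J where J: "disjoint_intervals (2 * n) J" "K = (\<Union>i\<in>{1..2 * n}. J i)"
    using K_disjoint_union by blast
  have "K \<in> sets lebesgue" unfolding J(2)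
    by (rule sets.finite_UN) (use J(1) in \<open>auto simp: disjoint_intervals_def\<close>)
  moreover have "bounded (I j \<union> uminus ` I j)" if "j \<in> {1..n}" for j
    by (simp add: I_eq[OF that])
  hence "bounded K" unfolding data_set_def by (intro bounded_UN) auto
  ultimately show ?thesis
    using wavelet_set_iff_tile K_translation_tile K_dyadic_tile by blast
qed

end

lemma wavelet_dataE:
  assumes "wavelet_data n \<epsilon> \<tau> a m lam"
  obtains \<alpha> \<beta> where "wavelet_configuration n \<epsilon> \<tau> a m lam \<alpha> \<beta>"
proof -
  from assms obtain \<alpha> \<beta> where
    f: "\<forall>j\<in>{1..n - 1}. {\<alpha> (\<tau> j)..\<beta> (\<tau> j)} = (\<lambda>x. 2 powi (- lam j) * x) ` data_interval \<epsilon> a m j"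
      "{\<alpha> n..\<beta> n} = data_interval \<epsilon> a m n" "2 * \<alpha> 1 = \<beta> n" "\<forall>k\<in>{1..n - 1}. \<beta> k = \<alpha> (k + 1)"
    unfolding wavelet_data_def by (elim conjE exE) (rule that)
  from assms have g: "n \<ge> 1" "\<forall>j\<in>{1..n}. \<epsilon> j \<in> {-1, 1}" "\<tau> permutes {1..n - 1}" "a 0 = 0"
      "\<forall>j\<in>{1..n}. a (j - 1) < a j" "a n = 1 / 2"
      "\<forall>j\<in>{1..n - 1}. \<epsilon> j = \<epsilon> (j + 1) \<longrightarrow> m j \<noteq> m (j + 1)"
    unfolding wavelet_data_def by - (elim conjE, assumption)+
  have "wavelet_configuration n \<epsilon> \<tau> a m lam \<alpha> \<beta>"
    by unfold_locales
      ((rule g(1,3,4,6) f(2,3) bspec[OF g(2)] bspec[OF g(5)] bspec[OF f(1)] bspec[OF f(4)]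
         mp[OF bspec[OF g(7)]]; assumption?)+)
  thus ?thesis by (rule that)
qed

subsection \<open>Uniqueness of the data\<close>

lemma connected_subset_disjoint_closed:
  assumes S: "connected S" "S \<noteq> {}" and A: "finite A" "\<And>i. i \<in> A \<Longrightarrow> closed (F i)"
    and disj: "\<And>i j. i \<in> A \<Longrightarrow> j \<in> A \<Longrightarrow> i \<noteq> j \<Longrightarrow> F i \<inter> F j = {}"
    and sub: "S \<subseteq> (\<Union>i\<in>A. F i)"
  obtains i where "i \<in> A" "S \<subseteq> F i"
proof -
  obtain x i where x: "x \<in> S" "x \<in> F i" and i: "i \<in> A" using S(2) sub by blast
  let ?R = "\<Union>j\<in>A - {i}. F j"
  have "closed (F i)" "closed ?R" using A i by auto
  moreover have "S \<subseteq> F i \<union> ?R" using sub by blast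
  moreover have "F i \<inter> ?R \<inter> S = {}" using disj i by blast
  moreover have "F i \<inter> S \<noteq> {}" using x by blast
  ultimately have "?R \<inter> S = {}" using S(1) unfolding connected_closed by metis
  hence "S \<subseteq> F i" using \<open>S \<subseteq> F i \<union> ?R\<close> by blast
  with i show ?thesis by (rule that)
qed

locale configuration_pair =
  c: wavelet_configuration n \<epsilon> \<tau> a m lam \<alpha> \<beta> +
  d: wavelet_configuration n' \<epsilon>' \<tau>' a' m' lam' \<alpha>' \<beta>'
  for n \<epsilon> \<tau> a m lam \<alpha> \<beta> n' \<epsilon>' \<tau>' a' m' lam' \<alpha>' \<beta>' +
  assumes K: "c.K = d.K"
begin

text \<open>By connectedness each interval of one family lies in a single interval of the other, and
  conversely. Disjointness turns the two inclusions into an equality.\<close>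

lemma intervals_eq:
  assumes j: "j \<in> {1..n}"
  shows "\<exists>i\<in>{1..n'}. c.I j = d.I i"
proof -
  have cd: "c.I i \<inter> c.I k = {}" if "i \<in> {1..n}" "k \<in> {1..n}" "i \<noteq> k" for i k
    using c.I_disjoint[of i k] c.I_disjoint[of k i] that by (cases "i < k") auto
  have dd: "d.I i \<inter> d.I k = {}" if "i \<in> {1..n'}" "k \<in> {1..n'}" "i \<noteq> k" for i k
    using d.I_disjoint[of i k] d.I_disjoint[of k i] that by (cases "i < k") auto
  have cI: "connected (c.I i)" "c.I i \<noteq> {}" "closed (c.I i)" if "i \<in> {1..n}" for i
    using c.lo_less_hi[OF that] by (auto simp: c.I_eq[OF that])
  have dI: "connected (d.I i)" "d.I i \<noteq> {}" "closed (d.I i)" if "i \<in> {1..n'}" for i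
    using d.lo_less_hi[OF that] by (auto simp: d.I_eq[OF that])
  have csub: "c.I i \<subseteq> (\<Union>k\<in>{1..n'}. d.I k)" if "i \<in> {1..n}" for i
  proof
    fix x assume x: "x \<in> c.I i"
    hence "x > 0" using c.I_pos that by blast
    moreover have "x \<in> c.K" using x that unfolding data_set_def by blast
    ultimately show "x \<in> (\<Union>k\<in>{1..n'}. d.I k)" unfolding K using d.K_nonneg[of x] by auto
  qed
  have dsub: "d.I i \<subseteq> (\<Union>k\<in>{1..n}. c.I k)" if "i \<in> {1..n'}" for i
  proof
    fix x assume x: "x \<in> d.I i"
    hence "x > 0" using d.I_pos that by blast
    moreover have "x \<in> d.K" using x that unfolding data_set_def by blast
    ultimately show "x \<in> (\<Union>k\<in>{1..n}. c.I k)" unfolding K[symmetric] using c.K_nonneg[of x] by auto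
  qed
  obtain i where i: "i \<in> {1..n'}" "c.I j \<subseteq> d.I i"
    by (rule connected_subset_disjoint_closed[OF cI(1,2)[OF j] finite_atLeastAtMost dI(3) dd csub[OF j]])
  obtain k where k: "k \<in> {1..n}" "d.I i \<subseteq> c.I k"
    by (rule connected_subset_disjoint_closed[OF dI(1,2)[OF i(1)] finite_atLeastAtMost cI(3) cd dsub[OF i(1)]])
  have "j = k" using cd[OF j k(1)] i(2) k(2) cI(2)[OF j] by blast
  thus ?thesis using i k by blast
qed

lemma interval_unique:
  assumes eq: "c.I j = d.I i" and j: "j \<in> {1..n}" and i: "i \<in> {1..n'}"
  shows "\<epsilon> j = \<epsilon>' i" "m j = m' i" "a (j - 1) = a' (i - 1)" "a j = a' i"
proof -
  \<comment> \<open>The midpoint of a cell is strictly between 0 and 1/2, where folding determines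
    sign and integer.\<close>
  define y where "y = (a (j - 1) + a j) / 2"
  have aj: "a (j - 1) < a j" "0 \<le> a (j - 1)" "a j \<le> 1 / 2"
    using c.a_less[OF j] c.a_bounds[of "j - 1"] c.a_bounds[of j] j by auto
  have y: "0 < y" "y < 1 / 2" "a (j - 1) \<le> y" "y \<le> a j" using aj by (auto simp: y_def)
  have "of_int (\<epsilon> j) * y + of_nat (m j) \<in> d.I i" unfolding eq[symmetric] data_interval_mem using y by auto
  then obtain z where z: "z \<in> {a' (i - 1)..a' i}" "of_int (\<epsilon> j) * y + of_nat (m j) = of_int (\<epsilon>' i) * z + of_nat (m' i)"
    unfolding data_interval_mem by blast
  have "i - 1 \<le> n'" "i \<le> n'" using i by auto
  hence "0 \<le> z" "z \<le> 1 / 2" using z(1) d.a_bounds[of "i - 1"] d.a_bounds[of i] by auto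
  moreover have "of_int (\<epsilon> j) * y = of_int (\<epsilon>' i) * z + of_int (int (m' i) - int (m j))" using z(2) by simp
  ultimately have *: "\<epsilon> j = \<epsilon>' i" "int (m' i) - int (m j) = 0"
    using fold_unique[of y z "\<epsilon> j" "\<epsilon>' i"] y c.\<epsilon>[OF j] d.\<epsilon>[OF i] by blast+
  show 1: "\<epsilon> j = \<epsilon>' i" and 2: "m j = m' i" using * by auto
  have "{c.lo j..c.hi j} = {d.lo i..d.hi i}" using eq c.I_eq[OF j] d.I_eq[OF i] by simp
  hence "c.lo j = d.lo i" "c.hi j = d.hi i" using c.lo_less_hi[OF j] by (auto simp: Icc_eq_Icc)
  thus "a (j - 1) = a' (i - 1)" "a j = a' i"
    using 1 2 by (auto simp: c.lo_def d.lo_def c.hi_def d.hi_def split: if_splits)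
qed

lemma data_unique:
  "n = n' \<and> \<tau> = \<tau>' \<and> (\<forall>j\<in>{1..n}. \<epsilon> j = \<epsilon>' j \<and> m j = m' j) \<and>
    (\<forall>j\<in>{0..n}. a j = a' j) \<and> (\<forall>j\<in>{1..n - 1}. lam j = lam' j)"
proof -
  have step: "\<exists>i\<in>{1..n'}. c.I j = d.I i \<and> a (j - 1) = a' (i - 1) \<and> a j = a' i" if "j \<in> {1..n}" for j
    using intervals_eq[OF that] interval_unique[OF _ that] by blast
  \<comment> \<open>The cells are matched from left to right: the left end of cell
    \<open>j + 1\<close> is already known to be \<open>a' j\<close>, and an increasing chain takes
    this value only once.\<close>
  have same: "j \<in> {1..n} \<Longrightarrow> j \<in> {1..n'} \<and> c.I j = d.I j" for j
  proof (induction j)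
    case (Suc j)
    obtain i where i: "i \<in> {1..n'}" "c.I (Suc j) = d.I i" "a j = a' (i - 1)"
      using step[OF Suc.prems] by auto
    have aj: "a j = a' j \<and> j \<le> n'"
    proof (cases "j = 0")
      case True
      thus ?thesis using c.a0 d.a0 by simp
    next
      case False
      hence "j \<in> {1..n}" using Suc.prems by auto
      thus ?thesis using Suc.IH interval_unique(4)[of j j] by auto
    qed
    have "a' (i - 1) = a' j" "i - 1 \<le> n'" "j \<le> n'" using i(1,3) aj by auto
    hence "i - 1 = j" using strict_chain_inj[of n' a' "i - 1" j, OF d.a_less] by blast
    hence "i = Suc j" using i(1) by auto
    thus ?case using i by simp
  qed simp
  have uniq: "\<epsilon> j = \<epsilon>' j" "m j = m' j" "a (j - 1) = a' (j - 1)" "a j = a' j" if "j \<in> {1..n}" for j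
    using interval_unique[of j j] same[OF that] that by blast+
  have nn: "n = n'"
  proof -
    have "n \<in> {1..n}" using c.n by auto
    hence "a' n = a' n'" "n \<le> n'" using uniq(4)[of n] same[of n] c.an d.an by auto
    thus ?thesis using strict_chain_inj[of n' a' n n', OF d.a_less] by blast
  qed
  have lohi: "c.lo j = d.lo j" "c.hi j = d.hi j" if "j \<in> {1..n}" for j
    using uniq[OF that] by (auto simp: c.lo_def d.lo_def c.hi_def d.hi_def)
  have nmem: "n \<in> {1..n}" using c.n by auto
  have \<beta>: "\<beta> n = \<beta>' n'"
  proof -
    have "\<beta> n = c.hi n" using c.\<alpha>_\<tau>[OF nmem] by (simp add: c.\<tau>_n c.expo_def)
    moreover have "\<beta>' n' = d.hi n'" using d.\<alpha>_\<tau>[of n'] d.n by (simp add: d.\<tau>_n d.expo_def)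
    moreover have "d.hi n = d.hi n'" using nn by simp
    ultimately show ?thesis using lohi(2)[OF nmem] by simp
  qed
  have ex: "c.expo j = d.expo j" if j: "j \<in> {1..n}" for j
  proof -
    \<comment> \<open>The rescaled midpoint is strictly between \<open>\<beta> n / 2\<close> and
      \<open>\<beta> n\<close>. The other exponent carries the same midpoint into the same interval,
      and by \<open>dyadic_unique\<close> the two exponents agree.\<close>
    define w where "w = 2 powi (- c.expo j) * ((c.lo j + c.hi j) / 2)"
    have j': "j \<in> {1..n'}" using j nn by simp
    have h: "c.lo j < c.hi j" by (rule c.lo_less_hi[OF j])
    have "2 powi (- c.expo j) * c.lo j < w" "w < 2 powi (- c.expo j) * c.hi j"
      unfolding w_def using h by (auto intro!: mult_strict_left_mono)
    hence w: "\<beta> n / 2 < w" "w < \<beta> n"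
      using c.\<alpha>_\<tau>[OF j] c.\<alpha>_\<beta>_bounds[OF c.\<tau>_in[OF j]] by auto
    have eq: "2 powi (c.expo j - d.expo j) * w = 2 powi (- d.expo j) * ((c.lo j + c.hi j) / 2)"
    proof -
      have "(2::real) powi (c.expo j - d.expo j) * 2 powi (- c.expo j) = 2 powi (- d.expo j)"
        by (simp add: power_int_add[symmetric])
      thus ?thesis by (simp add: w_def mult.assoc[symmetric])
    qed
    have 1: "2 powi (- d.expo j) * d.lo j \<le> 2 powi (- d.expo j) * ((c.lo j + c.hi j) / 2)"
      "2 powi (- d.expo j) * ((c.lo j + c.hi j) / 2) \<le> 2 powi (- d.expo j) * d.hi j"
      using h lohi[OF j] by (auto intro!: mult_left_mono)
    have 2: "\<beta> n / 2 \<le> 2 powi (- d.expo j) * d.lo j" "2 powi (- d.expo j) * d.hi j \<le> \<beta> n"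
      using d.\<alpha>_\<tau>[OF j'] d.\<alpha>_\<beta>_bounds[OF d.\<tau>_in[OF j']] \<beta> by auto
    have "c.expo j - d.expo j = 0"
      by (rule dyadic_unique[OF w]) (unfold eq, rule order_trans[OF 2(1) 1(1)], rule order_trans[OF 1(2) 2(2)])
    thus ?thesis by simp
  qed
  have cuts: "c.cut (\<tau> j - 1) = d.cut (\<tau>' j - 1)" "c.cut (\<tau> j) = d.cut (\<tau>' j)" if j: "j \<in> {1..n}" for j
  proof -
    have j': "j \<in> {1..n'}" using j nn by simp
    show "c.cut (\<tau> j - 1) = d.cut (\<tau>' j - 1)" "c.cut (\<tau> j) = d.cut (\<tau>' j)"
      using c.cut_eq[OF c.\<tau>_in[OF j]] d.cut_eq[OF d.\<tau>_in[OF j']] c.\<alpha>_\<tau>[OF j] d.\<alpha>_\<tau>[OF j'] ex[OF j] lohi[OF j]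
      by simp_all
  qed
  \<comment> \<open>Cut points and permutation are compared together: the common cut
    \<open>k\<close> is the left end of the interval at place \<open>k + 1\<close> in both orders,
    so that interval is the same, and its right end is the next common cut.\<close>
  have perm: "k \<le> n \<Longrightarrow> c.cut k = d.cut k \<and> (\<forall>j\<in>{1..n}. \<tau>' j = k \<longrightarrow> \<tau> j = k)" for k
  proof (induction k)
    case 0
    have "\<tau>' j \<noteq> 0" if "j \<in> {1..n}" for j using d.\<tau>_in[of j] that nn by auto
    moreover have "c.cut 0 = d.cut 0" using c.cut_0 d.cut_0 \<beta> by simp
    ultimately show ?case by blast
  next
    case (Suc k)
    have *: "\<tau> j = Suc k" if j: "j \<in> {1..n}" "\<tau>' j = Suc k" for j
    proof -
      have \<tau>j: "\<tau> j \<in> {1..n}" by (rule c.\<tau>_in[OF j(1)])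
      have "c.cut (\<tau> j - 1) = c.cut k" using cuts(1)[OF j(1)] j(2) Suc by simp
      moreover have "\<tau> j - 1 \<le> n" "k \<le> n" using \<tau>j Suc.prems by auto
      ultimately have "\<tau> j - 1 = k"
        using strict_chain_inj[of n c.cut "\<tau> j - 1" k, OF c.cut_less] by blast
      thus ?thesis using \<tau>j by auto
    qed
    obtain j where j: "j \<in> {1..n}" "\<tau>' j = Suc k" using d.\<tau>_surj[of "Suc k"] Suc.prems nn by auto
    have "c.cut (Suc k) = d.cut (Suc k)" using cuts(2)[OF j(1)] *[OF j] j(2) by simp
    thus ?case using * by blast
  qed
  have "\<tau> = \<tau>'"
  proof
    fix j
    show "\<tau> j = \<tau>' j"
    proof (cases "j \<in> {1..n}")
      case True
      thus ?thesis using perm[of "\<tau>' j"] d.\<tau>_in[of j] nn by auto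
    next
      case False
      thus ?thesis using permutes_not_in[OF c.\<tau>_permutes] permutes_not_in[OF d.\<tau>_permutes] nn by simp
    qed
  qed
  moreover have "a j = a' j" if "j \<in> {0..n}" for j
    using uniq(4)[of j] c.a0 d.a0 that by (cases "j = 0") auto
  moreover have "lam j = lam' j" if "j \<in> {1..n - 1}" for j
  proof -
    have "j \<in> {1..n}" "j \<noteq> n" "j \<noteq> n'" using that nn by auto
    thus ?thesis using ex[of j] by (simp add: c.expo_def d.expo_def)
  qed
  ultimately show ?thesis using nn uniq by blast
qed

end

subsection \<open>From wavelet sets to data\<close>

lemma interval_partition_sorted:
  fixes b c :: "'i \<Rightarrow> real"
  assumes "finite S" "card S = n" "n \<ge> 1" "\<And>j. j \<in> S \<Longrightarrow> b j < c j"
    and "\<And>i j. i \<in> S \<Longrightarrow> j \<in> S \<Longrightarrow> i \<noteq> j \<Longrightarrow> {b i<..<c i} \<inter> {b j<..<c j} = {}"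
    and "(\<Union>j\<in>S. {b j..c j}) = {A..B}"
  shows "\<exists>\<sigma> a. bij_betw \<sigma> {1..n} S \<and> a 0 = A \<and> a n = B \<and> (\<forall>k\<in>{1..n}. b (\<sigma> k) = a (k - 1) \<and> c (\<sigma> k) = a k)"
  using assms
proof (induction n arbitrary: S B)
  case (Suc n S B)
  have "S \<noteq> {}" using Suc.prems by auto
  then obtain i0 where "i0 \<in> S" by blast
  hence "b i0 \<in> {A..B}" using Suc.prems(4,6) by force
  hence "B \<in> (\<Union>j\<in>S. {b j..c j})" unfolding Suc.prems(6) by auto
  then obtain i where i: "i \<in> S" "b i \<le> B" "B \<le> c i" by auto
  have sub: "A \<le> b j" "c j \<le> B" if "j \<in> S" for j
  proof -
    have "b j \<in> {A..B}" "c j \<in> {A..B}" unfolding Suc.prems(6)[symmetric] using that Suc.prems(4)[OF that] by force+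
    thus "A \<le> b j" "c j \<le> B" by auto
  qed
  have ci: "c i = B" using i(3) sub(2)[OF i(1)] by simp
  let ?S = "S - {i}"
  have card: "finite ?S" "card ?S = n" using Suc.prems(1,2) i(1) by auto
  show ?case
  proof (cases "n = 0")
    case True
    hence "?S = {}" using card by (metis card_0_eq)
    hence "S = {i}" using i(1) by blast
    hence "{b i..c i} = {A..B}" using Suc.prems(6) by simp
    hence "b i = A" using Suc.prems(4)[OF i(1)] by (auto simp: Icc_eq_Icc)
    thus ?thesis using True \<open>S = {i}\<close> ci
      by (intro exI[of _ "\<lambda>_. i"] exI[of _ "\<lambda>k. if k = 0 then A else B"]) (auto simp: bij_betw_def)
  next
    case False
    have left: "c k \<le> b i" if k: "k \<in> ?S" for k
    proof (rule ccontr)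
      assume "\<not> c k \<le> b i"
      moreover have "b k < c k" "b i < c i" "c k \<le> c i" using Suc.prems(4) k i(1) sub(2)[of k] ci by auto
      ultimately have "(max (b k) (b i) + c k) / 2 \<in> {b i<..<c i} \<inter> {b k<..<c k}" by auto
      thus False using Suc.prems(5)[OF i(1), of k] k by blast
    qed
    have union: "(\<Union>j\<in>?S. {b j..c j}) = {A..b i}"
    proof
      show "(\<Union>j\<in>?S. {b j..c j}) \<subseteq> {A..b i}" using left sub(1) by force
      have ne: "?S \<noteq> {}" using False card(2) by (metis card.empty)
      then obtain k where k: "k \<in> ?S" by blast
      have "A < b i" using left[OF k] sub(1)[of k] Suc.prems(4)[of k] k by auto
      \<comment> \<open>Without the removed interval the cover is known at first only to the left of
        \<open>b i\<close>; closedness of a finite union adds the end point.\<close>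
      have "{A..<b i} \<subseteq> (\<Union>j\<in>?S. {b j..c j})"
      proof
        fix x assume x: "x \<in> {A..<b i}"
        hence "x \<in> {A..B}" using i(2) by auto
        then obtain j where "j \<in> S" "x \<in> {b j..c j}" unfolding Suc.prems(6)[symmetric] by blast
        thus "x \<in> (\<Union>j\<in>?S. {b j..c j})" using x by (intro UN_I[of j]) auto
      qed
      moreover have "closed (\<Union>j\<in>?S. {b j..c j})" using card(1) by (intro closed_UN) auto
      ultimately have "closure {A..<b i} \<subseteq> (\<Union>j\<in>?S. {b j..c j})" by (rule closure_minimal)
      thus "{A..b i} \<subseteq> (\<Union>j\<in>?S. {b j..c j})" using \<open>A < b i\<close> by simp
    qed
    have "\<exists>\<sigma> a. bij_betw \<sigma> {1..n} ?S \<and> a 0 = A \<and> a n = b i \<and> (\<forall>k\<in>{1..n}. b (\<sigma> k) = a (k - 1) \<and> c (\<sigma> k) = a k)"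
      by (rule Suc.IH[OF card _ _ _ union]) (use False Suc.prems in auto)
    then obtain \<sigma> a where \<sigma>: "bij_betw \<sigma> {1..n} ?S" and a: "a 0 = A" "a n = b i"
      "\<And>k. k \<in> {1..n} \<Longrightarrow> b (\<sigma> k) = a (k - 1) \<and> c (\<sigma> k) = a k" by blast
    have "bij_betw (\<sigma>(Suc n := i)) {1..n} ?S"
      using \<sigma> by (subst bij_betw_cong[of _ _ \<sigma>]) auto
    hence "bij_betw (\<sigma>(Suc n := i)) ({1..n} \<union> {Suc n}) (?S \<union> {(\<sigma>(Suc n := i)) (Suc n)})"
      by (intro notIn_Un_bij_betw) auto
    moreover have "{1..n} \<union> {Suc n} = {1..Suc n}" by auto
    moreover have "?S \<union> {(\<sigma>(Suc n := i)) (Suc n)} = S" using i(1) by auto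
    ultimately have "bij_betw (\<sigma>(Suc n := i)) {1..Suc n} S" by simp
    moreover have "(a(Suc n := B)) 0 = A" "(a(Suc n := B)) (Suc n) = B" using a(1) by auto
    moreover have "\<forall>k\<in>{1..Suc n}. b ((\<sigma>(Suc n := i)) k) = (a(Suc n := B)) (k - 1) \<and>
        c ((\<sigma>(Suc n := i)) k) = (a(Suc n := B)) k" using a ci by auto
    ultimately show ?thesis by blast
  qed
qed simp

section \<open>From almost everywhere to exact statements\<close>

lemma AE_interval_ex:
  assumes "AE x in lebesgue. P (x::real)" "u < v"
  obtains x where "u < x" "x < v" "P x"
proof -
  obtain N where N: "N \<in> null_sets lebesgue" "{x. \<not> P x} \<subseteq> N"
    using assms(1) unfolding eventually_ae_filter by auto
  have "\<not> {u<..<v} \<subseteq> N"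
  proof
    assume "{u<..<v} \<subseteq> N"
    hence "negligible {u<..<v}" using N(1) negligible_subset by (auto simp: negligible_iff_null_sets)
    thus False using open_not_negligible[of "{u<..<v}"] assms(2) by auto
  qed
  then obtain x where "x \<in> {u<..<v}" "x \<notin> N" by blast
  thus ?thesis using that[of x] N(2) by auto
qed

text \<open>A set of full measure meets every ball, so an open gap in \<open>C\<close> is
  impossible. This makes exact covers out of the two tilings.\<close>

lemma closed_covers_interval:
  assumes "closed C" "u < v" and P: "AE x in lebesgue. P (x::real)"
    and C: "\<And>y. u < y \<Longrightarrow> y < v \<Longrightarrow> P y \<Longrightarrow> y \<in> C"
  shows "{u..v} \<subseteq> C"
proof -
  have "{u<..<v} \<subseteq> C"
  proof
    fix x assume x: "x \<in> {u<..<v}"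
    show "x \<in> C"
    proof (rule ccontr)
      assume "x \<notin> C"
      moreover have "open ({u<..<v} - C)" using assms(1) by (intro open_Diff) auto
      ultimately obtain d where d: "d > 0" "ball x d \<subseteq> {u<..<v} - C"
        using x open_contains_ball by blast
      obtain y where y: "x - d < y" "y < x + d" "P y"
        using AE_interval_ex[OF P, of "x - d" "x + d"] d(1) by auto
      hence "y \<in> ball x d" by (auto simp: dist_real_def)
      thus False using d(2) C[of y] y(3) by auto
    qed
  qed
  from closure_minimal[OF this assms(1)] show ?thesis using assms(2) by simp
qed

text \<open>\<open>disjoint_intervals\<close> admits unbounded intervals. Half-lines are excluded
  because the squared modulus of the transform is integrable and equals the indicator of
  \<open>K\<close>, so \<open>K\<close> has finite measure.\<close>

lemma wavelet_set_no_halfline: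
  assumes "wavelet_set K" shows "\<not> {u..} \<subseteq> K"
proof
  assume sub: "{u..} \<subseteq> K"
  obtain g where g: "L2_fun g" "AE x in lebesgue. cmod (g x) = indicator K x" and K: "K \<in> sets lebesgue"
    using assms unfolding wavelet_set_def has_L2_fourier_transform_def by blast
  have "integrable lebesgue (indicator K :: real \<Rightarrow> real)"
  proof (rule integrable_cong_AE_imp[OF L2_fun_integrable_sq[OF g(1)]])
    show "AE x in lebesgue. (cmod (g x))\<^sup>2 = indicator K x"
      using g(2) by eventually_elim (simp split: split_indicator)
  qed (use K in simp)
  hence fin: "emeasure lebesgue K < \<infinity>" using K by (simp add: integrable_indicator_iff)
  define R where "R = measure lebesgue K + 1"
  have "emeasure lebesgue {u..u + R} \<le> emeasure lebesgue K"
    by (rule emeasure_mono) (use sub K in auto)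
  also have "\<dots> = ennreal (measure lebesgue K)" using fin by (simp add: emeasure_eq_ennreal_measure)
  finally show False by (simp add: R_def emeasure_lborel_Icc_eq ennreal_le_iff)
qed

section \<open>Symmetric tiles made of intervals\<close>

locale interval_tiling =
  fixes n :: nat and K :: "real set" and I :: "nat \<Rightarrow> real set" and lo hi :: "nat \<Rightarrow> real"
  assumes n: "n \<ge> 1" and sym: "\<And>x. x \<in> K \<longleftrightarrow> - x \<in> K"
    and I: "\<And>j. j \<in> {1..n} \<Longrightarrow> I j = {lo j..hi j}" and lo_hi: "\<And>j. j \<in> {1..n} \<Longrightarrow> lo j < hi j"
    and disj: "\<And>i j. i \<in> {1..n} \<Longrightarrow> j \<in> {1..n} \<Longrightarrow> i \<noteq> j \<Longrightarrow> I i \<inter> I j = {}"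
    and K: "K \<inter> {0..} = (\<Union>j\<in>{1..n}. I j)"
    and trans: "translation_tile K" and dyad: "dyadic_tile K"
begin

text \<open>An overlap of positive length contradicts uniqueness almost everywhere. The form
  \<open>t + c * y\<close> allows the overlap to be described in the cell coordinate
  \<open>y\<close>; \<open>no_dilate\<close> is the counterpart for powers of 2.\<close>

lemma no_translate:
  assumes "p \<noteq> 0" "u < v" "c \<noteq> 0"
    and mem: "\<And>y. u < y \<Longrightarrow> y < v \<Longrightarrow> t + c * y \<in> K \<and> of_int p + (t + c * y) \<in> K"
  shows False
proof -
  obtain y where y: "u < y" "y < v" "\<exists>!m::int. of_int m + (t + c * y) \<in> K"
    using AE_interval_ex[OF AE_lebesgue_affine[OF trans[unfolded translation_tile_def] assms(3)] assms(2)]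
    by blast
  have "of_int 0 + (t + c * y) \<in> K" "of_int p + (t + c * y) \<in> K" using mem[OF y(1,2)] by auto
  thus False using y(3) assms(1) by blast
qed

lemma no_dilate:
  assumes "p \<noteq> 0" "u < v" "c \<noteq> 0"
    and mem: "\<And>y. u < y \<Longrightarrow> y < v \<Longrightarrow> c * y \<in> K \<and> 2 powi p * (c * y) \<in> K"
  shows False
proof -
  obtain y where y: "u < y" "y < v" "\<exists>!m::int. 2 powi m * (0 + c * y) \<in> K"
    using AE_interval_ex[OF AE_lebesgue_affine[OF dyad[unfolded dyadic_tile_def] assms(3)] assms(2)]
    by blast
  have "2 powi 0 * (0 + c * y) \<in> K" "2 powi p * (0 + c * y) \<in> K" using mem[OF y(1,2)] by auto
  thus False using y(3) assms(1) by blast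
qed

lemma I_sub: "j \<in> {1..n} \<Longrightarrow> x \<in> I j \<Longrightarrow> x \<in> K \<and> 0 \<le> x"
  using K by auto

lemma K_ex: "x \<in> K \<Longrightarrow> 0 \<le> x \<Longrightarrow> \<exists>j\<in>{1..n}. x \<in> I j"
  using K by auto

text \<open>If an interval began at 0, its left half and the double of that half would both lie in
  \<open>K\<close>.\<close>

lemma lo_pos: assumes j: "j \<in> {1..n}" shows "lo j > 0"
proof (rule ccontr)
  assume "\<not> lo j > 0"
  moreover have "lo j \<ge> 0" using I_sub[OF j, of "lo j"] I[OF j] lo_hi[OF j] by auto
  ultimately have 0: "lo j = 0" by simp
  have "hi j > 0" using lo_hi[OF j] 0 by simp
  show False
  proof (rule no_dilate[of 1 0 "hi j / 2" 1])
    fix x assume "0 < x" "x < hi j / 2"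
    hence "x \<in> I j" "2 powi 1 * x \<in> I j" unfolding I[OF j] 0 by auto
    thus "1 * x \<in> K \<and> 2 powi 1 * (1 * x) \<in> K" using I_sub[OF j] by simp
  qed (use \<open>hi j > 0\<close> in auto)
qed

text \<open>No interval contains a half-integer \<open>c = (p + 1) / 2\<close> in its interior: by
  symmetry points near \<open>- c\<close> would lie in \<open>K\<close>, and the translation by the
  nonzero integer \<open>2 * c\<close> would take them into the same interval. So each interval
  stays within one half-unit.\<close>

lemma fold_ex:
  assumes j: "j \<in> {1..n}"
  shows "\<exists>e mm b c. e \<in> {-1, 1::int} \<and> 0 \<le> b \<and> b < c \<and> c \<le> 1 / 2 \<and>
    I j = (\<lambda>x. of_int e * x + of_nat mm) ` {b..c}"
proof -
  define p where "p = \<lfloor>2 * lo j\<rfloor>"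
  have "of_int p \<le> 2 * lo j \<and> 2 * lo j < of_int p + 1"
    using floor_correct[of "2 * lo j"] by (simp only: p_def of_int_add of_int_1)
  hence p: "of_int p / 2 \<le> lo j" "lo j < (of_int p + 1) / 2" by auto
  have p0: "p \<ge> 0" unfolding p_def using lo_pos[OF j] by simp
  have hi: "hi j \<le> (of_int p + 1) / 2"
  proof (rule ccontr)
    assume h: "\<not> hi j \<le> (of_int p + 1) / 2"
    define c where "c = (of_int p + 1) / (2::real)"
    define d where "d = min (c - lo j) (hi j - c)"
    have d: "d > 0" "lo j \<le> c - d" "c + d \<le> hi j" using p h by (auto simp: d_def c_def)
    have pc: "real_of_int (p + 1) = 2 * c" by (simp add: c_def)
    show False
    proof (rule no_translate[of "p + 1" "- c - d" "- c + d" 1 0])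
      fix x assume x: "- c - d < x" "x < - c + d"
      hence "- x \<in> I j" unfolding I[OF j] using d by auto
      moreover have "of_int (p + 1) + x \<in> I j" unfolding I[OF j] pc using x d by auto
      ultimately have "x \<in> K" "of_int (p + 1) + x \<in> K" using I_sub[OF j] sym[of x] by blast+
      thus "0 + 1 * x \<in> K \<and> of_int (p + 1) + (0 + 1 * x) \<in> K" by simp
    qed (use p0 d in auto)
  qed
  show ?thesis
  \<comment> \<open>The parity of \<open>p\<close> gives the sign: \<open>[q, q + 1/2]\<close> is
    folded by a translation, \<open>[q + 1/2, q + 1]\<close> by a reflection about its right
    end.\<close>
  proof (cases "even p")
    case True
    then obtain q where q: "p = 2 * q" by blast
    have q0: "real (nat q) = of_int q" using q p0 by simp
    show ?thesis
    proof (intro exI conjI)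
      show "I j = (\<lambda>x. of_int 1 * x + of_nat (nat q)) ` {lo j - of_int q..hi j - of_int q}"
        unfolding I[OF j] q0 by (auto intro!: image_eqI[of _ _ "_ - of_int q"])
    qed (use p hi lo_hi[OF j] q in auto)
  next
    case False
    then obtain q where q: "p = 2 * q + 1" by (auto elim: oddE)
    have q0: "real (nat (q + 1)) = of_int q + 1" using q p0 by simp
    show ?thesis
    proof (intro exI conjI)
      show "I j = (\<lambda>x. of_int (-1) * x + of_nat (nat (q + 1))) ` {of_int q + 1 - hi j..of_int q + 1 - lo j}"
        unfolding I[OF j] q0 by (auto intro!: image_eqI[of _ _ "of_int q + 1 - _"])
    qed (use p hi lo_hi[OF j] q in auto)
  qed
qed

lemma translation_data:
  "\<exists>\<sigma> e mm a. bij_betw \<sigma> {1..n} {1..n} \<and> (\<forall>k\<in>{1..n}. e k \<in> {-1, 1}) \<and> a 0 = 0 \<and> a n = 1 / 2 \<and>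
    (\<forall>k\<in>{1..n}. a (k - 1) < a k \<and> I (\<sigma> k) = data_interval e a mm k)"
proof -
  have "\<forall>j. \<exists>e mm b c. j \<in> {1..n} \<longrightarrow> e \<in> {-1, 1::int} \<and> 0 \<le> b \<and> b < c \<and> c \<le> 1 / 2 \<and>
      I j = (\<lambda>x. of_int e * x + of_nat mm) ` {b..c}"
    using fold_ex by blast
  then obtain e mm b c where fold: "\<And>j. j \<in> {1..n} \<Longrightarrow> e j \<in> {-1, 1::int} \<and> 0 \<le> b j \<and> b j < c j \<and>
      c j \<le> 1 / 2 \<and> I j = (\<lambda>x. of_int (e j) * x + of_nat (mm j)) ` {b j..c j}"
    unfolding choice_iff by blast
  hence e: "e j \<in> {-1, 1}" and b: "0 \<le> b j" "b j < c j" "c j \<le> 1 / 2"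
    and Ij: "I j = (\<lambda>x. of_int (e j) * x + of_nat (mm j)) ` {b j..c j}" if "j \<in> {1..n}" for j
    using that by blast+
  have dis: "{b i<..<c i} \<inter> {b j<..<c j} = {}" if ij: "i \<in> {1..n}" "j \<in> {1..n}" "i \<noteq> j" for i j
  proof (rule ccontr)
    assume ne: "{b i<..<c i} \<inter> {b j<..<c j} \<noteq> {}"
    define u v where "u = max (b i) (b j)" and "v = min (c i) (c j)"
    have uv: "u < v" using ne by (auto simp: u_def v_def)
    have Ii: "of_int (e i) * y + of_nat (mm i) \<in> I i" and Ijj: "of_int (e j) * y + of_nat (mm j) \<in> I j"
      if "u < y" "y < v" for y
      unfolding Ij[OF ij(1)] Ij[OF ij(2)] using that by (auto simp: u_def v_def)
    \<comment> \<open>Over a common part of the two cells, \<open>I i\<close> is the image of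
      \<open>I j\<close> under the sign \<open>s\<close> followed by the translation by
      \<open>p\<close>. Since \<open>K\<close> is symmetric, \<open>p \<noteq> 0\<close> contradicts
      the translation tiling.\<close>
    define s where "s = e i * e j"
    have s: "s = 1 \<or> s = -1" using e[OF ij(1)] e[OF ij(2)] by (auto simp: s_def)
    define p where "p = int (mm i) - s * int (mm j)"
    have ei: "real_of_int (e i) = of_int s * of_int (e j)" using e[OF ij(1)] e[OF ij(2)] by (auto simp: s_def)
    have sK: "of_int s * x \<in> K \<longleftrightarrow> x \<in> K" for x using s sym[of x] by auto
    have both: "of_int s * (of_int (e j) * y + of_nat (mm j)) \<in> K \<and>
        of_int p + of_int s * (of_int (e j) * y + of_nat (mm j)) \<in> K" if "u < y" "y < v" for y
    proof -
      have "of_int p + of_int s * (of_int (e j) * y + of_nat (mm j)) = of_int (e i) * y + of_nat (mm i)"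
        unfolding ei p_def by (simp add: algebra_simps)
      thus ?thesis using Ii[OF that] Ijj[OF that] I_sub[OF ij(1)] I_sub[OF ij(2)] sK by metis
    qed
    show False
    proof (cases "p = 0")
      case False
      have "of_int s * (of_int (e j) * y + of_nat (mm j)) = of_int s * of_nat (mm j) + of_int (e i) * y" for y :: real
        unfolding ei by (simp add: algebra_simps)
      thus False
        by (intro no_translate[OF False uv, of "of_int (e i)" "of_int s * of_nat (mm j)"])
          (use both e[OF ij(1)] in auto)
    next
      case True
      define y where "y = (u + v) / 2"
      have y: "u < y" "y < v" using uv by (auto simp: y_def)
      have y0: "y > 0" using y(1) b[OF ij(1)] by (auto simp: u_def)
      from s show False
      proof
        assume "s = 1"
        hence "of_int (e i) * y + of_nat (mm i) = of_int (e j) * y + of_nat (mm j)"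
          using ei True by (simp add: p_def)
        thus False using Ii[OF y] Ijj[OF y] disj[OF ij] by auto
      next
        \<comment> \<open>Now \<open>p\<close> is the sum of the two nonnegative integers, so both
          are 0. Two opposite signs applied to \<open>y > 0\<close> cannot both give points of the
          nonnegative half-line.\<close>
        assume s1: "s = -1"
        hence "mm i = 0" "mm j = 0" using True by (auto simp: p_def)
        hence "0 \<le> of_int (e i) * y" "0 \<le> of_int (e j) * y"
          using Ii[OF y] Ijj[OF y] I_sub[OF ij(1)] I_sub[OF ij(2)] by fastforce+
        thus False using ei s1 y0 e[OF ij(2)] by auto
      qed
    qed
  qed
  have cover: "(\<Union>j\<in>{1..n}. {b j..c j}) = {0..1 / 2}"
  proof
    have "{b j..c j} \<subseteq> {0..1 / 2}" if "j \<in> {1..n}" for j using b[OF that] by auto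
    thus "(\<Union>j\<in>{1..n}. {b j..c j}) \<subseteq> {0..1 / 2}" by blast
    show "{0..1 / 2} \<subseteq> (\<Union>j\<in>{1..n}. {b j..c j})"
    proof (rule closed_covers_interval[OF _ _ trans[unfolded translation_tile_def]])
      show "closed (\<Union>j\<in>{1..n}. {b j..c j})" by (intro closed_UN) auto
      fix y :: real assume y: "0 < y" "y < 1 / 2" and "\<exists>!k::int. of_int k + y \<in> K"
      then obtain k where k: "of_int k + y \<in> K" by blast
      \<comment> \<open>By symmetry the translate of \<open>y\<close> may be taken nonnegative.
        Since folding is unique, \<open>y\<close> is then the cell coordinate of the interval that
        contains it.\<close>
      obtain t where t: "t \<in> {-1, 1::int}" "of_int t * (of_int k + y) \<in> K" "0 \<le> of_int t * (of_int k + y)"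
      proof (cases "0 \<le> of_int k + y")
        case True
        thus ?thesis using that[of 1] k by simp
      next
        case False
        thus ?thesis using that[of "-1"] k sym[of "of_int k + y"] by auto
      qed
      obtain j where j: "j \<in> {1..n}" "of_int t * (of_int k + y) \<in> I j" using K_ex[OF t(2,3)] by blast
      then obtain z where z: "z \<in> {b j..c j}" "of_int t * (of_int k + y) = of_int (e j) * z + of_nat (mm j)"
        using Ij[OF j(1)] by auto
      have "of_int t * y = of_int (e j) * z + of_int (int (mm j) - t * k)" using z(2) by (simp add: algebra_simps)
      moreover have "0 \<le> z" "z \<le> 1 / 2" using z(1) b[OF j(1)] by auto
      ultimately have "z = y"
        using fold_unique[of y z t "e j" "int (mm j) - t * k"] t(1) e[OF j(1)] y by blast
      thus "y \<in> (\<Union>j\<in>{1..n}. {b j..c j})" using z(1) j(1) by blast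
    qed simp
  qed
  obtain \<sigma> a where \<sigma>: "bij_betw \<sigma> {1..n} {1..n}" and a: "a 0 = 0" "a n = 1 / 2"
    "\<And>k. k \<in> {1..n} \<Longrightarrow> b (\<sigma> k) = a (k - 1) \<and> c (\<sigma> k) = a k"
    using interval_partition_sorted[OF finite_atLeastAtMost _ n b(2) dis cover] by auto
  have \<sigma>in: "\<sigma> k \<in> {1..n}" if "k \<in> {1..n}" for k using \<sigma> that by (auto simp: bij_betw_def)
  show ?thesis
  proof (rule exI[of _ \<sigma>], rule exI[of _ "\<lambda>k. e (\<sigma> k)"], rule exI[of _ "\<lambda>k. mm (\<sigma> k)"],
      rule exI[of _ a], intro conjI ballI)
    fix k assume k: "k \<in> {1..n}"
    show "e (\<sigma> k) \<in> {-1, 1}" by (rule e[OF \<sigma>in[OF k]])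
    show "a (k - 1) < a k" using a(3)[OF k] b(2)[OF \<sigma>in[OF k]] by simp
    show "I (\<sigma> k) = data_interval (\<lambda>k. e (\<sigma> k)) a (\<lambda>k. mm (\<sigma> k)) k"
      unfolding data_interval_def Ij[OF \<sigma>in[OF k]] using a(3)[OF k] by simp
  qed (use \<sigma> a in auto)
qed

text \<open>The exponents are chosen by the left ends alone, so that these fall into
  \<open>[hi t / 2, hi t)\<close>. That the right ends also stay below \<open>hi t\<close> comes
  from \<open>I t\<close> itself, which occupies the points just left of
  \<open>hi t\<close>.\<close>

lemma dyadic_data:
  assumes t: "t \<in> {1..n}"
  shows "\<exists>lam \<rho> a. lam t = 0 \<and> bij_betw \<rho> {1..n} {1..n} \<and> a 0 = hi t / 2 \<and> a n = hi t \<and> \<rho> n = t \<and>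
    (\<forall>k\<in>{1..n}. 2 powi (- lam (\<rho> k)) * lo (\<rho> k) = a (k - 1) \<and> 2 powi (- lam (\<rho> k)) * hi (\<rho> k) = a k)"
proof -
  let ?B = "hi t"
  have B: "?B > 0" using lo_pos[OF t] lo_hi[OF t] by simp
  have "\<forall>j\<in>{1..n}. \<exists>i::int. ?B / 2 \<le> 2 powi (- i) * lo j \<and> 2 powi (- i) * lo j < ?B"
  proof
    fix j assume "j \<in> {1..n}"
    then obtain i :: int where "?B / 2 \<le> 2 powi i * lo j" "2 powi i * lo j < ?B"
      using dyadic_exists[OF lo_pos B] by blast
    thus "\<exists>i::int. ?B / 2 \<le> 2 powi (- i) * lo j \<and> 2 powi (- i) * lo j < ?B"
      by (intro exI[of _ "- i"]) simp
  qed
  from bchoice[OF this] obtain lam :: "nat \<Rightarrow> int" where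
    lam: "\<And>j. j \<in> {1..n} \<Longrightarrow> ?B / 2 \<le> 2 powi (- lam j) * lo j" "\<And>j. j \<in> {1..n} \<Longrightarrow> 2 powi (- lam j) * lo j < ?B"
    by blast
  define b c where "b = (\<lambda>j. 2 powi (- lam j) * lo j)" and "c = (\<lambda>j. 2 powi (- lam j) * hi j)"
  have bc: "b j < c j" if "j \<in> {1..n}" for j
    unfolding b_def c_def using lo_hi[OF that] by (intro mult_strict_left_mono) auto
  have mem: "2 powi (lam j) * x \<in> I j" if j: "j \<in> {1..n}" and "b j \<le> x" "x \<le> c j" for j x
  proof -
    have eq: "2 powi (lam j) * (2 powi (- lam j) * y) = y" for y :: real
      using powi_minus_mult[of "- lam j" y] by simp
    have "2 powi (lam j) * b j \<le> 2 powi (lam j) * x" "2 powi (lam j) * x \<le> 2 powi (lam j) * c j"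
      using that by (auto intro!: mult_left_mono)
    thus ?thesis unfolding b_def c_def eq I[OF j] by simp
  qed
  \<comment> \<open>A rescaled interval that crossed \<open>hi t\<close> would overlap
    \<open>I t\<close> to the left of it. For a nonzero exponent this contradicts the dyadic tiling;
    for exponent 0 disjointness gives \<open>j = t\<close>, and \<open>I t\<close> does not extend
    beyond \<open>hi t\<close>.\<close>
  have cB: "c j \<le> ?B" if j: "j \<in> {1..n}" for j
  proof (rule ccontr)
    assume "\<not> c j \<le> ?B"
    hence c: "?B < c j" by simp
    have pt: "x \<in> I t" "2 powi (lam j) * x \<in> I j" if "max (b j) (lo t) < x" "x < ?B" for x
      using that mem[OF j, of x] c I[OF t] by auto
    have lt: "max (b j) (lo t) < ?B" using lam(2)[OF j] lo_hi[OF t] by (simp add: b_def)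
    show False
    proof (cases "lam j = 0")
      case False
      show False
        by (rule no_dilate[OF False lt, of 1]) (use pt I_sub[OF t] I_sub[OF j] in simp_all)
    next
      case True
      define x where "x = (max (b j) (lo t) + ?B) / 2"
      have "x \<in> I t" "x \<in> I j" using pt[of x] lt True by (auto simp: x_def)
      hence "j = t" using disj[OF j t] by blast
      thus False using c True by (simp add: c_def)
    qed
  qed
  \<comment> \<open>A negative exponent would push the right end beyond \<open>hi t\<close>, a
    positive one the left end below \<open>hi t / 2\<close>.\<close>
  have lam_t: "lam t = 0"
  proof (rule ccontr)
    assume nz: "lam t \<noteq> 0"
    define x where "x = (lo t + ?B) / 2"
    consider "lam t \<le> -1" | "lam t \<ge> 1" using nz by linarith
    thus False
    proof cases
      case 1
      hence "2 powi 1 \<le> (2::real) powi (- lam t)" unfolding powi_le_iff by simp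
      hence "2 powi 1 * ?B \<le> 2 powi (- lam t) * ?B" using B by (intro mult_right_mono) auto
      thus False using cB[OF t] B by (simp add: c_def)
    next
      case 2
      hence "(2::real) powi (- lam t) \<le> 2 powi (-1)" unfolding powi_le_iff by simp
      hence "2 powi (- lam t) * lo t \<le> 2 powi (-1) * lo t" using lo_pos[OF t] by (intro mult_right_mono) auto
      thus False using lam(1)[OF t] lo_hi[OF t] by (simp add: power_int_minus)
    qed
  qed
  have dis: "{b i<..<c i} \<inter> {b j<..<c j} = {}" if ij: "i \<in> {1..n}" "j \<in> {1..n}" "i \<noteq> j" for i j
  proof (rule ccontr)
    assume ne: "{b i<..<c i} \<inter> {b j<..<c j} \<noteq> {}"
    define u v where "u = max (b i) (b j)" and "v = min (c i) (c j)"
    have uv: "u < v" using ne by (auto simp: u_def v_def)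
    have pt: "2 powi (lam i) * x \<in> I i" "2 powi (lam j) * x \<in> I j" if "u < x" "x < v" for x
      using mem[OF ij(1), of x] mem[OF ij(2), of x] that by (auto simp: u_def v_def)
    show False
    proof (cases "lam i = lam j")
      case True
      have "(u + v) / 2 > u" "(u + v) / 2 < v" using uv by auto
      from pt[OF this] True disj[OF ij] show False by auto
    next
      case False
      show False
      proof (rule no_dilate[of "lam j - lam i" u v "2 powi (lam i)"])
        fix y assume y: "u < y" "y < v"
        have eq: "2 powi (lam j - lam i) * (2 powi (lam i) * y) = 2 powi (lam j) * y"
          by (simp add: mult.assoc[symmetric] power_int_add[symmetric])
        show "2 powi (lam i) * y \<in> K \<and> 2 powi (lam j - lam i) * (2 powi (lam i) * y) \<in> K"
          unfolding eq using pt[OF y] I_sub[OF ij(1)] I_sub[OF ij(2)] by blast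
      qed (use False uv in simp_all)
    qed
  qed
  have cover: "(\<Union>j\<in>{1..n}. {b j..c j}) = {?B / 2..?B}"
  proof
    have "{b j..c j} \<subseteq> {?B / 2..?B}" if "j \<in> {1..n}" for j
      using lam(1)[OF that] cB[OF that] by (auto simp: b_def)
    thus "(\<Union>j\<in>{1..n}. {b j..c j}) \<subseteq> {?B / 2..?B}" by blast
    show "{?B / 2..?B} \<subseteq> (\<Union>j\<in>{1..n}. {b j..c j})"
    proof (rule closed_covers_interval[OF _ _ dyad[unfolded dyadic_tile_def]])
      show "closed (\<Union>j\<in>{1..n}. {b j..c j})" by (intro closed_UN) auto
      fix y :: real assume y: "?B / 2 < y" "y < ?B" and "\<exists>!k::int. 2 powi k * y \<in> K"
      then obtain k where k: "2 powi k * y \<in> K" by blast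
      have y0: "y > 0" using y B by auto
      then obtain j where j: "j \<in> {1..n}" "2 powi k * y \<in> I j" using K_ex[OF k] by auto
      have e: "2 powi (k - lam j) * y = 2 powi (- lam j) * (2 powi k * y)"
      proof -
        have "(2::real) powi (k - lam j) = 2 powi (- lam j) * 2 powi k"
          by (simp add: power_int_add[symmetric])
        thus ?thesis by (simp add: mult.assoc)
      qed
      have "b j \<le> 2 powi (k - lam j) * y" "2 powi (k - lam j) * y \<le> c j"
        unfolding e b_def c_def using j I by (auto intro!: mult_left_mono)
      moreover from this have "k - lam j = 0"
        using lam(1)[OF j(1)] cB[OF j(1)] y by (intro dyadic_unique[of ?B y]) (auto simp: b_def)
      ultimately have "y \<in> {b j..c j}" by simp
      thus "y \<in> (\<Union>j\<in>{1..n}. {b j..c j})" using j(1) by blast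
    qed (use B in simp)
  qed
  obtain \<rho> a where \<rho>: "bij_betw \<rho> {1..n} {1..n}" and a: "a 0 = ?B / 2" "a n = ?B"
    "\<And>k. k \<in> {1..n} \<Longrightarrow> b (\<rho> k) = a (k - 1) \<and> c (\<rho> k) = a k"
    using interval_partition_sorted[OF finite_atLeastAtMost _ n bc dis cover] by auto
  have nn: "n \<in> {1..n}" using n by auto
  have \<rho>n: "\<rho> n \<in> {1..n}" using \<rho> nn by (auto simp: bij_betw_def)
  \<comment> \<open>The last interval of the partition and that of \<open>t\<close> both end at
    \<open>hi t\<close>, so they overlap and must coincide.\<close>
  have "\<rho> n = t"
  proof (rule ccontr)
    assume ne: "\<rho> n \<noteq> t"
    have "c (\<rho> n) = ?B" "c t = ?B" using a(3)[OF nn] a(2) lam_t by (auto simp: c_def)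
    hence "(max (b (\<rho> n)) (b t) + ?B) / 2 \<in> {b (\<rho> n)<..<c (\<rho> n)} \<inter> {b t<..<c t}"
      using bc[OF \<rho>n] bc[OF t] by auto
    thus False using dis[OF \<rho>n t ne] by blast
  qed
  thus ?thesis
    using lam_t \<rho> a by (intro exI[of _ lam] exI[of _ \<rho>] exI[of _ a]) (auto simp: b_def c_def)
qed

text \<open>\<open>s\<close> orders the intervals by folded position and \<open>\<rho>\<close> by
  rescaled position. Both orders end with the same interval, because \<open>dyadic_data\<close> is
  applied to the one that is folded onto the last cell.\<close>

lemma ex_wavelet_data:
  "\<exists>\<sigma> \<epsilon> \<tau> a m lam. \<sigma> permutes {1..n} \<and> wavelet_data n \<epsilon> \<tau> a m lam \<and>
     (\<forall>j\<in>{1..n}. I (\<sigma> j) = data_interval \<epsilon> a m j)"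
proof -
  obtain s \<epsilon> m a where s: "bij_betw s {1..n} {1..n}" and \<epsilon>: "\<And>k. k \<in> {1..n} \<Longrightarrow> \<epsilon> k \<in> {-1, 1}"
    and a: "a 0 = 0" "a n = 1 / 2" "\<And>k. k \<in> {1..n} \<Longrightarrow> a (k - 1) < a k"
    and Is: "\<And>k. k \<in> {1..n} \<Longrightarrow> I (s k) = data_interval \<epsilon> a m k"
    using translation_data by blast
  have nn: "n \<in> {1..n}" using n by auto
  have sin: "s k \<in> {1..n}" if "k \<in> {1..n}" for k using s that by (auto simp: bij_betw_def)
  obtain L \<rho> d where L: "L (s n) = 0" and \<rho>: "bij_betw \<rho> {1..n} {1..n}" "\<rho> n = s n"
    and d: "d 0 = hi (s n) / 2" "d n = hi (s n)"
      "\<And>k. k \<in> {1..n} \<Longrightarrow> 2 powi (- L (\<rho> k)) * lo (\<rho> k) = d (k - 1) \<and> 2 powi (- L (\<rho> k)) * hi (\<rho> k) = d k"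
    using dyadic_data[OF sin[OF nn]] by blast
  \<comment> \<open>Both orders are extended by the identity, as \<open>permutes\<close>
    demands.\<close>
  define \<sigma> where "\<sigma> = (\<lambda>k. if k \<in> {1..n} then s k else k)"
  define \<rho>' where "\<rho>' = (\<lambda>k. if k \<in> {1..n} then \<rho> k else k)"
  have \<sigma>: "\<sigma> permutes {1..n}"
  proof (rule bij_imp_permutes)
    show "bij_betw \<sigma> {1..n} {1..n}"
      using s by (subst bij_betw_cong[of _ _ s]) (auto simp: \<sigma>_def)
  qed (auto simp: \<sigma>_def)
  have \<rho>': "\<rho>' permutes {1..n}"
  proof (rule bij_imp_permutes)
    show "bij_betw \<rho>' {1..n} {1..n}"
      using \<rho>(1) by (subst bij_betw_cong[of _ _ \<rho>]) (auto simp: \<rho>'_def)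
  qed (auto simp: \<rho>'_def)
  \<comment> \<open>From the place in the folded order to the place in the rescaled order. The two
    orders agree at \<open>n\<close>, so \<open>n\<close> is fixed and \<open>\<tau>\<close>
    permutes the smaller indices.\<close>
  define \<tau> where "\<tau> = inv \<rho>' \<circ> \<sigma>"
  have \<tau>: "\<tau> permutes {1..n}" unfolding \<tau>_def by (rule permutes_compose[OF \<sigma> permutes_inv[OF \<rho>']])
  have \<rho>\<tau>: "\<rho>' (\<tau> j) = \<sigma> j" for j by (simp add: \<tau>_def permutes_inverses(1)[OF \<rho>'])
  have \<tau>n: "\<tau> n = n"
  proof -
    have "\<rho>' (\<tau> n) = \<rho>' n" unfolding \<rho>\<tau> using \<rho>(2) nn by (simp add: \<sigma>_def \<rho>'_def)
    thus ?thesis using permutes_inj[OF \<rho>'] by (auto dest: injD)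
  qed
  have \<tau>': "\<tau> permutes {1..n - 1}"
  proof (rule permutes_superset[OF \<tau>])
    fix x assume "x \<in> {1..n} - {1..n - 1}"
    hence "x = n" by auto
    thus "\<tau> x = x" using \<tau>n by simp
  qed
  have dlt: "d (k - 1) < d k" if k: "k \<in> {1..n}" for k
  proof -
    have r: "\<rho> k \<in> {1..n}" using \<rho> k by (auto simp: bij_betw_def)
    have "2 powi (- L (\<rho> k)) * lo (\<rho> k) < 2 powi (- L (\<rho> k)) * hi (\<rho> k)"
      using lo_hi[OF r] by (intro mult_strict_left_mono) auto
    thus ?thesis using d(3)[OF k] by simp
  qed
  \<comment> \<open>Consecutive cut points serve as end points, so
    \<open>\<beta> k = \<alpha> (k + 1)\<close> holds by construction.\<close>
  define \<alpha> \<beta> where "\<alpha> = (\<lambda>k. d (k - 1))" and "\<beta> = d"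
  have H: "{\<alpha> (\<tau> j)..\<beta> (\<tau> j)} = (\<lambda>x. 2 powi (- L (\<sigma> j)) * x) ` data_interval \<epsilon> a m j" if j: "j \<in> {1..n}" for j
  proof -
    have tj: "\<tau> j \<in> {1..n}" using permutes_in_image[OF \<tau>] j by blast
    have "\<rho> (\<tau> j) = s j" using \<rho>\<tau>[of j] tj j by (simp add: \<rho>'_def \<sigma>_def)
    hence "\<alpha> (\<tau> j) = 2 powi (- L (s j)) * lo (s j)" "\<beta> (\<tau> j) = 2 powi (- L (s j)) * hi (s j)"
      using d(3)[OF tj] by (auto simp: \<alpha>_def \<beta>_def)
    moreover have "data_interval \<epsilon> a m j = {lo (s j)..hi (s j)}" using Is[OF j] I[OF sin[OF j]] by simp
    moreover have "lo (s j) \<le> hi (s j)" using lo_hi[OF sin[OF j]] by simp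
    ultimately show ?thesis using j by (simp add: \<sigma>_def image_mult_atLeastAtMost)
  qed
  have sep: "m j \<noteq> m (j + 1)" if j: "j \<in> {1..n - 1}" and e: "\<epsilon> j = \<epsilon> (j + 1)" for j
  proof
    \<comment> \<open>With equal signs and integers both intervals would contain the image of the
      common cell end \<open>a j\<close>.\<close>
    assume mm: "m j = m (j + 1)"
    have j1: "j \<in> {1..n}" "j + 1 \<in> {1..n}" using j by auto
    have "of_int (\<epsilon> j) * a j + of_nat (m j) \<in> I (s j)"
      unfolding Is[OF j1(1)] data_interval_mem using a(3)[OF j1(1)] by auto
    moreover have "of_int (\<epsilon> j) * a j + of_nat (m j) \<in> I (s (j + 1))"
      unfolding Is[OF j1(2)] data_interval_mem e mm using a(3)[OF j1(2)] by auto
    moreover have "s j \<noteq> s (j + 1)" using s j1 by (auto simp: bij_betw_def dest: inj_onD)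
    ultimately show False using disj[OF sin[OF j1(1)] sin[OF j1(2)]] by blast
  qed
  have "\<exists>\<alpha> \<beta>.
        (\<forall>j\<in>{1..n - 1}. {\<alpha> (\<tau> j)..\<beta> (\<tau> j)} =
           (\<lambda>x. 2 powi (- L (\<sigma> j)) * x) ` data_interval \<epsilon> a m j) \<and>
        {\<alpha> n..\<beta> n} = data_interval \<epsilon> a m n \<and>
        2 * \<alpha> 1 = \<beta> n \<and>
        (\<forall>k\<in>{1..n - 1}. \<beta> k = \<alpha> (k + 1))"
  proof (rule exI[of _ \<alpha>], rule exI[of _ \<beta>], intro conjI ballI)
    show "{\<alpha> n..\<beta> n} = data_interval \<epsilon> a m n"
      using H[OF nn] \<tau>n L nn by (simp add: \<sigma>_def)
    show "2 * \<alpha> 1 = \<beta> n" using d by (simp add: \<alpha>_def \<beta>_def)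
    show "\<beta> k = \<alpha> (k + 1)" for k by (simp add: \<alpha>_def \<beta>_def)
    show "{\<alpha> (\<tau> j)..\<beta> (\<tau> j)} = (\<lambda>x. 2 powi (- L (\<sigma> j)) * x) ` data_interval \<epsilon> a m j" if "j \<in> {1..n - 1}" for j
      by (rule H) (use that in auto)
  qed
  hence "wavelet_data n \<epsilon> \<tau> a m (\<lambda>j. L (\<sigma> j))"
    unfolding wavelet_data_def using n \<epsilon> \<tau>' a sep by (intro conjI ballI impI) assumption+
  moreover have "I (\<sigma> j) = data_interval \<epsilon> a m j" if "j \<in> {1..n}" for j
    using Is[OF that] that by (simp add: \<sigma>_def)
  ultimately show ?thesis using \<sigma> by blast
qed

end

lemma wavelet_set_imp_data:
  assumes n: "n \<ge> 1" and sym: "symmetric_set K" and I: "disjoint_intervals n I"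
    and K: "K \<inter> {0..} = (\<Union>j\<in>{1..n}. I j)" and W: "wavelet_set K"
  shows "\<exists>\<sigma> \<epsilon> \<tau> a m lam. \<sigma> permutes {1..n} \<and> wavelet_data n \<epsilon> \<tau> a m lam \<and>
     (\<forall>j\<in>{1..n}. I (\<sigma> j) = data_interval \<epsilon> a m j)"
proof -
  have sym': "x \<in> K \<longleftrightarrow> - x \<in> K" for x
  proof -
    have *: "y \<in> K \<longleftrightarrow> - y \<in> K" if "y \<ge> 0" for y
    proof
      assume "y \<in> K"
      hence "- y \<in> uminus ` (K \<inter> {0..})" using that by auto
      thus "- y \<in> K" using sym unfolding symmetric_set_def by auto
    next
      assume "- y \<in> K"
      hence "- y \<in> uminus ` (K \<inter> {0..})" using that sym unfolding symmetric_set_def by auto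
      thus "y \<in> K" by auto
    qed
    show ?thesis using *[of x] *[of "- x"] by (cases "x \<ge> 0") auto
  qed
  have Ij: "\<exists>w. I j = {fst w..snd w} \<and> fst w < snd w" if j: "j \<in> {1..n}" for j
  proof -
    have i: "is_interval (I j)" "closed (I j)" "interior (I j) \<noteq> {}"
      using I j unfolding disjoint_intervals_def by auto
    have pos: "x \<ge> 0" "x \<in> K" if "x \<in> I j" for x using K j that by auto
    obtain y where y: "y \<in> I j" using i(3) interior_subset by blast
    have "bounded (I j)"
    proof -
      \<comment> \<open>Since \<open>K\<close> contains no half-line, \<open>I j\<close> misses a
        point to the right of \<open>y\<close>, and by convexity that point bounds it.\<close>
      obtain u where u: "u \<ge> y" "u \<notin> I j"
        using wavelet_set_no_halfline[OF W, of y] pos(2) by force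
      have "x \<le> u" if x: "x \<in> I j" for x
      proof (rule ccontr)
        assume "\<not> x \<le> u"
        hence "u \<in> I j" using i(1) x y u(1) unfolding is_interval_1 by (meson linear)
        thus False using u(2) by simp
      qed
      hence "I j \<subseteq> {0..u}" using pos by auto
      thus ?thesis using bounded_subset bounded_closed_interval by blast
    qed
    hence "compact (I j)" using i(2) by (simp add: compact_eq_bounded_closed)
    then obtain u v where uv: "I j = {u..v}" using i(1) is_interval_compact[of "I j"] by (auto simp: cbox_interval)
    have "u < v" using i(3) unfolding uv interior_atLeastAtMost_real by auto
    thus ?thesis using uv by (intro exI[of _ "(u, v)"]) simp
  qed
  have "\<forall>j\<in>{1..n}. \<exists>w. I j = {fst w..snd w} \<and> fst w < snd w"
    using Ij by (intro ballI)
  from bchoice[OF this] obtain w where w: "\<forall>j\<in>{1..n}. I j = {fst (w j)..snd (w j)} \<and> fst (w j) < snd (w j)"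
    by blast
  have "bounded (\<Union>j\<in>{1..n}. I j)" using w by (intro bounded_UN) auto
  hence "bounded (K \<inter> {0..} \<union> uminus ` (K \<inter> {0..}))" unfolding K by simp
  moreover have "K \<subseteq> K \<inter> {0..} \<union> uminus ` (K \<inter> {0..})"
    using sym unfolding symmetric_set_def by auto
  ultimately have Kb: "bounded K" by (rule bounded_subset)
  have Ks: "K \<in> sets lebesgue" using W by (simp add: wavelet_set_def)
  have dis: "I i \<inter> I j = {}" if "i \<in> {1..n}" "j \<in> {1..n}" "i \<noteq> j" for i j
    using I that unfolding disjoint_intervals_def disjoint_family_on_def by blast
  interpret interval_tiling n K I "\<lambda>j. fst (w j)" "\<lambda>j. snd (w j)"
    using n sym' w dis K W wavelet_set_iff_tile[OF Ks Kb] by unfold_locales blast+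
  show ?thesis by (rule ex_wavelet_data)
qed

text \<open>The intervals come in an arbitrary numbering, whereas the data number them by their
  cells in \<open>[0, 1/2]\<close>; \<open>\<sigma>\<close> translates between the two. Equality of
  data refers to the relevant entries, and for \<open>lam\<close> these end at \<open>n - 1\<close>,
  since the last interval is not rescaled.\<close>

theorem proposition6:
  "(\<forall>n K I. n \<ge> 1 \<and> symmetric_set K \<and> disjoint_intervals n I \<and>
        K \<inter> {0..} = (\<Union>j\<in>{1..n}. I j) \<longrightarrow>
      (wavelet_set K \<longleftrightarrow>
        (\<exists>\<sigma> \<epsilon> \<tau> a m lam. \<sigma> permutes {1..n} \<and> wavelet_data n \<epsilon> \<tau> a m lam \<and>
           (\<forall>j\<in>{1..n}. I (\<sigma> j) = data_interval \<epsilon> a m j)))) \<and>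
   (\<forall>n \<epsilon> \<tau> a m lam. wavelet_data n \<epsilon> \<tau> a m lam \<longrightarrow>
      wavelet_set (data_set n \<epsilon> a m) \<and>
      (\<exists>J. disjoint_intervals (2 * n) J \<and> data_set n \<epsilon> a m = (\<Union>i\<in>{1..2 * n}. J i))) \<and>
   (\<forall>n \<epsilon> \<tau> a m lam n' \<epsilon>' \<tau>' a' m' lam'.
      wavelet_data n \<epsilon> \<tau> a m lam \<and> wavelet_data n' \<epsilon>' \<tau>' a' m' lam' \<and>
      data_set n \<epsilon> a m = data_set n' \<epsilon>' a' m' \<longrightarrow>
        n = n' \<and> \<tau> = \<tau>' \<and>
        (\<forall>j\<in>{1..n}. \<epsilon> j = \<epsilon>' j \<and> m j = m' j) \<and>
        (\<forall>j\<in>{0..n}. a j = a' j) \<and>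
        (\<forall>j\<in>{1..n - 1}. lam j = lam' j))"
proof (intro conjI allI impI)
  fix n \<epsilon> \<tau> a m lam assume *: "wavelet_data n \<epsilon> \<tau> a m lam"
  show "wavelet_set (data_set n \<epsilon> a m)"
    using * by (rule wavelet_dataE) (rule wavelet_configuration.K_wavelet_set)
  show "\<exists>J. disjoint_intervals (2 * n) J \<and> data_set n \<epsilon> a m = (\<Union>i\<in>{1..2 * n}. J i)"
    using * by (rule wavelet_dataE) (rule wavelet_configuration.K_disjoint_union)
next
  fix n K I
  assume *: "n \<ge> 1 \<and> symmetric_set K \<and> disjoint_intervals n I \<and> K \<inter> {0..} = (\<Union>j\<in>{1..n}. I j)"
  show "wavelet_set K \<longleftrightarrow> (\<exists>\<sigma> \<epsilon> \<tau> a m lam. \<sigma> permutes {1..n} \<and> wavelet_data n \<epsilon> \<tau> a m lam \<and>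
           (\<forall>j\<in>{1..n}. I (\<sigma> j) = data_interval \<epsilon> a m j))" (is "_ \<longleftrightarrow> ?data")
  proof
    assume W: "wavelet_set K"
    show ?data by (rule wavelet_set_imp_data[OF _ _ _ _ W]) (use * in blast)+
  next
    assume ?data
    then obtain \<sigma> \<epsilon> \<tau> a m lam where \<sigma>: "\<sigma> permutes {1..n}" and data: "wavelet_data n \<epsilon> \<tau> a m lam"
      and I: "\<forall>j\<in>{1..n}. I (\<sigma> j) = data_interval \<epsilon> a m j" by blast
    have "(\<Union>j\<in>{1..n}. I j) = (\<Union>j\<in>\<sigma> ` {1..n}. I j)" by (simp only: permutes_image[OF \<sigma>])
    also have "\<dots> = (\<Union>j\<in>{1..n}. data_interval \<epsilon> a m j)" using I by simp
    finally have pos: "K \<inter> {0..} = (\<Union>j\<in>{1..n}. data_interval \<epsilon> a m j)" using * by simp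
    have "K = K \<inter> {0..} \<union> K \<inter> {..0}" by auto
    also have "K \<inter> {..0} = uminus ` (K \<inter> {0..})" using * by (simp add: symmetric_set_def)
    finally have "K = data_set n \<epsilon> a m" unfolding pos data_set_def by blast
    moreover have "wavelet_set (data_set n \<epsilon> a m)"
      using data by (rule wavelet_dataE) (rule wavelet_configuration.K_wavelet_set)
    ultimately show "wavelet_set K" by simp
  qed
next
  fix n \<epsilon> \<tau> a m lam n' \<epsilon>' \<tau>' a' m' lam'
  assume *: "wavelet_data n \<epsilon> \<tau> a m lam \<and> wavelet_data n' \<epsilon>' \<tau>' a' m' lam' \<and>
      data_set n \<epsilon> a m = data_set n' \<epsilon>' a' m'"
  obtain \<alpha> \<beta> where c: "wavelet_configuration n \<epsilon> \<tau> a m lam \<alpha> \<beta>"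
    using conjunct1[OF *] by (rule wavelet_dataE)
  obtain \<alpha>' \<beta>' where d: "wavelet_configuration n' \<epsilon>' \<tau>' a' m' lam' \<alpha>' \<beta>'"
    using conjunct1[OF conjunct2[OF *]] by (rule wavelet_dataE)
  have "configuration_pair n \<epsilon> \<tau> a m lam \<alpha> \<beta> n' \<epsilon>' \<tau>' a' m' lam' \<alpha>' \<beta>'"
    using c d * by (simp add: configuration_pair_def configuration_pair_axioms_def)
  note uniq = configuration_pair.data_unique[OF this]
  show "n = n'" "\<tau> = \<tau>'" "\<forall>j\<in>{1..n}. \<epsilon> j = \<epsilon>' j \<and> m j = m' j"
    "\<forall>j\<in>{0..n}. a j = a' j" "\<forall>j\<in>{1..n - 1}. lam j = lam' j" using uniq by blast+
qed

end
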